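(* Let $E/\mathbb{Q}$ be an elliptic curve and let $\mathbf{P}=(P_1,P_2)\in E(\mathbb{Q})^2$ be a pair consisting of points of infinite order. Let $p$ be an odd prime such that $P_1$ and $P_2$ modulo $p$ are nonsingular and let $r>3$ be the order of $P_1$ modulo $p$. Let $p^v$ be the highest power of $p$ such that $[r]P_1\equiv\mathcal{O}\pmod{p^v}$ and write $r_l=p^{l-v}r$ for $l\ge v$. Let $(\Phi_n(\mathbf{P}))_{n\ge1}$ and $(\overline{\Omega}_n(\mathbf{P}))_{n\ge1}$ be the sequences of values of the translated division polynomials of $E$ at $\mathbf{P}$. Then the sequences $(\Phi_n(\mathbf{P})\bmod p^l)_{n\ge1}$ and $(\overline{\Omega}_n(\mathbf{P})\bmod p^l)_{n\ge1}$ are purely periodic with periods $r_lt_l$ and $r_lt_l'$ respectively, for some integers $t_l,t_l'$ dividing $p^{l-1}(p-1)$, for all positive integers $l$.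
   Context: A sequence $(s_n)$ is purely periodic with period $\pi\ge1$ if $s_{n+\pi}=s_n$ for all indices $n$ of the sequence; for a sequence taken modulo $p^l$ the equality is replaced by congruence modulo $p^l$. For rational numbers $u,w$, $u\equiv w\pmod{p^l}$ means $u-w\in p^l\mathbb{Z}_{(p)}$, where $\mathbb{Z}_{(p)}$ is the ring of rational numbers with denominator prime to $p$. Reduction. $E$ is given by a Weierstrass equation with $p$-integral coefficients $a_1,a_2,a_3,a_4,a_6$. A point $Q\in E(\mathbb{Q})$ is nonsingular modulo $p$ if it reduces to a nonsingular point of the reduced cubic over $\mathbb{F}_p$; its order modulo $p$ is its order in the group of nonsingular points. For $k\ge1$, $Q\equiv\mathcal{O}\pmod{p^k}$ means $Q=\mathcal{O}$ or $\mathrm{ord}_p(x(Q))\le-2k$. Translated division polynomials (defined for $P_1,P_2,P_2\pm P_1\ne\mathcal{O}$). Let $f^*(x,y)=y^2+\alpha_1xy+\alpha_3y-x^3-\alpha_2x^2-\alpha_4x-\alpha_6$ and $R^*=\mathbb{Z}[\alpha_1,\alpha_2,\alpha_3,\alpha_4,\alpha_6][x_1,y_1,x_2,y_2][(x_1-x_2)^{-1}]/\langle f^*(x_1,y_1),f^*(x_2,y_2)\rangle$. Let $\beta_1=2y_1+\alpha_1x_1+\alpha_3$ and $\beta_2=3x_1^4+b_2x_1^3+3b_4x_1^2+3b_6x_1+b_8$ with $b_i$ the usual Weierstrass quantities attached to the $\alpha_i$. The elements $\Psi_n\in R^*$ ($n\in\mathbb{Z}$) are determined by $\Psi_{-1}=x_1-x_2$,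 $\Psi_0=\Psi_1=1$, $\Psi_2=2x_1+x_2-\left(\frac{y_2-y_1}{x_2-x_1}\right)^2-\alpha_1\frac{y_2-y_1}{x_2-x_1}+\alpha_2$, and $\Psi_{m+2}\Psi_{m-2}=\beta_1^2\Psi_{m+1}\Psi_{m-1}-\beta_2\Psi_m^2$ for all $m\in\mathbb{Z}$. The values $\Psi_n(\mathbf{P})$ are obtained by specializing $\alpha_i\mapsto a_i$ and $(x_i,y_i)\mapsto$ the coordinates of $P_i$. Further, evaluating at $\mathbf{P}$, $\Phi_n=x_1\Psi_n^2-\Psi_{n+1}\Psi_{n-1}$ and $\overline{\Omega}_n=\left(\Psi_{n-1}^2\Psi_{n+2}-\Psi_{n-2}\Psi_{n+1}^2-\beta_1\Psi_n(a_1\Phi_n+a_3\Psi_n^2)\right)/(2\beta_1)$. When $[n]P_1+P_2\ne\mathcal{O}$ one has $[n]P_1+P_2=\left(\Phi_n(\mathbf{P})/\Psi_n(\mathbf{P})^2,\ \overline{\Omega}_n(\mathbf{P})/\Psi_n(\mathbf{P})^3\right)$.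
   Formalization: It is additionally assumed that neither P_2 nor P_1+P_2 is congruent to O modulo p, since otherwise the claim is false (y^2+y=x^3-x, P_1=(0,0), P_2=[6]P_1 or [7]P_1, p=3); for l<v, where r_l was left undefined, r_l is taken to be r. *)

theory Defs
  imports
    "HOL-Computational_Algebra.Computational_Algebra"
    "HOL-Library.Poly_Mapping"
    "Berlekamp_Zassenhaus.Finite_Field"
begin

section \<open>Weierstrass cubics and the chord-tangent law over a field\<close>

datatype 'a weierstrass =
  Weierstrass (a1: 'a) (a2: 'a) (a3: 'a) (a4: 'a) (a6: 'a)

definition b2 :: "'a::comm_ring_1 weierstrass \<Rightarrow> 'a" where
  "b2 E = a1 E ^ 2 + 4 * a2 E"

definition b4 :: "'a::comm_ring_1 weierstrass \<Rightarrow> 'a" where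
  "b4 E = 2 * a4 E + a1 E * a3 E"

definition b6 :: "'a::comm_ring_1 weierstrass \<Rightarrow> 'a" where
  "b6 E = a3 E ^ 2 + 4 * a6 E"

definition b8 :: "'a::comm_ring_1 weierstrass \<Rightarrow> 'a" where
  "b8 E = a1 E ^ 2 * a6 E + 4 * a2 E * a6 E - a1 E * a3 E * a4 E
          + a2 E * a3 E ^ 2 - a4 E ^ 2"

definition discriminant :: "'a::comm_ring_1 weierstrass \<Rightarrow> 'a" where
  "discriminant E = - (b2 E ^ 2) * b8 E - 8 * b4 E ^ 3 - 27 * b6 E ^ 2 + 9 * b2 E * b4 E * b6 E"

definition elliptic_curve :: "'a::field weierstrass \<Rightarrow> bool" where
  "elliptic_curve E \<longleftrightarrow> discriminant E \<noteq> 0"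

definition weierstrass_eq :: "'a::comm_ring_1 weierstrass \<Rightarrow> 'a \<Rightarrow> 'a \<Rightarrow> 'a" where
  "weierstrass_eq E x y =
     y ^ 2 + a1 E * x * y + a3 E * y - x ^ 3 - a2 E * x ^ 2 - a4 E * x - a6 E"

datatype 'a point = Infinity | Affine (x_of: 'a) (y_of: 'a)

fun on_curve :: "'a::field weierstrass \<Rightarrow> 'a point \<Rightarrow> bool" where
  "on_curve E Infinity \<longleftrightarrow> True"
| "on_curve E (Affine x y) \<longleftrightarrow> weierstrass_eq E x y = 0"

text \<open>
  For affine points the condition says that the partial derivatives of the Weierstrass
  equation do not both vanish. The point at infinity of a Weierstrass cubic is never singular.
\<close>

fun nonsingular_point :: "'a::field weierstrass \<Rightarrow> 'a point \<Rightarrow> bool" where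
  "nonsingular_point E Infinity \<longleftrightarrow> True"
| "nonsingular_point E (Affine x y) \<longleftrightarrow> weierstrass_eq E x y = 0 \<and>
     (a1 E * y - 3 * x ^ 2 - 2 * a2 E * x - a4 E \<noteq> 0 \<or> 2 * y + a1 E * x + a3 E \<noteq> 0)"

fun point_neg :: "'a::field weierstrass \<Rightarrow> 'a point \<Rightarrow> 'a point" where
  "point_neg E Infinity = Infinity"
| "point_neg E (Affine x y) = Affine x (- y - a1 E * x - a3 E)"

text \<open>
  The formulas give the group law on the nonsingular points of the cubic, also when the cubic
  itself is singular.
\<close>

fun point_add :: "'a::field weierstrass \<Rightarrow> 'a point \<Rightarrow> 'a point \<Rightarrow> 'a point" where
  "point_add E Infinity Q = Q"
| "point_add E P Infinity = P"
| "point_add E (Affine x1 y1) (Affine x2 y2) =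
     (if x1 = x2 \<and> y1 + y2 + a1 E * x2 + a3 E = 0 then Infinity
      else
        let l = (if x1 = x2
                 then (3 * x1 ^ 2 + 2 * a2 E * x1 + a4 E - a1 E * y1) / (2 * y1 + a1 E * x1 + a3 E)
                 else (y2 - y1) / (x2 - x1));
            x3 = l ^ 2 + a1 E * l - a2 E - x1 - x2
        in Affine x3 (l * (x1 - x3) - y1 - a1 E * x3 - a3 E))"

definition point_mult :: "'a::field weierstrass \<Rightarrow> nat \<Rightarrow> 'a point \<Rightarrow> 'a point" where
  "point_mult E n P = (point_add E P ^^ n) Infinity"

definition infinite_order :: "'a::field weierstrass \<Rightarrow> 'a point \<Rightarrow> bool" where
  "infinite_order E P \<longleftrightarrow> (\<forall>n>0. point_mult E n P \<noteq> Infinity)"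

definition has_order :: "'a::field weierstrass \<Rightarrow> 'a point \<Rightarrow> nat \<Rightarrow> bool" where
  "has_order E P r \<longleftrightarrow> r > 0 \<and> point_mult E r P = Infinity \<and>
     (\<forall>m. 0 < m \<and> m < r \<longrightarrow> point_mult E m P \<noteq> Infinity)"


section \<open>Reduction modulo a prime\<close>

definition p_integral :: "nat \<Rightarrow> rat \<Rightarrow> bool" where
  "p_integral p u \<longleftrightarrow> coprime (snd (quotient_of u)) (int p)"

definition rat_cong :: "nat \<Rightarrow> nat \<Rightarrow> rat \<Rightarrow> rat \<Rightarrow> bool" where
  "rat_cong p l u w \<longleftrightarrow> (\<exists>z. p_integral p z \<and> u - w = of_nat p ^ l * z)"

text \<open>The value at 0, which should be infinite, is 0 here.\<close>

definition rat_ord :: "nat \<Rightarrow> rat \<Rightarrow> int" where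
  "rat_ord p u = int (multiplicity (int p) (fst (quotient_of u)))
               - int (multiplicity (int p) (snd (quotient_of u)))"

text \<open>
  Congruence to the point at infinity modulo \<open>p\<^sup>k\<close>, for \<open>k \<ge> 1\<close>; the convention on \<^term>\<open>rat_ord p 0\<close>
  is then harmless.
\<close>

fun cong_infinity :: "nat \<Rightarrow> nat \<Rightarrow> rat point \<Rightarrow> bool" where
  "cong_infinity p k Infinity \<longleftrightarrow> True"
| "cong_infinity p k (Affine x y) \<longleftrightarrow> rat_ord p x \<le> - 2 * int k"

text \<open>
  The prime is the cardinality of the index type \<open>'p\<close> of the field \<open>'p mod_ring\<close> with \<open>p\<close>
  elements. The map is meaningful on \<open>p\<close>-integral rationals only.
\<close>

definition reduce :: "rat \<Rightarrow> 'p::prime_card mod_ring" where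
  "reduce u = of_int (fst (quotient_of u)) / of_int (snd (quotient_of u))"

definition p_integral_curve :: "nat \<Rightarrow> rat weierstrass \<Rightarrow> bool" where
  "p_integral_curve p E \<longleftrightarrow> (\<forall>c \<in> set_weierstrass E. p_integral p c)"

definition reduce_curve :: "rat weierstrass \<Rightarrow> 'p::prime_card mod_ring weierstrass" where
  "reduce_curve E = map_weierstrass reduce E"

text \<open>
  On a curve with \<open>p\<close>-integral coefficients, the coordinates of a rational affine point are
  either both \<open>p\<close>-integral or both not, and in the latter case the point reduces to infinity.
\<close>

fun reduce_point :: "rat point \<Rightarrow> 'p::prime_card mod_ring point" where
  "reduce_point Infinity = Infinity"
| "reduce_point (Affine x y) =
     (if p_integral CARD('p) x \<and> p_integral CARD('p) y
      then Affine (reduce x) (reduce y) else Infinity)"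


section \<open>The ring of translated division polynomials\<close>

text \<open>
  \<open>\<int>[\<alpha>\<^sub>1, \<alpha>\<^sub>2, \<alpha>\<^sub>3, \<alpha>\<^sub>4, \<alpha>\<^sub>6, x\<^sub>1, y\<^sub>1, x\<^sub>2, y\<^sub>2, u]\<close> as the monoid ring of finitely supported
  exponent vectors. The variable \<open>u\<close> serves as inverse of \<open>x\<^sub>1 - x\<^sub>2\<close>, so that
  \<open>R\<^sup>* = \<int>[\<alpha>, x\<^sub>1, y\<^sub>1, x\<^sub>2, y\<^sub>2, u] / (f\<^sup>*(x\<^sub>1, y\<^sub>1), f\<^sup>*(x\<^sub>2, y\<^sub>2), u (x\<^sub>1 - x\<^sub>2) - 1)\<close>.
  Elements of \<open>R\<^sup>*\<close> are given by representatives, and equality in \<open>R\<^sup>*\<close> is the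
  relation \<open>rstar_eq\<close>.
\<close>

datatype indet = Al1 | Al2 | Al3 | Al4 | Al6 | X1 | Y1 | X2 | Y2 | U

type_synonym mpoly_indet = "(indet \<Rightarrow>\<^sub>0 nat) \<Rightarrow>\<^sub>0 int"

definition Var :: "indet \<Rightarrow> mpoly_indet" where
  "Var v = Poly_Mapping.single (Poly_Mapping.single v 1) 1"

definition eval_mpoly :: "(indet \<Rightarrow> 'a::comm_ring_1) \<Rightarrow> mpoly_indet \<Rightarrow> 'a" where
  "eval_mpoly s g =
     (\<Sum>m \<in> Poly_Mapping.keys g. of_int (Poly_Mapping.lookup g m) *
        (\<Prod>v \<in> Poly_Mapping.keys m. s v ^ Poly_Mapping.lookup m v))"

definition generic_curve :: "mpoly_indet weierstrass" where
  "generic_curve = Weierstrass (Var Al1) (Var Al2) (Var Al3) (Var Al4) (Var Al6)"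

definition rstar_eq :: "mpoly_indet \<Rightarrow> mpoly_indet \<Rightarrow> bool" where
  "rstar_eq g h \<longleftrightarrow> (\<exists>c1 c2 c3. g - h =
      c1 * weierstrass_eq generic_curve (Var X1) (Var Y1)
    + c2 * weierstrass_eq generic_curve (Var X2) (Var Y2)
    + c3 * (Var U * (Var X1 - Var X2) - 1))"

definition beta1 :: "'a::comm_ring_1 weierstrass \<Rightarrow> 'a \<Rightarrow> 'a \<Rightarrow> 'a" where
  "beta1 E x y = 2 * y + a1 E * x + a3 E"

definition beta2 :: "'a::comm_ring_1 weierstrass \<Rightarrow> 'a \<Rightarrow> 'a" where
  "beta2 E x = 3 * x ^ 4 + b2 E * x ^ 3 + 3 * b4 E * x ^ 2 + 3 * b6 E * x + b8 E"

text \<open>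
  The slope \<open>(y\<^sub>2 - y\<^sub>1) / (x\<^sub>2 - x\<^sub>1)\<close> is \<open>(y\<^sub>1 - y\<^sub>2) u\<close>. Modulo \<open>rstar_eq\<close> there is exactly one
  family with the following property.
\<close>

definition translated_division_polynomials :: "(int \<Rightarrow> mpoly_indet) \<Rightarrow> bool" where
  "translated_division_polynomials Psi \<longleftrightarrow>
     (let slope = (Var Y1 - Var Y2) * Var U;
          be1 = beta1 generic_curve (Var X1) (Var Y1);
          be2 = beta2 generic_curve (Var X1)
      in rstar_eq (Psi (- 1)) (Var X1 - Var X2) \<and>
         rstar_eq (Psi 0) 1 \<and>
         rstar_eq (Psi 1) 1 \<and>
         rstar_eq (Psi 2) (2 * Var X1 + Var X2 - slope ^ 2 - Var Al1 * slope + Var Al2) \<and>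
         (\<forall>m. rstar_eq (Psi (m + 2) * Psi (m - 2))
                       (be1 ^ 2 * Psi (m + 1) * Psi (m - 1) - be2 * Psi m ^ 2)))"

text \<open>
  The specialization at \<open>E\<close> and \<open>(P\<^sub>1, P\<^sub>2)\<close>, for affine points with distinct \<open>x\<close>-coordinates.
  Being a ring homomorphism that kills the three generators of the ideal, its value depends on the
  class in \<open>R\<^sup>*\<close> only.
\<close>

fun specialization :: "'a::field weierstrass \<Rightarrow> 'a point \<Rightarrow> 'a point \<Rightarrow> indet \<Rightarrow> 'a" where
  "specialization E P1 P2 Al1 = a1 E"
| "specialization E P1 P2 Al2 = a2 E"
| "specialization E P1 P2 Al3 = a3 E"
| "specialization E P1 P2 Al4 = a4 E"
| "specialization E P1 P2 Al6 = a6 E"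
| "specialization E P1 P2 X1 = x_of P1"
| "specialization E P1 P2 Y1 = y_of P1"
| "specialization E P1 P2 X2 = x_of P2"
| "specialization E P1 P2 Y2 = y_of P2"
| "specialization E P1 P2 U = 1 / (x_of P1 - x_of P2)"

definition Psi_val ::
  "(int \<Rightarrow> mpoly_indet) \<Rightarrow> 'a::field weierstrass \<Rightarrow> 'a point \<Rightarrow> 'a point \<Rightarrow> int \<Rightarrow> 'a" where
  "Psi_val Psi E P1 P2 n = eval_mpoly (specialization E P1 P2) (Psi n)"

definition Phi_val ::
  "(int \<Rightarrow> mpoly_indet) \<Rightarrow> 'a::field weierstrass \<Rightarrow> 'a point \<Rightarrow> 'a point \<Rightarrow> int \<Rightarrow> 'a" where
  "Phi_val Psi E P1 P2 n =
     x_of P1 * Psi_val Psi E P1 P2 n ^ 2 - Psi_val Psi E P1 P2 (n + 1) * Psi_val Psi E P1 P2 (n - 1)"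

definition Omega_val ::
  "(int \<Rightarrow> mpoly_indet) \<Rightarrow> 'a::field weierstrass \<Rightarrow> 'a point \<Rightarrow> 'a point \<Rightarrow> int \<Rightarrow> 'a" where
  "Omega_val Psi E P1 P2 n =
     (let psi = Psi_val Psi E P1 P2; be1 = beta1 E (x_of P1) (y_of P1)
      in (psi (n - 1) ^ 2 * psi (n + 2) - psi (n - 2) * psi (n + 1) ^ 2
          - be1 * psi n * (a1 E * Phi_val Psi E P1 P2 n + a3 E * psi n ^ 2)) / (2 * be1))"


section \<open>Periodicity\<close>

text \<open>Pure periodicity modulo \<open>p\<^sup>l\<close> of a sequence with index set \<open>{1..}\<close>.\<close>

definition purely_periodic_mod :: "nat \<Rightarrow> nat \<Rightarrow> (nat \<Rightarrow> rat) \<Rightarrow> nat \<Rightarrow> bool" where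
  "purely_periodic_mod p l s per \<longleftrightarrow> per \<ge> 1 \<and> (\<forall>n\<ge>1. rat_cong p l (s (n + per)) (s n))"

text \<open>
  \<open>r\<^sub>l = p\<^bsup>l - v\<^esup> r\<close> for \<open>l \<ge> v\<close>. For \<open>l < v\<close> the value is \<open>r\<close>, because then already
  \<open>[r]P\<^sub>1\<close> is congruent to infinity modulo \<open>p\<^sup>l\<close>.
\<close>

definition r_level :: "nat \<Rightarrow> nat \<Rightarrow> nat \<Rightarrow> nat \<Rightarrow> nat" where
  "r_level p v r l = (if l \<ge> v then p ^ (l - v) * r else r)"

end

theory Submission
  imports Defs "HOL-Number_Theory.Residues"
begin

text \<open>
  Let \<open>w\<close> be the elliptic divisibility sequence of \<open>P1\<close>, so that
  \<open>x(P1) - x([n]P1) = w (n + 1) w (n - 1) / w n\<^sup>2\<close>, and \<open>f n\<close> the value of \<open>\<Psi>\<^sub>n\<close>. Both satisfy the same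
  Somos-4 recurrence and a cubic relation with the same constant \<open>J\<close>, and hence the addition formulas
  \<open>f (m + k) f (m - k) = w k\<^sup>2 f (m + 1) f (m - 1) - w (k + 1) w (k - 1) f m\<^sup>2\<close> and their analogue for
  odd index sums. If \<open>p\<^sup>l\<close> divides \<open>w k\<close>, these become
  \<open>f (m + k) f (m - k) = - w (k + 1) w (k - 1) f m\<^sup>2\<close> modulo \<open>p\<^sup>l\<close>, and \<open>f (m + k) / f m\<close> is a geometric
  progression in \<open>m\<close> with unit coefficients. Iterating \<open>p\<^bsup>l - 1\<^esup> (p - 1)\<close> times kills these units, so
  already \<open>f\<close> itself is periodic, with \<open>t\<^sub>l = t\<^sub>l' = p\<^bsup>l - 1\<^esup> (p - 1)\<close>. The denominator of \<open>[r]P1\<close> shows that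
  \<open>p\<^sup>v\<close> divides \<open>w r\<close>, and replacing \<open>k\<close> by \<open>p k\<close> gains one power of \<open>p\<close>, so \<open>k = r\<^sub>l\<close> is admissible.
\<close>

section \<open>Evaluation of representatives of elements of the ring\<close>

text \<open>All relations come from the differences e m = x1 - x([m]P1 + P2). The sum and the
  product of e (m + 1) and e (m - 1) are rational functions of e m with coefficients depending on P1
  only; this is why \<open>f\<close> and \<open>w\<close> share \<open>\<alpha>\<close>,
  \<open>\<beta>\<close> and \<open>J\<close>. The sequence \<open>w\<close> is the case P2 = O.
  Zeros are the obstacle, at two levels. Over the rationals the addition formulas are proved by
  cancelling values, which may vanish; hence the deformation of P2. Modulo p the quotient f (m + k)
  / f m makes sense at units only. As \<open>\<beta>\<close> is a unit and f 0 = f 1 = 1, no two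
  neighbouring values with nonnegative index are both divisible by p, and a single gap is bridged by
  a relation with step two. The order r > 3 makes w 2 and w 3 units. Oddness of p serves twice:
  \<open>Omega_val\<close> divides by 2, and the exponent p^(l-1) (p-1) has to be even because T
  choose 2 arises when a geometric shift is iterated T times. That P2 and P2 + P1 do not reduce to O
  makes the values at -1 and 2, the data of the recurrence, p-integral.\<close>

definition eval_monom :: "(indet \<Rightarrow> 'a::comm_ring_1) \<Rightarrow> (indet \<Rightarrow>\<^sub>0 nat) \<Rightarrow> 'a" where
  "eval_monom s m = (\<Prod>v\<in>Poly_Mapping.keys m. s v ^ Poly_Mapping.lookup m v)"

text \<open>With finitely many variables a monomial is a product over all of them, so that
  multiplying monomials adds exponents factor by factor; products over supports would not
  match.\<close>

instance indet :: finite
proof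
  have "(UNIV :: indet set) = {Al1, Al2, Al3, Al4, Al6, X1, Y1, X2, Y2, U}"
    using indet.exhaust by blast
  thus "finite (UNIV :: indet set)" by (metis finite.emptyI finite_insert)
qed

lemma eval_monom_UNIV: "eval_monom s m = (\<Prod>v\<in>UNIV. s v ^ Poly_Mapping.lookup m v)"
  unfolding eval_monom_def
  by (rule prod.mono_neutral_left) (auto simp: in_keys_iff)

lemma eval_monom_add: "eval_monom s (m + n) = eval_monom s m * eval_monom s n"
  by (simp add: eval_monom_UNIV lookup_add power_add prod.distrib)

lemma eval_mpoly_superset:
  assumes "finite A" "Poly_Mapping.keys g \<subseteq> A"
  shows "eval_mpoly s g = (\<Sum>m\<in>A. of_int (Poly_Mapping.lookup g m) * eval_monom s m)"
  unfolding eval_mpoly_def eval_monom_def[symmetric]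
  by (rule sum.mono_neutral_left) (use assms in \<open>auto simp: in_keys_iff\<close>)

lemma eval_mpoly_add: "eval_mpoly s (g + h) = eval_mpoly s g + eval_mpoly s h"
proof -
  let ?A = "Poly_Mapping.keys g \<union> Poly_Mapping.keys h"
  have "eval_mpoly s (g + h) = (\<Sum>m\<in>?A. of_int (Poly_Mapping.lookup (g + h) m) * eval_monom s m)"
    by (rule eval_mpoly_superset) (auto simp: in_keys_iff lookup_add)
  also have "\<dots> = eval_mpoly s g + eval_mpoly s h"
    by (simp add: eval_mpoly_superset[of ?A] lookup_add algebra_simps sum.distrib)
  finally show ?thesis .
qed

lemma eval_mpoly_zero: "eval_mpoly s 0 = 0"
  by (simp add: eval_mpoly_def)

lemma eval_mpoly_uminus: "eval_mpoly s (- g) = - eval_mpoly s g"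
  using eval_mpoly_add[of s g "- g"] by (simp add: eval_mpoly_zero add_eq_0_iff)

lemma eval_mpoly_diff: "eval_mpoly s (g - h) = eval_mpoly s g - eval_mpoly s h"
  using eval_mpoly_add[of s g "- h"] by (simp add: eval_mpoly_uminus)

lemma eval_mpoly_single: "eval_mpoly s (Poly_Mapping.single m c) = of_int c * eval_monom s m"
  by (simp add: eval_mpoly_def eval_monom_def)

text \<open>Integer polynomials are formal integer combinations of monomials, so the expansion
  theorem for free abelian groups yields this induction.\<close>

lemma mpoly_induct [case_names zero single add]:
  fixes g :: "'k \<Rightarrow>\<^sub>0 int"
  assumes "P 0" "\<And>m c. P (Poly_Mapping.single m c)" "\<And>g h. P g \<Longrightarrow> P h \<Longrightarrow> P (g + h)"
  shows "P g"
proof -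
  have "P (frag_cmul c (frag_of m))" for c m
  proof -
    have "frag_cmul c (frag_of m) = Poly_Mapping.single m c"
      by (rule poly_mapping_eqI) (simp add: lookup_single when_def)
    thus ?thesis using assms(2) by simp
  qed
  hence "P (\<Sum>m\<in>A. frag_cmul (Poly_Mapping.lookup g m) (frag_of m))" for A
    using assms(1,3) by (induction A rule: infinite_finite_induct) auto
  from this[of "Poly_Mapping.keys g"] show ?thesis
    using frag_expansion[of g] by (simp add: frag_extend_def)
qed

lemma eval_mpoly_mult: "eval_mpoly s (g * h) = eval_mpoly s g * eval_mpoly s h"
proof (induction g rule: mpoly_induct)
  case zero
  then show ?case by (simp add: eval_mpoly_zero)
next
  case (single m c)
  show ?case
  proof (induction h rule: mpoly_induct)
    case zero
    then show ?case by (simp add: eval_mpoly_zero)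
  next
    case (single n d)
    then show ?case by (simp add: mult_single eval_mpoly_single eval_monom_add)
  next
    case (add g h)
    then show ?case by (simp add: eval_mpoly_add algebra_simps)
  qed
next
  case (add g h)
  then show ?case by (simp add: eval_mpoly_add algebra_simps)
qed

lemma eval_mpoly_one: "eval_mpoly s 1 = 1"
  using eval_mpoly_single[of s 0 1] by (simp add: eval_monom_def)

lemma eval_mpoly_power: "eval_mpoly s (g ^ n) = eval_mpoly s g ^ n"
  by (induction n) (simp_all add: eval_mpoly_one eval_mpoly_mult)

lemma eval_mpoly_of_nat: "eval_mpoly s (of_nat n) = of_nat n"
  by (induction n) (simp_all add: eval_mpoly_zero eval_mpoly_one eval_mpoly_add)

lemma eval_mpoly_numeral: "eval_mpoly s (numeral n) = numeral n"
  using eval_mpoly_of_nat[of s "numeral n"] by simp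

lemma eval_mpoly_Var: "eval_mpoly s (Var v) = s v"
  by (simp add: Var_def eval_mpoly_single eval_monom_def)

lemmas eval_mpoly_hom = eval_mpoly_add eval_mpoly_zero eval_mpoly_uminus eval_mpoly_diff
  eval_mpoly_mult eval_mpoly_one eval_mpoly_power eval_mpoly_numeral eval_mpoly_Var

text \<open>Applied to two ring homomorphisms \<open>h\<close> in the deformation argument: the
  constant term of a power series and the inclusion of power series into Laurent series.\<close>

lemma eval_mpoly_compose:
  assumes "h 0 = 0" "h 1 = 1" "\<And>x y. h (x + y) = h x + h y" "\<And>x y. h (x * y) = h x * h y"
  shows "h (eval_mpoly s g) = eval_mpoly (\<lambda>v. h (s v)) g"
proof (induction g rule: mpoly_induct)
  case (single m c)
  have neg: "h (- x) = - h x" for x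
    using assms(3)[of x "- x"] assms(1) by (simp add: add_eq_0_iff)
  have nat: "h (of_nat n) = of_nat n" for n
    using assms(1-3) by (induction n) simp_all
  have int: "h (of_int c) = of_int c"
    by (cases c rule: int_cases2) (simp_all add: neg nat)
  have pow: "h (x ^ n) = h x ^ n" for x n
    using assms(2,4) by (induction n) simp_all
  have "h (\<Prod>v\<in>A. s v ^ Poly_Mapping.lookup m v) = (\<Prod>v\<in>A. h (s v) ^ Poly_Mapping.lookup m v)" for A
    using assms(2,4) by (induction A rule: infinite_finite_induct) (simp_all add: pow)
  then show ?case by (simp add: eval_mpoly_single eval_monom_def assms(4) int)
qed (simp_all add: eval_mpoly_zero eval_mpoly_add assms)

definition respects_rstar :: "(indet \<Rightarrow> 'a::comm_ring_1) \<Rightarrow> bool" where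
  "respects_rstar s \<longleftrightarrow>
     weierstrass_eq (Weierstrass (s Al1) (s Al2) (s Al3) (s Al4) (s Al6)) (s X1) (s Y1) = 0 \<and>
     weierstrass_eq (Weierstrass (s Al1) (s Al2) (s Al3) (s Al4) (s Al6)) (s X2) (s Y2) = 0 \<and>
     s U * (s X1 - s X2) = 1"

lemma eval_mpoly_rstar_eq:
  assumes "respects_rstar s" "rstar_eq g h"
  shows "eval_mpoly s g = eval_mpoly s h"
proof -
  obtain c1 c2 c3 where "g - h =
      c1 * weierstrass_eq generic_curve (Var X1) (Var Y1)
    + c2 * weierstrass_eq generic_curve (Var X2) (Var Y2)
    + c3 * (Var U * (Var X1 - Var X2) - 1)"
    using assms(2) unfolding rstar_eq_def by blast
  from arg_cong[OF this, of "eval_mpoly s"] show ?thesis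
    using assms(1) by (simp add: respects_rstar_def weierstrass_eq_def generic_curve_def eval_mpoly_hom)
qed

lemma translated_division_polynomials_eval:
  fixes s :: "indet \<Rightarrow> 'a::comm_ring_1"
  assumes Psi: "translated_division_polynomials Psi" and s: "respects_rstar s"
  defines "E \<equiv> Weierstrass (s Al1) (s Al2) (s Al3) (s Al4) (s Al6)"
    and "l \<equiv> (s Y1 - s Y2) * s U"
    and "f \<equiv> \<lambda>n. eval_mpoly s (Psi n)"
  shows "f (- 1) = s X1 - s X2" "f 0 = 1" "f 1 = 1"
    "f 2 = 2 * s X1 + s X2 - l ^ 2 - s Al1 * l + s Al2"
    "f (m + 2) * f (m - 2) = beta1 E (s X1) (s Y1) ^ 2 * f (m + 1) * f (m - 1)
       - beta2 E (s X1) * f m ^ 2"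
proof -
  have gen: "a1 generic_curve = Var Al1" "a2 generic_curve = Var Al2" "a3 generic_curve = Var Al3"
    "a4 generic_curve = Var Al4" "a6 generic_curve = Var Al6"
    by (simp_all add: generic_curve_def)
  note simps = eval_mpoly_hom beta1_def beta2_def b2_def b4_def b6_def b8_def gen E_def l_def f_def
  note P = Psi[unfolded translated_division_polynomials_def Let_def]
  note ev = eval_mpoly_rstar_eq[OF s]
  show "f (- 1) = s X1 - s X2" "f 0 = 1" "f 1 = 1"
    "f 2 = 2 * s X1 + s X2 - l ^ 2 - s Al1 * l + s Al2"
    using ev[OF P[THEN conjunct1]] ev[OF P[THEN conjunct2, THEN conjunct1]]
      ev[OF P[THEN conjunct2, THEN conjunct2, THEN conjunct1]]
      ev[OF P[THEN conjunct2, THEN conjunct2, THEN conjunct2, THEN conjunct1]]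
    by (simp_all add: simps)
  show "f (m + 2) * f (m - 2) = beta1 E (s X1) (s Y1) ^ 2 * f (m + 1) * f (m - 1)
       - beta2 E (s X1) * f m ^ 2"
    using ev[OF P[THEN conjunct2, THEN conjunct2, THEN conjunct2, THEN conjunct2, rule_format, of m]]
    by (simp add: simps)
qed

section \<open>Somos-4 sequences and their addition formulas\<close>

text \<open>Relations are stated at one index because their ranges differ: all integers for the
  translated sequence, but only \<open>k \<ge> 2\<close> for the division sequence, which is
  extended by 0 to negative indices.\<close>

definition somos_at :: "'a::comm_ring_1 \<Rightarrow> 'a \<Rightarrow> (int \<Rightarrow> 'a) \<Rightarrow> int \<Rightarrow> bool" where
  "somos_at \<alpha> \<beta> f m \<longleftrightarrow> f (m + 2) * f (m - 2) = \<alpha> * f (m + 1) * f (m - 1) - \<beta> * f m ^ 2"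

definition cubic_at :: "'a::comm_ring_1 \<Rightarrow> 'a \<Rightarrow> (int \<Rightarrow> 'a) \<Rightarrow> int \<Rightarrow> bool" where
  "cubic_at \<alpha> J f m \<longleftrightarrow> f (m + 2) * f (m - 1) ^ 2 + f (m - 2) * f (m + 1) ^ 2
     = J * f (m + 1) * f m * f (m - 1) - \<alpha> * f m ^ 3"

text \<open>Write e m for f (m + 1) f (m - 1) / f m ^ 2. Up to powers of e m,
  \<open>somos_at\<close> gives the product of the neighbours e (m + 1) and e (m - 1),
  \<open>cubic_at\<close> their sum, and this is the quadratic equation with these two roots,
  evaluated at e (m + 1). So \<open>J\<close> is a conserved quantity of the recurrence.\<close>

definition quartic_at :: "'a::comm_ring_1 \<Rightarrow> 'a \<Rightarrow> 'a \<Rightarrow> (int \<Rightarrow> 'a) \<Rightarrow> int \<Rightarrow> bool" where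
  "quartic_at \<alpha> \<beta> J f m \<longleftrightarrow> J * f (m - 1) * f m * f (m + 1) * f (m + 2)
     = f (m - 1) ^ 2 * f (m + 2) ^ 2 + \<alpha> * (f (m - 1) * f (m + 1) ^ 3 + f m ^ 3 * f (m + 2))
       - \<beta> * f m ^ 2 * f (m + 1) ^ 2"

text \<open>Vieta: e m is one root of the quadratic belonging to e (m + 1) and the Somos relation
  gives the product of the roots, so that e (m + 2) is the other root and the sum follows. This
  direction divides by \<open>f (m - 1)\<close>; the converse is a polynomial identity.\<close>

lemma quartic_imp_cubic:
  fixes f :: "int \<Rightarrow> 'a::idom"
  assumes "somos_at \<alpha> \<beta> f (m + 1)" "quartic_at \<alpha> \<beta> J f m" "f (m - 1) \<noteq> 0"
  shows "cubic_at \<alpha> J f (m + 1)"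
proof -
  define a b c d e where "a = f (m - 1)" and "b = f m" and "c = f (m + 1)" and "d = f (m + 2)"
    and "e = f (m + 3)"
  have s: "e * a = \<alpha> * d * b - \<beta> * c ^ 2"
    using assms(1) by (simp add: somos_at_def a_def b_def c_def d_def e_def algebra_simps)
  have q: "J * a * b * c * d = a ^ 2 * d ^ 2 + \<alpha> * (a * c ^ 3 + b ^ 3 * d) - \<beta> * b ^ 2 * c ^ 2"
    using assms(2) by (simp add: quartic_at_def a_def b_def c_def d_def)
  have "a * (e * b ^ 2 + a * d ^ 2) = a * (J * d * c * b - \<alpha> * c ^ 3)"
    using s q by Groebner_Basis.algebra
  hence "e * b ^ 2 + a * d ^ 2 = J * d * c * b - \<alpha> * c ^ 3"
    using assms(3) by (simp add: a_def)
  thus ?thesis by (simp add: cubic_at_def a_def b_def c_def d_def e_def algebra_simps)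
qed

lemma cubic_imp_quartic:
  fixes f :: "int \<Rightarrow> 'a::idom"
  assumes "somos_at \<alpha> \<beta> f m" "cubic_at \<alpha> J f m"
  shows "quartic_at \<alpha> \<beta> J f m"
  using assms unfolding somos_at_def cubic_at_def quartic_at_def by Groebner_Basis.algebra

text \<open>Divided by w k ^ 2 f m ^ 2, the right-hand side is x([k]P1) - x([m]P1 + P2): this is the
  factorization of a difference of two values of the Weierstrass function into sigma functions.
  \<open>bilinear_odd_at\<close> is the analogue for indices of odd sum.\<close>

definition bilinear_even_at :: "(int \<Rightarrow> 'a::comm_ring_1) \<Rightarrow> (int \<Rightarrow> 'a) \<Rightarrow> int \<Rightarrow> int \<Rightarrow> bool" where
  "bilinear_even_at w f k m \<longleftrightarrow>
     f (m + k) * f (m - k) = w k ^ 2 * f (m + 1) * f (m - 1) - w (k + 1) * w (k - 1) * f m ^ 2"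

definition bilinear_odd_at :: "(int \<Rightarrow> 'a::comm_ring_1) \<Rightarrow> (int \<Rightarrow> 'a) \<Rightarrow> int \<Rightarrow> int \<Rightarrow> bool" where
  "bilinear_odd_at w f k m \<longleftrightarrow>
     w 2 * f (m + k + 1) * f (m - k)
       = w k * w (k + 1) * f (m + 2) * f (m - 1) - w (k - 1) * w (k + 2) * f (m + 1) * f m"

text \<open>
  With \<open>F\<^sub>k(m)\<close> and \<open>G\<^sub>k(m)\<close> the left hand sides of the even and odd relations, the products
  \<open>G\<^sub>k(m) G\<^sub>k\<^sub>-\<^sub>1(m)\<close> and \<open>F\<^sub>k(m) F\<^sub>k(m + 1)\<close> consist of the same four factors, and likewise
  \<open>F\<^sub>k\<^sub>+\<^sub>1(m) F\<^sub>k(m)\<close> and \<open>G\<^sub>k(m) G\<^sub>k(m - 1)\<close>. So each relation follows from the previous two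
  by an identity in a fixed number of variables, after cancelling a nonzero term.
\<close>

lemma bilinear_step_odd:
  fixes f w :: "int \<Rightarrow> 'a::idom"
  assumes w: "w 2 ^ 2 = \<alpha>" "somos_at \<alpha> \<beta> w k" "cubic_at \<alpha> J w k" "w 2 \<noteq> 0"
    and q: "quartic_at \<alpha> \<beta> J f m"
    and odd: "bilinear_odd_at w f (k - 1) m"
    and even: "bilinear_even_at w f k m" "bilinear_even_at w f k (m + 1)"
    and nz: "f (m + k) \<noteq> 0" "f (m - k + 1) \<noteq> 0"
  shows "bilinear_odd_at w f k m"
proof -
  define a b c d where "a = f (m - 1)" and "b = f m" and "c = f (m + 1)" and "d = f (m + 2)"
  define A B C D G where "A = w (k - 1)" and "B = w k" and "C = w (k + 1)" and "D = w (k + 2)"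
    and "G = w (k - 2)"
  define X Y X' Y' where "X = f (m + k)" and "Y = f (m - k)" and "X' = f (m + k + 1)"
    and "Y' = f (m - k + 1)"
  have W1: "D * G = w 2 ^ 2 * C * A - \<beta> * B ^ 2"
    and W2: "D * A ^ 2 + G * C ^ 2 = J * C * B * A - w 2 ^ 2 * B ^ 3"
    using w by (simp_all add: somos_at_def cubic_at_def A_def B_def C_def D_def G_def)
  have Q: "J * a * b * c * d = a ^ 2 * d ^ 2 + w 2 ^ 2 * (a * c ^ 3 + b ^ 3 * d) - \<beta> * b ^ 2 * c ^ 2"
    using q w(1) by (simp add: quartic_at_def a_def b_def c_def d_def)
  have O1: "w 2 * X * Y' = A * B * d * a - G * C * c * b"
    using odd by (simp add: bilinear_odd_at_def A_def B_def C_def G_def X_def Y'_def a_def b_def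
        c_def d_def algebra_simps)
  have E1: "X * Y = B ^ 2 * c * a - C * A * b ^ 2"
    using even(1) by (simp add: bilinear_even_at_def A_def B_def C_def X_def Y_def a_def b_def c_def)
  have E2: "X' * Y' = B ^ 2 * d * b - C * A * c ^ 2"
    using even(2) by (simp add: bilinear_even_at_def A_def B_def C_def X'_def Y'_def b_def c_def d_def
        algebra_simps)
  \<comment> \<open>The product is arranged so that \<open>w\<close> enters only through D * G and D
    * A ^ 2 + G * C ^ 2, the two quantities that \<open>W1\<close> and \<open>W2\<close> evaluate;
    what remains is \<open>Q\<close>.\<close>
  have "(B * C * d * a - A * D * c * b) * (A * B * d * a - G * C * c * b)
      = B ^ 2 * C * A * (a ^ 2 * d ^ 2) - B * (G * C ^ 2 + D * A ^ 2) * (a * b * c * d)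
        + A * C * (D * G) * (b ^ 2 * c ^ 2)"
    by Groebner_Basis.algebra
  also have "\<dots> = w 2 ^ 2 * (B ^ 2 * c * a - C * A * b ^ 2) * (B ^ 2 * d * b - C * A * c ^ 2)"
    unfolding W1 add.commute[of "G * C ^ 2"] W2 using Q by Groebner_Basis.algebra
  also have "\<dots> = (w 2 * X' * Y) * (w 2 * X * Y')"
    unfolding E1[symmetric] E2[symmetric] by Groebner_Basis.algebra
  finally have "(w 2 * X' * Y) * (w 2 * X * Y')
      = (B * C * d * a - A * D * c * b) * (w 2 * X * Y')"
    unfolding O1 by (rule sym)
  moreover have "w 2 * X * Y' \<noteq> 0" using w(4) nz by (simp add: X_def Y'_def)
  ultimately have "w 2 * X' * Y = B * C * d * a - A * D * c * b"
    using mult_right_cancel by blast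
  thus ?thesis by (simp add: bilinear_odd_at_def A_def B_def C_def D_def X'_def Y_def a_def b_def
        c_def d_def)
qed

lemma bilinear_step_even:
  fixes f w :: "int \<Rightarrow> 'a::idom"
  assumes w: "w 2 ^ 2 = \<alpha>" "quartic_at \<alpha> \<beta> J w k" "w 2 \<noteq> 0"
    and f: "somos_at \<alpha> \<beta> f m" "cubic_at \<alpha> J f m"
    and even: "bilinear_even_at w f k m"
    and odd: "bilinear_odd_at w f k m" "bilinear_odd_at w f k (m - 1)"
    and nz: "f (m + k) \<noteq> 0" "f (m - k) \<noteq> 0"
  shows "bilinear_even_at w f (k + 1) m"
proof -
  define a b c d e where "a = f (m - 1)" and "b = f m" and "c = f (m + 1)" and "d = f (m + 2)"
    and "e = f (m - 2)"
  define A B C D where "A = w (k - 1)" and "B = w k" and "C = w (k + 1)" and "D = w (k + 2)"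
  define X Y X' Y' where "X = f (m + k)" and "Y = f (m - k)" and "X' = f (m + k + 1)"
    and "Y' = f (m - k - 1)"
  have W: "J * A * B * C * D = A ^ 2 * D ^ 2 + w 2 ^ 2 * (A * C ^ 3 + B ^ 3 * D) - \<beta> * B ^ 2 * C ^ 2"
    using w by (simp add: quartic_at_def A_def B_def C_def D_def)
  have F1: "d * e = w 2 ^ 2 * c * a - \<beta> * b ^ 2"
    and F2: "d * a ^ 2 + e * c ^ 2 = J * c * b * a - w 2 ^ 2 * b ^ 3"
    using f w(1) by (simp_all add: somos_at_def cubic_at_def a_def b_def c_def d_def e_def)
  have O1: "w 2 * X' * Y = B * C * d * a - A * D * c * b"
    using odd(1) by (simp add: bilinear_odd_at_def A_def B_def C_def D_def X'_def Y_def a_def b_def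
        c_def d_def)
  have O2: "w 2 * X * Y' = B * C * c * e - A * D * b * a"
    using odd(2) by (simp add: bilinear_odd_at_def A_def B_def C_def D_def X_def Y'_def a_def b_def
        c_def e_def algebra_simps)
  have E1: "X * Y = B ^ 2 * c * a - C * A * b ^ 2"
    using even(1) by (simp add: bilinear_even_at_def A_def B_def C_def X_def Y_def a_def b_def c_def)
  \<comment> \<open>Here the roles are exchanged: \<open>f\<close> enters through d * e and d * a ^
    2 + e * c ^ 2, and \<open>w\<close> through its quartic relation.\<close>
  have "w 2 ^ 2 * ((X' * Y') * (X * Y)) = (w 2 * X' * Y) * (w 2 * X * Y')"
    by Groebner_Basis.algebra
  also have "\<dots> = B ^ 2 * C ^ 2 * (c * a) * (d * e) - A * B * C * D * b * (d * a ^ 2 + e * c ^ 2)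
      + A ^ 2 * D ^ 2 * b ^ 2 * (c * a)"
    unfolding O1 O2 by Groebner_Basis.algebra
  also have "\<dots> = w 2 ^ 2 * (C ^ 2 * c * a - D * B * b ^ 2) * (B ^ 2 * c * a - C * A * b ^ 2)"
    unfolding F1 F2 using W by Groebner_Basis.algebra
  also have "\<dots> = w 2 ^ 2 * ((C ^ 2 * c * a - D * B * b ^ 2) * (X * Y))"
    unfolding E1 by Groebner_Basis.algebra
  finally have "X' * Y' = C ^ 2 * c * a - D * B * b ^ 2"
    using w(3) nz by (simp add: X_def Y_def)
  thus ?thesis by (simp add: bilinear_even_at_def B_def C_def D_def X'_def Y'_def a_def b_def
        c_def algebra_simps)
qed

text \<open>The window from \<open>a\<close> to \<open>b\<close> serves two uses with different
  zeros: \<open>f\<close> = \<open>w\<close>, which vanishes at 0, needs a window starting at 1, and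
  the deformed translated sequence, nowhere zero, allows any window.\<close>

lemma bilinear_relations:
  fixes f w :: "int \<Rightarrow> 'a::idom"
  assumes w: "w 0 = 0" "w 1 = 1" "w 2 ^ 2 = \<alpha>" "w 3 = \<beta>" "w 2 \<noteq> 0"
    and W: "\<And>k. k \<ge> 2 \<Longrightarrow> somos_at \<alpha> \<beta> w k" "\<And>k. k \<ge> 2 \<Longrightarrow> cubic_at \<alpha> J w k"
    and f: "\<And>m. a \<le> m - 2 \<Longrightarrow> m + 2 \<le> b \<Longrightarrow> somos_at \<alpha> \<beta> f m"
      "\<And>m. a \<le> m - 2 \<Longrightarrow> m + 2 \<le> b \<Longrightarrow> cubic_at \<alpha> J f m"
      "\<And>m. a \<le> m - 1 \<Longrightarrow> m + 2 \<le> b \<Longrightarrow> quartic_at \<alpha> \<beta> J f m"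
    and nz: "\<And>m. a \<le> m \<Longrightarrow> m \<le> b \<Longrightarrow> f m \<noteq> 0"
    and k: "k \<ge> 1"
  shows "(\<forall>m. a \<le> m - k \<and> m + k \<le> b \<longrightarrow> bilinear_even_at w f k m) \<and>
         (\<forall>m. a \<le> m - k \<and> m + k + 1 \<le> b \<longrightarrow> bilinear_odd_at w f k m)"
  using k
proof (induction k rule: int_ge_induct)
  case base
  show ?case using w by (auto simp: bilinear_even_at_def bilinear_odd_at_def algebra_simps)
next
  case (step k)
  have even: "bilinear_even_at w f (k + 1) m" if m: "a \<le> m - (k + 1)" "m + (k + 1) \<le> b" for m
  \<comment> \<open>For k + 1 = 2 this is the Somos relation itself. The general step takes the
    quartic relation of \<open>w\<close> from its Somos relation at the same index, which starts at
    2.\<close>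
  proof (cases "k = 1")
    case True
    then show ?thesis using f(1)[of m] m w
      by (simp add: bilinear_even_at_def somos_at_def algebra_simps)
  next
    case False
    with step.hyps have k2: "k \<ge> 2" by simp
    show ?thesis
    proof (rule bilinear_step_even[where \<alpha> = \<alpha> and \<beta> = \<beta> and J = J])
      show "quartic_at \<alpha> \<beta> J w k" using W k2 cubic_imp_quartic by blast
    qed (use m step k2 nz w f in auto)
  qed
  have "bilinear_odd_at w f (k + 1) m" if m: "a \<le> m - (k + 1)" "m + (k + 1) + 1 \<le> b" for m
  proof (rule bilinear_step_odd[where \<alpha> = \<alpha> and \<beta> = \<beta> and J = J])
    show "somos_at \<alpha> \<beta> w (k + 1)" "cubic_at \<alpha> J w (k + 1)" using W step.hyps by simp_all
    show "bilinear_even_at w f (k + 1) m" "bilinear_even_at w f (k + 1) (m + 1)"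
      using even m by auto
    show "bilinear_odd_at w f (k + 1 - 1) m" using step m by simp
  qed (use m step nz w f in auto)
  with even show ?case by blast
qed

text \<open>
  The quotients \<open>e\<^sub>m = f (m + 1) f (m - 1) / f m\<^sup>2\<close> satisfy
  \<open>J e\<^sub>m e\<^sub>m\<^sub>+\<^sub>1 = (e\<^sub>m e\<^sub>m\<^sub>+\<^sub>1)\<^sup>2 + \<alpha> (e\<^sub>m + e\<^sub>m\<^sub>+\<^sub>1) - \<beta>\<close> with constant coefficients. Differentiating,
  \<open>e\<^sub>m\<^sub>+\<^sub>1\<close> can only be constant if \<open>e\<^sub>m\<close> is. This keeps the sequence away from \<open>0\<close>.
\<close>

lemma quartic_propagate:
  fixes f :: "int \<Rightarrow> rat fls"
  assumes somos: "\<And>m. somos_at (fls_const \<alpha>) (fls_const \<beta>) f m" and \<alpha>: "\<alpha> \<noteq> 0"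
    and base: "quartic_at (fls_const \<alpha>) (fls_const \<beta>) (fls_const J) f 0"
    and nz: "f (- 1) \<noteq> 0" "f 0 \<noteq> 0" "f 1 \<noteq> 0"
    and move: "fls_deriv (f 1 * f (- 1) / f 0 ^ 2) \<noteq> 0"
    and m: "m \<ge> 0"
  shows "f (m - 1) \<noteq> 0 \<and> f m \<noteq> 0 \<and> f (m + 1) \<noteq> 0 \<and> f (m + 2) \<noteq> 0 \<and>
     quartic_at (fls_const \<alpha>) (fls_const \<beta>) (fls_const J) f m \<and>
     fls_deriv (f (m + 1) * f (m - 1) / f m ^ 2) \<noteq> 0"
proof -
  let ?a = "fls_const \<alpha>" and ?b = "fls_const \<beta>" and ?J = "fls_const J"
  let ?e = "\<lambda>m. f (m + 1) * f (m - 1) / f m ^ 2"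
  have key: "fls_deriv (?e (m + 1)) \<noteq> 0"
    if nz: "f (m - 1) \<noteq> 0" "f m \<noteq> 0" "f (m + 1) \<noteq> 0" and q: "quartic_at ?a ?b ?J f m"
      and d: "fls_deriv (?e m) \<noteq> 0" for m
  proof
    assume d0: "fls_deriv (?e (m + 1)) = 0"
    define x y where "x = ?e m" and "y = ?e (m + 1)"
    have dy: "fls_deriv y = 0" using d0 by (simp only: y_def)
    have "f (m + 1) * f (m - 1) = x * f m ^ 2" "f (m + 2) * f m = y * f (m + 1) ^ 2"
      using nz by (simp_all add: x_def y_def algebra_simps)
    hence "f m ^ 2 * f (m + 1) ^ 2 * (?J * (x * y)) = f m ^ 2 * f (m + 1) ^ 2 * ((x * y) ^ 2 + ?a * (x + y) - ?b)"
      using q unfolding quartic_at_def by Groebner_Basis.algebra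
    hence xy: "?J * (x * y) = (x * y) ^ 2 + ?a * (x + y) - ?b" using nz by simp
    from arg_cong[OF this, of fls_deriv]
    have "fls_deriv x * (?J * y) = fls_deriv x * (2 * x * y ^ 2 + ?a)"
      using dy by (simp add: fls_deriv_power algebra_simps power2_eq_square)
    hence J: "?J * y = 2 * x * y ^ 2 + ?a" using d by (simp add: x_def)
    \<comment> \<open>\<open>y\<close> is still constant here, so differentiating once more leaves
      only 2 y ^ 2 x' = 0. Then y = 0, and \<open>J\<close> turns into 0 =
      \<open>\<alpha>\<close>.\<close>
    from arg_cong[OF this, of fls_deriv] have "fls_deriv x * (2 * y ^ 2) = 0"
      using dy by (simp add: fls_deriv_power algebra_simps)
    hence "y = 0" using d by (simp add: x_def)
    with J \<alpha> show False by simp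
  qed
  have f2: "f (m + 2) \<noteq> 0" if "fls_deriv (?e (m + 1)) \<noteq> 0" for m
    using that by (auto simp: algebra_simps)
  show ?thesis using m
  proof (induction m rule: int_ge_induct)
    case base
    have "fls_deriv (?e 1) \<noteq> 0" using key[of 0] nz assms(3) move by simp
    with f2[of 0] show ?case using nz assms(3) move by simp
  next
    case (step m)
    hence d1: "fls_deriv (?e (m + 1)) \<noteq> 0" using key[of m] by blast
    have "cubic_at ?a ?J f (m + 1)"
      using quartic_imp_cubic[OF somos] step by blast
    hence q: "quartic_at ?a ?b ?J f (m + 1)" using cubic_imp_quartic somos by blast
    have "fls_deriv (?e (m + 1 + 1)) \<noteq> 0"
      using key[of "m + 1"] step q d1 by (simp add: algebra_simps)
    from f2[OF this] show ?case using step q d1 by (simp add: algebra_simps)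
  qed
qed

section \<open>The division sequence of a point\<close>

text \<open>
  \<open>xdiff_add E x\<^sub>1 x l\<close> is \<open>x\<^sub>1 - x(P + Q)\<close> when \<open>l\<close> is the slope of the line through \<open>P\<close> and \<open>Q\<close>.
  In terms of the Weierstrass function, \<open>jinv\<close> is the second derivative of \<open>\<wp>\<close> and \<open>beta1\<close> the first.
\<close>

definition jinv :: "'a::comm_ring_1 weierstrass \<Rightarrow> 'a \<Rightarrow> 'a" where
  "jinv E x = 6 * x ^ 2 + b2 E * x + b4 E"

definition xdiff_add :: "'a::comm_ring_1 weierstrass \<Rightarrow> 'a \<Rightarrow> 'a \<Rightarrow> 'a \<Rightarrow> 'a" where
  "xdiff_add E x1 x l = 2 * x1 + x + a2 E - l ^ 2 - a1 E * l"

text \<open>Subtracting the curve equations and dividing by x - x1 solves for \<open>a4\<close>. The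
  right-hand side keeps its meaning at x = x1, where it is the tangent condition, so
  \<open>third_point_on_curve\<close> covers chords and tangents alike.\<close>

lemma chord_coefficient:
  fixes E :: "'a::field weierstrass"
  assumes "weierstrass_eq E x1 y1 = 0" "weierstrass_eq E x y = 0" "x \<noteq> x1"
    and "l * (x - x1) = y - y1"
  shows "a4 E = l * (y + y1) + a1 E * (x * l + y1) + a3 E * l
    - (x ^ 2 + x * x1 + x1 ^ 2) - a2 E * (x + x1)"
proof -
  have y: "y = y1 + l * (x - x1)" using assms(4) by simp
  have "(x - x1) * (l * (y + y1) + a1 E * (x * l + y1) + a3 E * l
    - (x ^ 2 + x * x1 + x1 ^ 2) - a2 E * (x + x1) - a4 E)
    = weierstrass_eq E x y - weierstrass_eq E x1 y1"
    unfolding weierstrass_eq_def y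
    by (simp add: algebra_simps power2_eq_square power3_eq_cube)
  thus ?thesis using assms by simp
qed

lemma third_point_on_curve:
  fixes E :: "'a::field weierstrass"
  assumes "weierstrass_eq E x1 y1 = 0" "y = y1 + l * (x - x1)"
    and a4: "a4 E = l * (y + y1) + a1 E * (x * l + y1) + a3 E * l
    - (x ^ 2 + x * x1 + x1 ^ 2) - a2 E * (x + x1)"
    and x': "x' = l ^ 2 + a1 E * l - a2 E - x1 - x"
  shows "weierstrass_eq E x' (l * (x1 - x') - y1 - a1 E * x' - a3 E) = 0"
proof -
  have a6: "a6 E = y1 ^ 2 + a1 E * x1 * y1 + a3 E * y1 - x1 ^ 3 - a2 E * x1 ^ 2 - a4 E * x1"
    using assms(1) by (simp add: weierstrass_eq_def algebra_simps)
  have a2: "a2 E = l ^ 2 + a1 E * l - x' - x1 - x" using x' by (simp add: algebra_simps)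
  show ?thesis unfolding weierstrass_eq_def a6 a4 a2 assms(2)
    by (simp add: algebra_simps power2_eq_square power3_eq_cube)
qed

text \<open>\<open>M\<close> is the slope towards -Q, so the two differences belong to Q + P and Q -
  P. Changing the sign of Q exchanges \<open>L\<close> and \<open>M\<close>, so that sum and product
  depend on x only. These are the sources of \<open>cubic_at\<close> and
  \<open>somos_at\<close>.\<close>

lemma xdiff_relations:
  fixes E :: "'a::field weierstrass"
  assumes P: "weierstrass_eq E x1 y1 = 0" and Q: "weierstrass_eq E x y = 0" and x: "x \<noteq> x1"
    and L: "L = (y - y1) / (x - x1)" and M: "M = (- y - a1 E * x - a3 E - y1) / (x - x1)"
  shows "(x1 - x) ^ 2 * (xdiff_add E x1 x L + xdiff_add E x1 x M) + beta1 E x1 y1 ^ 2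
      = jinv E x1 * (x1 - x)" (is ?sum)
    and "(x1 - x) ^ 2 * (xdiff_add E x1 x L * xdiff_add E x1 x M)
      = beta1 E x1 y1 ^ 2 * (x1 - x) - beta2 E x1" (is ?prod)
proof -
  \<comment> \<open>The symmetric functions of the slopes. One factor \<open>d\<close> clears the
    denominator even of L * M, since \<open>chord_coefficient\<close> absorbs the second
    division.\<close>
  define d S T where "d = x - x1" and "S = d * (L + M)" and "T = d * (L * M)"
  have Ld: "L * d = y - y1" and Md: "M * d = - y - a1 E * x - a3 E - y1"
    using x by (simp_all add: L M d_def)
  have xd: "x = x1 + d" by (simp add: d_def)
  have S: "S = - beta1 E x1 y1 - a1 E * d"
  proof -
    have "S = L * d + M * d" by (simp add: S_def algebra_simps)
    thus ?thesis unfolding Ld Md by (simp add: beta1_def d_def algebra_simps)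
  qed
  have a4: "a4 E = l * (y + y1) + a1 E * (x * l + y1) + a3 E * l
    - (x ^ 2 + x * x1 + x1 ^ 2) - a2 E * (x + x1)" if "l * d = y - y1" for l
    using chord_coefficient[OF P Q x] that by (simp add: d_def)
  have T: "T = a1 E * y1 - (x ^ 2 + x * x1 + x1 ^ 2) - a2 E * (x + x1) - a4 E"
  proof -
    have "T = L * (M * d)" by (simp add: T_def algebra_simps)
    thus ?thesis unfolding Md a4[OF Ld] by (simp add: algebra_simps)
  qed
  have a6: "a6 E = y1 ^ 2 + a1 E * x1 * y1 + a3 E * y1 - x1 ^ 3 - a2 E * x1 ^ 2 - a4 E * x1"
    using P by (simp add: weierstrass_eq_def algebra_simps)
  have sum: "(x1 - x) ^ 2 * (xdiff_add E x1 x L + xdiff_add E x1 x M)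
      = d ^ 2 * (4 * x1 + 2 * x + 2 * a2 E) - S * (S + a1 E * d) + 2 * d * T"
    unfolding S_def T_def by (simp add: xd xdiff_add_def algebra_simps power2_eq_square)
  show ?sum unfolding sum S T jinv_def beta1_def b2_def b4_def
    by (simp add: xd algebra_simps power2_eq_square)
  define A where "A = 2 * x1 + x + a2 E"
  have prod: "(x1 - x) ^ 2 * (xdiff_add E x1 x L * xdiff_add E x1 x M)
      = A ^ 2 * d ^ 2 - A * (S ^ 2 - 2 * d * T + a1 E * d * S) + T * (T + a1 E * S + a1 E ^ 2 * d)"
    unfolding S_def T_def A_def by (simp add: xd xdiff_add_def algebra_simps power2_eq_square)
  show ?prod unfolding prod S T A_def beta1_def beta2_def b2_def b4_def b6_def b8_def a6
    by (simp add: xd algebra_simps power2_eq_square power3_eq_cube power4_eq_xxxx)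
qed

section \<open>Multiples of a point and their abscissae\<close>

lemma point_mult_Suc: "point_mult E (Suc n) P = point_add E P (point_mult E n P)"
  by (simp add: point_mult_def)

lemma point_mult_1: "point_mult E 1 P = P"
  by (cases P) (simp_all add: point_mult_def)

text \<open>The value \<open>0\<close> at \<open>n = 1\<close> makes the relations below hold from \<open>n = 2\<close> on.\<close>

definition mult_xdiff :: "'a::field weierstrass \<Rightarrow> 'a point \<Rightarrow> nat \<Rightarrow> 'a" where
  "mult_xdiff E P n = (if n \<le> 1 then 0 else x_of P - x_of (point_mult E n P))"

text \<open>P, [n - 1]P and -[n]P are collinear, so the slope towards -[n]P is the one by which [n]P
  was constructed, and the difference for [n]P - P is the previous entry. This avoids associativity
  of the group law.\<close>

lemma point_mult_line:
  fixes E :: "'a::field weierstrass"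
  assumes P: "weierstrass_eq E x1 y1 = 0" and n: "n \<ge> 2"
    and nz: "\<And>m. 1 \<le> m \<Longrightarrow> m \<le> n + 1 \<Longrightarrow> point_mult E m (Affine x1 y1) \<noteq> Infinity"
  shows "\<exists>x y. point_mult E n (Affine x1 y1) = Affine x y \<and> weierstrass_eq E x y = 0 \<and> x \<noteq> x1 \<and>
    xdiff_add E x1 x ((- y - a1 E * x - a3 E - y1) / (x - x1)) = mult_xdiff E (Affine x1 y1) (n - 1)"
  using n nz
proof (induction n rule: dec_induct)
  case base
  let ?P = "Affine x1 y1"
  define l where "l = (3 * x1 ^ 2 + 2 * a2 E * x1 + a4 E - a1 E * y1) / (2 * y1 + a1 E * x1 + a3 E)"
  define x where "x = l ^ 2 + a1 E * l - a2 E - x1 - x1"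
  define y where "y = l * (x1 - x) - y1 - a1 E * x - a3 E"
  have PP: "point_mult E 2 ?P = point_add E ?P ?P"
    using point_mult_Suc[of E 1 ?P] by (simp add: numeral_2_eq_2 point_mult_1[unfolded One_nat_def])
  have b: "y1 + y1 + a1 E * x1 + a3 E \<noteq> 0"
  proof
    assume "y1 + y1 + a1 E * x1 + a3 E = 0"
    hence "point_mult E 2 ?P = Infinity" unfolding PP by simp
    with base[of 2] show False by simp
  qed
  have P2: "point_mult E 2 ?P = Affine x y"
    unfolding PP y_def x_def l_def
    by (simp only: point_add.simps Let_def b simp_thms if_True if_False)
  have "l * (2 * y1 + a1 E * x1 + a3 E) = 3 * x1 ^ 2 + 2 * a2 E * x1 + a4 E - a1 E * y1"
    using nonzero_eq_divide_eq[OF b[folded mult_2]] l_def by blast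
  hence "a4 E = l * (y1 + y1) + a1 E * (x1 * l + y1) + a3 E * l
    - (x1 ^ 2 + x1 * x1 + x1 ^ 2) - a2 E * (x1 + x1)"
    by (simp add: algebra_simps power2_eq_square)
  from third_point_on_curve[OF P _ this x_def]
  have on: "weierstrass_eq E x y = 0" by (simp add: y_def)
  \<comment> \<open>With x = x1 the formula for y makes [2]P the negative of P, and [3]P would be
    infinite.\<close>
  have ne: "x \<noteq> x1"
  proof
    assume eq: "x = x1"
    have "point_mult E 3 ?P = point_add E ?P (Affine x y)"
      using point_mult_Suc[of E 2 ?P] P2 by simp
    also have "\<dots> = Infinity" unfolding y_def eq by simp
    finally have "point_mult E 3 ?P = Infinity" .
    thus False using base[of 3] by simp
  qed
  have "- y - a1 E * x - a3 E - y1 = l * (x - x1)" by (simp add: y_def algebra_simps)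
  hence "(- y - a1 E * x - a3 E - y1) / (x - x1) = l" using ne by simp
  thus ?case using on ne P2 by (intro exI[of _ x] exI[of _ y])
      (simp add: xdiff_add_def mult_xdiff_def x_def)
next
  case (step n)
  let ?P = "Affine x1 y1"
  obtain x0 y0 where Q: "point_mult E n ?P = Affine x0 y0" "weierstrass_eq E x0 y0 = 0" "x0 \<noteq> x1"
    using step by auto
  define l where "l = (y0 - y1) / (x0 - x1)"
  define x where "x = l ^ 2 + a1 E * l - a2 E - x1 - x0"
  define y where "y = l * (x1 - x) - y1 - a1 E * x - a3 E"
  have PQ: "point_mult E (Suc n) ?P = Affine x y"
    unfolding point_mult_Suc Q(1) y_def x_def l_def
    by (simp only: point_add.simps Let_def Q(3) Q(3)[symmetric] simp_thms if_True if_False)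
  have l: "l * (x0 - x1) = y0 - y1" using Q(3) by (simp add: l_def)
  hence "y0 = y1 + l * (x0 - x1)" by simp
  from third_point_on_curve[OF P this chord_coefficient[OF P Q(2,3) l] x_def]
  have on: "weierstrass_eq E x y = 0" by (simp add: y_def)
  have ne: "x \<noteq> x1"
  proof
    assume eq: "x = x1"
    have "point_mult E (Suc n + 1) ?P = point_add E ?P (Affine x y)"
      using point_mult_Suc[of E "Suc n" ?P] PQ by simp
    also have "\<dots> = Infinity" unfolding y_def eq by simp
    finally have "point_mult E (Suc n + 1) ?P = Infinity" .
    thus False using step.prems[of "Suc n + 1"] by simp
  qed
  have "- y - a1 E * x - a3 E - y1 = l * (x - x1)" by (simp add: y_def algebra_simps)
  hence "(- y - a1 E * x - a3 E - y1) / (x - x1) = l" using ne by simp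
  thus ?case using on ne PQ Q(1) step.hyps by (intro exI[of _ x] exI[of _ y])
      (simp add: xdiff_add_def mult_xdiff_def x_def)
qed

lemma mult_xdiff_relations:
  fixes E :: "'a::field weierstrass"
  assumes P: "weierstrass_eq E x1 y1 = 0" and n: "n \<ge> 2"
    and nz: "\<And>m. 1 \<le> m \<Longrightarrow> m \<le> n + 1 \<Longrightarrow> point_mult E m (Affine x1 y1) \<noteq> Infinity"
  defines "e \<equiv> mult_xdiff E (Affine x1 y1)"
  shows "e n \<noteq> 0"
    and "e n ^ 2 * (e (n + 1) + e (n - 1)) + beta1 E x1 y1 ^ 2 = jinv E x1 * e n"
    and "e n ^ 2 * (e (n + 1) * e (n - 1)) = beta1 E x1 y1 ^ 2 * e n - beta2 E x1"
proof -
  obtain x y where Q: "point_mult E n (Affine x1 y1) = Affine x y" "weierstrass_eq E x y = 0"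
    "x \<noteq> x1" "xdiff_add E x1 x ((- y - a1 E * x - a3 E - y1) / (x - x1)) = e (n - 1)"
    using point_mult_line[OF P n nz] unfolding e_def by blast
  have en: "e n = x1 - x" using n Q by (simp add: e_def mult_xdiff_def)
  have "xdiff_add E x1 x ((y - y1) / (x - x1)) = e (n + 1)"
  proof -
    have "x_of (point_mult E (n + 1) (Affine x1 y1))
        = ((y - y1) / (x - x1)) ^ 2 + a1 E * ((y - y1) / (x - x1)) - a2 E - x1 - x"
      unfolding Suc_eq_plus1[symmetric] point_mult_Suc Q(1)
      by (simp only: point_add.simps Let_def Q(3) Q(3)[symmetric] simp_thms if_True if_False point.sel)
    thus ?thesis using n by (simp add: e_def mult_xdiff_def xdiff_add_def)
  qed
  with xdiff_relations[OF P Q(2,3) refl refl] Q(3,4) en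
  show "e n \<noteq> 0" "e n ^ 2 * (e (n + 1) + e (n - 1)) + beta1 E x1 y1 ^ 2 = jinv E x1 * e n"
    "e n ^ 2 * (e (n + 1) * e (n - 1)) = beta1 E x1 y1 ^ 2 * e n - beta2 E x1"
    by auto
qed

lemma beta1_nonzero:
  fixes E :: "'a::field weierstrass"
  assumes "point_mult E 2 (Affine x1 y1) \<noteq> Infinity"
  shows "beta1 E x1 y1 \<noteq> 0"
proof
  assume "beta1 E x1 y1 = 0"
  hence "y1 + y1 + a1 E * x1 + a3 E = 0" by (simp only: beta1_def mult_2)
  hence "point_mult E 2 (Affine x1 y1) = Infinity"
    by (simp add: numeral_2_eq_2 point_mult_Suc point_mult_def)
  with assms show False by simp
qed

text \<open>At n = 2 the product relation, whose left-hand side vanishes, reads beta2 = beta1 ^ 2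
  (x1 - x([2]P)), and both factors are nonzero.\<close>

lemma beta2_nonzero:
  fixes E :: "'a::field weierstrass"
  assumes P: "weierstrass_eq E x1 y1 = 0"
    and nz: "\<And>m. 1 \<le> m \<Longrightarrow> m \<le> 3 \<Longrightarrow> point_mult E m (Affine x1 y1) \<noteq> Infinity"
  shows "beta2 E x1 \<noteq> 0"
  using mult_xdiff_relations(1,3)[OF P order_refl] nz beta1_nonzero[of E x1 y1]
  by (auto simp: mult_xdiff_def)

text \<open>The relation to the coordinates of the multiples holds by construction. Any value
  \<open>b\<close> at 2 is compatible with \<open>e\<close>; \<open>beta1\<close> is a choice for
  which w 2 ^ 2 = \<open>\<alpha>\<close> and w 3 = \<open>\<beta>\<close>, as the addition formulas
  require.\<close>

fun eds :: "(nat \<Rightarrow> 'a::field) \<Rightarrow> 'a \<Rightarrow> nat \<Rightarrow> 'a" where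
  "eds e b 0 = 0"
| "eds e b (Suc 0) = 1"
| "eds e b (Suc (Suc 0)) = b"
| "eds e b (Suc (Suc (Suc n))) = e (Suc (Suc n)) * eds e b (Suc (Suc n)) ^ 2 / eds e b (Suc n)"

lemma eds_nonzero:
  assumes "b \<noteq> 0" "\<And>n. n \<ge> 2 \<Longrightarrow> e n \<noteq> 0" "n \<ge> 1"
  shows "eds e b n \<noteq> 0"
  using assms(3)
proof (induction n rule: less_induct)
  case (less n)
  show ?case using less assms(1,2) by (cases "(e, b, n)" rule: eds.cases) auto
qed

lemma division_sequence_exists:
  fixes E :: "'a::field weierstrass"
  assumes P: "weierstrass_eq E x1 y1 = 0"
    and nz: "\<And>m. 1 \<le> m \<Longrightarrow> point_mult E m (Affine x1 y1) \<noteq> Infinity"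
  obtains w :: "int \<Rightarrow> 'a"
    where "w 0 = 0" "w 1 = 1" "w 2 = beta1 E x1 y1" "w 3 = beta2 E x1"
      and "\<And>k. k \<ge> 1 \<Longrightarrow> w k \<noteq> 0"
      and "\<And>k. k \<ge> 2 \<Longrightarrow> somos_at (beta1 E x1 y1 ^ 2) (beta2 E x1) w k"
      and "\<And>k. k \<ge> 2 \<Longrightarrow> cubic_at (beta1 E x1 y1 ^ 2) (jinv E x1) w k"
      and "\<And>n. n \<ge> 2 \<Longrightarrow> (x1 - x_of (point_mult E n (Affine x1 y1))) * w (int n) ^ 2
             = w (int n + 1) * w (int n - 1)"
proof -
  define e where "e = mult_xdiff E (Affine x1 y1)"
  let ?b = "beta1 E x1 y1"
  \<comment> \<open>All negative indices get 0; the relations below start at 2, where the smallest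
    index used is 0.\<close>
  define w where "w k = eds e ?b (nat k)" for k
  have rel: "e n \<noteq> 0" "e n ^ 2 * (e (n + 1) + e (n - 1)) + ?b ^ 2 = jinv E x1 * e n"
    "e n ^ 2 * (e (n + 1) * e (n - 1)) = ?b ^ 2 * e n - beta2 E x1" if "n \<ge> 2" for n
    using mult_xdiff_relations[OF P that] nz unfolding e_def by auto
  have b: "?b \<noteq> 0" by (intro beta1_nonzero nz) simp
  have w012: "w 0 = 0" "w 1 = 1" "w 2 = ?b" by (simp_all add: w_def numeral_2_eq_2)
  have wnz: "w k \<noteq> 0" if "k \<ge> 1" for k
    unfolding w_def using that by (intro eds_nonzero b rel) auto
  have we: "e n * w (int n) ^ 2 = w (int n + 1) * w (int n - 1)" if "n \<ge> 1" for n
  proof (cases "n = 1")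
    case True
    then show ?thesis by (simp add: w012 e_def mult_xdiff_def)
  next
    case False
    hence "n = Suc (Suc (n - 2))" using \<open>n \<ge> 1\<close> by linarith
    then obtain m where m: "n = Suc (Suc m)" ..
    have "w (int n - 1) \<noteq> 0" using m by (intro wnz) simp
    moreover have "w (int n + 1) = e n * w (int n) ^ 2 / w (int n - 1)"
    proof -
      have "nat (int n + 1) = Suc (Suc (Suc m))" "nat (int n) = Suc (Suc m)"
        "nat (int n - 1) = Suc m"
        by (simp_all add: m)
      thus ?thesis unfolding w_def m by (simp only: eds.simps)
    qed
    ultimately show ?thesis by simp
  qed
  have e1: "e 1 = 0" by (simp add: e_def mult_xdiff_def)
  have w3: "w 3 = beta2 E x1"
  proof -
    have "e 2 * ?b ^ 2 = w 3" using we[of 2] by (simp add: w012)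
    moreover have "?b ^ 2 * e 2 = beta2 E x1" using rel(3)[of 2] e1 by simp
    ultimately show ?thesis by (simp add: mult.commute)
  qed
  have local: "e n * w k ^ 2 = w (k + 1) * w (k - 1)" "e (n + 1) * w (k + 1) ^ 2 = w (k + 2) * w k"
    "e (n - 1) * w (k - 1) ^ 2 = w k * w (k - 2)" if "n \<ge> 2" "k = int n" for n k
    using we[of n] we[of "n + 1"] we[of "n - 1"] that by (auto simp: of_nat_diff algebra_simps)
  have somos: "somos_at (?b ^ 2) (beta2 E x1) w k" if "k \<ge> 2" for k
  proof -
    define n where "n = nat k"
    have n: "n \<ge> 2" "k = int n" using that by (simp_all add: n_def)
    have "w k ^ 2 * (w (k + 2) * w (k - 2)) = e (n + 1) * e (n - 1) * (w (k + 1) * w (k - 1)) ^ 2"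
      using local(2,3)[OF n] by Groebner_Basis.algebra
    also have "\<dots> = (e n ^ 2 * (e (n + 1) * e (n - 1))) * w k ^ 4"
      unfolding local(1)[OF n, symmetric] by Groebner_Basis.algebra
    also have "\<dots> = w k ^ 2 * (?b ^ 2 * (e n * w k ^ 2) - beta2 E x1 * w k ^ 2)"
      unfolding rel(3)[OF n(1)] by Groebner_Basis.algebra
    finally show ?thesis using wnz[of k] that by (simp add: somos_at_def local(1)[OF n] mult.assoc)
  qed
  have cubic: "cubic_at (?b ^ 2) (jinv E x1) w k" if "k \<ge> 2" for k
  proof -
    define n where "n = nat k"
    have n: "n \<ge> 2" "k = int n" using that by (simp_all add: n_def)
    have "w k * (w (k + 2) * w (k - 1) ^ 2 + w (k - 2) * w (k + 1) ^ 2)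
        = (e (n + 1) + e (n - 1)) * (w (k + 1) * w (k - 1)) ^ 2"
      using local(2,3)[OF n] by Groebner_Basis.algebra
    also have "\<dots> = (e n ^ 2 * (e (n + 1) + e (n - 1)) + ?b ^ 2) * w k ^ 4 - ?b ^ 2 * w k ^ 4"
      unfolding local(1)[OF n, symmetric] by Groebner_Basis.algebra
    also have "\<dots> = w k * (jinv E x1 * (e n * w k ^ 2) * w k - ?b ^ 2 * w k ^ 3)"
      unfolding rel(2)[OF n(1)] by Groebner_Basis.algebra
    finally have "w (k + 2) * w (k - 1) ^ 2 + w (k - 2) * w (k + 1) ^ 2
        = jinv E x1 * (e n * w k ^ 2) * w k - ?b ^ 2 * w k ^ 3"
      using mult_left_cancel[OF wnz[of k]] that by fastforce
    thus ?thesis unfolding cubic_at_def local(1)[OF n] by (simp add: mult_ac)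
  qed
  show ?thesis
  proof (rule that[OF w012 w3 wnz somos cubic])
    fix n :: nat
    assume "n \<ge> 2"
    thus "(x1 - x_of (point_mult E n (Affine x1 y1))) * w (int n) ^ 2 = w (int n + 1) * w (int n - 1)"
      using we[of n] by (simp add: e_def mult_xdiff_def)
  qed
qed

section \<open>Deforming the second point\<close>

lemmas fls_const_hom = fls_plus_const[symmetric] fls_minus_const[symmetric]
  fls_const_mult_const[symmetric] fls_const_power fls_const_numeral fls_const_uminus

text \<open>The starting values encode e 0 = x1 - x = f (- 1) and e 1 = f 2, and the quadratic
  equation satisfied by e 1 is the one whose roots belong to Q + P and Q - P. Here the constant
  \<open>J\<close> of the curve enters the translated sequence.\<close>

lemma quartic_base:
  fixes E :: "'a::field weierstrass"
  assumes P: "weierstrass_eq E x1 y1 = 0" and Q: "weierstrass_eq E x y = 0" and x: "x \<noteq> x1"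
    and L: "L = (y - y1) / (x - x1)"
    and f: "f (- 1) = x1 - x" "f 0 = 1" "f 1 = 1" "f 2 = xdiff_add E x1 x L"
  shows "quartic_at (beta1 E x1 y1 ^ 2) (beta2 E x1) (jinv E x1) f 0"
proof -
  define M where "M = (- y - a1 E * x - a3 E - y1) / (x - x1)"
  define e eP eM where "e = x1 - x" and "eP = xdiff_add E x1 x L" and "eM = xdiff_add E x1 x M"
  have "e ^ 2 * (eP + eM) + beta1 E x1 y1 ^ 2 = jinv E x1 * e"
    "e ^ 2 * (eP * eM) = beta1 E x1 y1 ^ 2 * e - beta2 E x1"
    using xdiff_relations[OF P Q x L M_def] by (simp_all add: e_def eP_def eM_def)
  hence "jinv E x1 * e * eP = e ^ 2 * eP ^ 2 + beta1 E x1 y1 ^ 2 * (e + eP) - beta2 E x1"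
    by Groebner_Basis.algebra
  thus ?thesis by (simp add: quartic_at_def f e_def eP_def)
qed

text \<open>The propagation only runs upwards. As f 0 = f 1, the reflection of n to 1 - n preserves
  the form of the assumptions and takes care of the negative indices.\<close>

lemma all_relations_fls:
  fixes f :: "int \<Rightarrow> rat fls"
  assumes somos: "\<And>m. somos_at (fls_const \<alpha>) (fls_const \<beta>) f m" and \<alpha>: "\<alpha> \<noteq> 0"
    and base: "quartic_at (fls_const \<alpha>) (fls_const \<beta>) (fls_const J) f 0"
    and init: "f 0 = 1" "f 1 = 1" "fls_deriv (f (- 1)) \<noteq> 0"
  shows "f m \<noteq> 0" "quartic_at (fls_const \<alpha>) (fls_const \<beta>) (fls_const J) f m"
    "cubic_at (fls_const \<alpha>) (fls_const J) f m"
proof -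
  let ?q = "quartic_at (fls_const \<alpha>) (fls_const \<beta>) (fls_const J)"
  define g where "g n = f (1 - n)" for n
  have f1: "f (- 1) \<noteq> 0" using init by auto
  have up: "f (m - 1) \<noteq> 0 \<and> f m \<noteq> 0 \<and> f (m + 1) \<noteq> 0 \<and> f (m + 2) \<noteq> 0 \<and> ?q f m \<and>
     fls_deriv (f (m + 1) * f (m - 1) / f m ^ 2) \<noteq> 0" if "m \<ge> 0" for m
    by (rule quartic_propagate[OF somos \<alpha> base _ _ _ _ that]) (use init f1 in auto)
  have somos_g: "somos_at (fls_const \<alpha>) (fls_const \<beta>) g m" for m
    using somos[of "1 - m"] by (simp add: somos_at_def g_def algebra_simps)
  have base_g: "?q g 0"
    using base by (simp add: quartic_at_def g_def init algebra_simps)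
  have down: "g (m - 1) \<noteq> 0 \<and> g m \<noteq> 0 \<and> g (m + 1) \<noteq> 0 \<and> g (m + 2) \<noteq> 0 \<and> ?q g m \<and>
     fls_deriv (g (m + 1) * g (m - 1) / g m ^ 2) \<noteq> 0" if "m \<ge> 0" for m
    \<comment> \<open>For \<open>g\<close> the quotient at 0 is e 1 of \<open>f\<close>, whose
      derivative is nonzero by \<open>up\<close> at 1.\<close>
    by (rule quartic_propagate[OF somos_g \<alpha> base_g _ _ _ _ that])
       (use init f1 up[of 1] in \<open>auto simp: g_def\<close>)
  have nz: "f m \<noteq> 0" for m
    using up[of m] down[of "1 - m"] by (cases "m \<ge> 0") (auto simp: g_def)
  have q: "?q f m" for m
  proof (cases "m \<ge> 0")
    case False
    hence "?q g (- m)" using down[of "- m"] by simp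
    moreover have "1 - (- m - 1) = m + 2" "1 - (- m + 1) = m" "1 - (- m + 2) = m - 1"
      "1 - - m = m + 1" by simp_all
    ultimately show ?thesis by (simp add: quartic_at_def g_def) (simp add: algebra_simps)
  qed (use up in blast)
  show "f m \<noteq> 0" "?q f m" by (fact nz q)+
  show "cubic_at (fls_const \<alpha>) (fls_const J) f m"
    using quartic_imp_cubic[of _ _ f "m - 1"] somos q nz[of "m - 2"] by fastforce
qed

lemma weierstrass_complete_square:
  "4 * weierstrass_eq E x y = beta1 E x y ^ 2 - (4 * x ^ 3 + b2 E * x ^ 2 + 2 * b4 E * x + b6 E)"
  by (simp add: weierstrass_eq_def beta1_def b2_def b4_def b6_def algebra_simps power2_eq_square
      power3_eq_cube)

text \<open>Off the points of order two x is a local parameter: completing the square, y is found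
  from a square root of a power series whose constant term is the nonzero square of
  \<open>beta1\<close>.\<close>

lemma deform_point:
  fixes E :: "rat weierstrass"
  assumes "weierstrass_eq E x y = 0" "beta1 E x y \<noteq> 0"
  obtains yt :: "rat fps" where
    "weierstrass_eq (map_weierstrass fps_const E) (fps_const x + fps_X) yt = 0" "fps_nth yt 0 = y"
proof -
  let ?E = "map_weierstrass fps_const E"
  define b where "b = beta1 E x y"
  define X where "X = fps_const x + fps_X"
  define G where "G = 4 * X ^ 3 + b2 ?E * X ^ 2 + 2 * b4 ?E * X + b6 ?E"
  \<comment> \<open>\<open>fps_radical\<close> takes the root of the constant term as an argument;
    returning \<open>b\<close> makes the branch pass through the given point.\<close>
  define w where "w = fps_radical (\<lambda>_ _. b) 2 G"
  define yt where "yt = fps_const (1 / 2) * (w - a1 ?E * X - a3 ?E)"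
  have coeffs: "a1 ?E = fps_const (a1 E)" "a2 ?E = fps_const (a2 E)" "a3 ?E = fps_const (a3 E)"
    "a4 ?E = fps_const (a4 E)" "a6 ?E = fps_const (a6 E)"
    by (simp_all add: weierstrass.map_sel)
  have X0: "fps_nth X 0 = x" by (simp add: X_def)
  have num: "fps_nth (numeral k) 0 = (numeral k :: rat)" for k
    by (simp add: numeral_fps_const)
  have "fps_nth G 0 = 4 * x ^ 3 + b2 E * x ^ 2 + 2 * b4 E * x + b6 E"
    by (simp add: G_def b2_def b4_def b6_def coeffs X0 num fps_power_zeroth)
  also have "\<dots> = b ^ 2" using weierstrass_complete_square[of E x y] assms(1) by (simp add: b_def)
  finally have G0: "fps_nth G 0 = b ^ 2" .
  have "w ^ 2 = G"
    using power_radical[of G "\<lambda>_ _. b" 1] assms(2) G0 by (simp add: w_def numeral_2_eq_2 b_def)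
  moreover have two: "2 * fps_const (1 / 2 :: rat) = 1"
    unfolding numeral_fps_const fps_const_mult by simp
  have "beta1 ?E X yt = w"
  proof -
    have "beta1 ?E X yt = (2 * fps_const (1 / 2)) * (w - a1 ?E * X - a3 ?E) + a1 ?E * X + a3 ?E"
      by (simp add: beta1_def yt_def mult.assoc)
    thus ?thesis unfolding two by simp
  qed
  ultimately have "4 * weierstrass_eq ?E X yt = 0"
    by (simp add: weierstrass_complete_square G_def)
  hence "weierstrass_eq ?E X yt = 0"
    by (simp add: numeral_fps_const)
  moreover have "fps_nth yt 0 = y"
  proof -
    have "fps_nth w 0 = b" by (simp add: w_def)
    thus ?thesis by (simp add: yt_def coeffs X0 b_def beta1_def field_simps)
  qed
  ultimately show ?thesis using that unfolding X_def by blast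
qed

text \<open>
  Over \<open>\<rat>\<close> a value \<open>Psi_val Psi E P1 P2 n\<close> vanishes when \<open>[n]P1 + P2\<close> is the point at infinity, and then
  the recurrence no longer determines the later values. Moving the second point along the curve, to
  \<open>x2 + t\<close> over \<open>\<rat>((t))\<close>, all values become nonzero, and the relations specialize to \<open>t = 0\<close>.
\<close>

lemma Psi_val_relations:
  fixes E :: "rat weierstrass" and w :: "int \<Rightarrow> rat"
  assumes Psi: "translated_division_polynomials Psi"
    and P1: "weierstrass_eq E x1 y1 = 0" "beta1 E x1 y1 \<noteq> 0"
    and P2: "weierstrass_eq E x2 y2 = 0" "beta1 E x2 y2 \<noteq> 0" and ne: "x1 \<noteq> x2"
  defines "\<alpha> \<equiv> beta1 E x1 y1 ^ 2" and "\<beta> \<equiv> beta2 E x1" and "J \<equiv> jinv E x1"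
  assumes w: "w 0 = 0" "w 1 = 1" "w 2 = beta1 E x1 y1" "w 3 = \<beta>"
    "\<And>k. k \<ge> 2 \<Longrightarrow> somos_at \<alpha> \<beta> w k" "\<And>k. k \<ge> 2 \<Longrightarrow> cubic_at \<alpha> J w k"
  defines "f \<equiv> Psi_val Psi E (Affine x1 y1) (Affine x2 y2)"
  shows "f (- 1) = x1 - x2" "f 0 = 1" "f 1 = 1"
    "f 2 = xdiff_add E x1 x2 ((y2 - y1) / (x2 - x1))"
    "somos_at \<alpha> \<beta> f m" "cubic_at \<alpha> J f m"
    "k \<ge> 1 \<Longrightarrow> bilinear_even_at w f k m" "k \<ge> 1 \<Longrightarrow> bilinear_odd_at w f k m"
proof -
  let ?spec = "specialization E (Affine x1 y1) (Affine x2 y2)"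
  have u: "1 / (x1 - x2) * (x1 - x2) = 1" using ne by simp
  have "respects_rstar ?spec"
    using P1(1) P2(1) u by (simp add: respects_rstar_def weierstrass_eq_def)
  note ev = translated_division_polynomials_eval[OF Psi this]
  have coll: "Weierstrass (a1 E) (a2 E) (a3 E) (a4 E) (a6 E) = E" by (cases E) simp
  have slope: "(y1 - y2) * (1 / (x1 - x2)) = (y2 - y1) / (x2 - x1)"
    by (metis minus_diff_eq minus_divide_divide times_divide_eq_right mult.right_neutral)
  show "f (- 1) = x1 - x2" "f 0 = 1" "f 1 = 1"
    "f 2 = xdiff_add E x1 x2 ((y2 - y1) / (x2 - x1))" "somos_at \<alpha> \<beta> f m"
    using ev unfolding specialization.simps point.sel coll slope
    by (simp_all add: f_def Psi_val_def xdiff_add_def somos_at_def \<alpha>_def \<beta>_def)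

  obtain yt where yt: "weierstrass_eq (map_weierstrass fps_const E) (fps_const x2 + fps_X) yt = 0"
    "fps_nth yt 0 = y2"
    using deform_point[OF P2] by blast
  define D where "D = fps_const x1 - (fps_const x2 + fps_X)"
  \<comment> \<open>\<open>D\<close> has the nonzero constant term x1 - x2, so the substitution has
    values in power series, where t = 0 can be inserted. Laurent series serve as the field in which
    values are cancelled.\<close>
  define s where "s v = (case v of
      Al1 \<Rightarrow> fps_const (a1 E) | Al2 \<Rightarrow> fps_const (a2 E) | Al3 \<Rightarrow> fps_const (a3 E)
    | Al4 \<Rightarrow> fps_const (a4 E) | Al6 \<Rightarrow> fps_const (a6 E) | X1 \<Rightarrow> fps_const x1 | Y1 \<Rightarrow> fps_const y1
    | X2 \<Rightarrow> fps_const x2 + fps_X | Y2 \<Rightarrow> yt | U \<Rightarrow> inverse D)" for v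
  define g where "g n = eval_mpoly s (Psi n)" for n
  define F where "F n = fps_to_fls (g n)" for n
  have D0: "fps_nth D 0 = x1 - x2" by (simp add: D_def)
  have g0: "fps_nth (g n) 0 = f n" for n
  proof -
    have "fps_nth (g n) 0 = eval_mpoly (\<lambda>v. fps_nth (s v) 0) (Psi n)"
      unfolding g_def by (rule eval_mpoly_compose) simp_all
    also have "(\<lambda>v. fps_nth (s v) 0) = ?spec"
    proof
      fix v show "fps_nth (s v) 0 = ?spec v"
        by (cases v) (simp_all add: s_def yt(2) D0 inverse_eq_divide)
    qed
    finally show ?thesis by (simp add: f_def Psi_val_def)
  qed
  define s' where "s' v = fps_to_fls (s v)" for v
  have F: "F n = eval_mpoly s' (Psi n)" for n
    unfolding F_def g_def s'_def
    by (rule eval_mpoly_compose) (simp_all add: fls_times_fps_to_fls)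
  let ?E = "map_weierstrass fls_const E"
  let ?c = "fls_const :: rat \<Rightarrow> rat fls"
  have coeffs: "a1 ?E = ?c (a1 E)" "a2 ?E = ?c (a2 E)" "a3 ?E = ?c (a3 E)"
    "a4 ?E = ?c (a4 E)" "a6 ?E = ?c (a6 E)"
    by (simp_all add: weierstrass.map_sel)
  have s'v: "s' Al1 = ?c (a1 E)" "s' Al2 = ?c (a2 E)" "s' Al3 = ?c (a3 E)" "s' Al4 = ?c (a4 E)"
    "s' Al6 = ?c (a6 E)" "s' X1 = ?c x1" "s' Y1 = ?c y1" "s' X2 = ?c x2 + fls_X"
    "s' Y2 = fps_to_fls yt" "s' U = fps_to_fls (inverse D)"
    by (simp_all add: s'_def s_def)
  have E': "Weierstrass (s' Al1) (s' Al2) (s' Al3) (s' Al4) (s' Al6) = ?E"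
    by (cases E) (simp add: s'v)
  have on1: "weierstrass_eq ?E (?c x1) (?c y1) = 0"
  proof -
    have "weierstrass_eq ?E (?c x1) (?c y1) = ?c (weierstrass_eq E x1 y1)"
      by (simp only: weierstrass_eq_def coeffs fls_const_hom)
    thus ?thesis by (simp add: P1)
  qed
  have on2: "weierstrass_eq ?E (s' X2) (s' Y2) = 0"
  proof -
    have "fps_to_fls (weierstrass_eq (map_weierstrass fps_const E) (fps_const x2 + fps_X) yt)
      = weierstrass_eq ?E (s' X2) (s' Y2)"
      by (simp add: weierstrass_eq_def weierstrass.map_sel s'v fls_times_fps_to_fls fps_to_fls_power)
    thus ?thesis using yt(1) by simp
  qed
  have "inverse D * D = 1" using D0 ne by (intro inverse_mult_eq_1) simp
  hence "fps_to_fls (inverse D) * fps_to_fls D = 1"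
    by (metis fls_times_fps_to_fls fps_one_to_fls)
  moreover have Ds: "fps_to_fls D = s' X1 - s' X2" by (simp add: D_def s'v)
  ultimately have U: "s' U * (s' X1 - s' X2) = 1" by (simp add: s'v)
  have "respects_rstar s'"
    unfolding respects_rstar_def E' using on1 on2 U by (simp add: s'v)
  note ev' = translated_division_polynomials_eval[OF Psi this, folded F, unfolded E']
  have neX: "s' X2 \<noteq> s' X1" using U by auto
  hence "s' U = 1 / (s' X1 - s' X2)" using U by (simp add: eq_divide_eq)
  hence slope': "(s' Y1 - s' Y2) * s' U = (s' Y2 - s' Y1) / (s' X2 - s' X1)"
    by (metis minus_diff_eq minus_divide_divide times_divide_eq_right mult.right_neutral)
  have coeff_consts: "beta1 ?E (?c x1) (?c y1) ^ 2 = ?c \<alpha>" "beta2 ?E (?c x1) = ?c \<beta>"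
    "jinv ?E (?c x1) = ?c J"
    by (simp_all only: \<alpha>_def \<beta>_def J_def beta1_def beta2_def jinv_def b2_def b4_def b6_def b8_def
        coeffs fls_const_hom)
  have somosF: "somos_at (?c \<alpha>) (?c \<beta>) F m" for m
    using ev'(5)[of m] by (simp only: somos_at_def coeff_consts s'v)
  have F2: "F 2 = xdiff_add ?E (s' X1) (s' X2) ((s' Y2 - s' Y1) / (s' X2 - s' X1))"
    using ev'(4) unfolding slope' by (simp add: xdiff_add_def coeffs s'v)
  have base: "quartic_at (?c \<alpha>) (?c \<beta>) (?c J) F 0"
    using quartic_base[OF _ on2 neX refl ev'(1,2,3) F2] on1 coeff_consts by (simp add: s'v)
  \<comment> \<open>F (- 1) is x1 - x2 - t, so the quotient at 0 really moves with t.\<close>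
  have "fls_deriv (F (- 1)) \<noteq> 0" unfolding ev'(1) by (simp add: s'v)
  note rels = all_relations_fls[OF somosF _ base ev'(2,3) this]
  have \<alpha>0: "\<alpha> \<noteq> 0" using P1(2) by (simp add: \<alpha>_def)
  define W where "W k = ?c (w k)" for k
  have W: "somos_at (?c \<alpha>) (?c \<beta>) W k" "cubic_at (?c \<alpha>) (?c J) W k" if "k \<ge> 2" for k
    using w(5,6)[OF that] unfolding somos_at_def cubic_at_def W_def
    by (simp_all only: fls_const_hom[symmetric])
  have W0: "W 0 = 0" "W 1 = 1" "W 2 ^ 2 = ?c \<alpha>" "W 3 = ?c \<beta>" "W 2 \<noteq> 0"
    using P1(2) by (simp_all add: W_def w(1-4) \<alpha>_def fls_const_power)
  have bil: "bilinear_even_at W F k m" "bilinear_odd_at W F k m" if "k \<ge> 1"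
    using bilinear_relations[where f = F and a = "m - k - 2" and b = "m + k + 2" and k = k,
        OF W0 W somosF rels(3)[OF \<alpha>0] rels(2)[OF \<alpha>0] rels(1)[OF \<alpha>0] that]
    by simp_all
  have WF: "W k = fps_to_fls (fps_const (w k))" for k by (simp add: W_def)
  have const: "?c c = fps_to_fls (fps_const c)" for c by simp
  \<comment> \<open>Relations between Laurent series are read as relations between power series, the
    inclusion being injective, and then constant terms are compared.\<close>
  note descend = F_def WF const fls_times_fps_to_fls[symmetric] fps_to_fls_power[symmetric]
    fps_to_fls_minus[symmetric] fps_to_fls_plus[symmetric] fps_to_fls_eq_iff
  note spec0 = fps_mult_nth_0 fps_sub_nth fps_add_nth fps_power_zeroth fps_nth_fps_const g0 if_True
  show "cubic_at \<alpha> J f m"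
    using arg_cong[OF rels(3)[OF \<alpha>0, of m, unfolded cubic_at_def descend], of "\<lambda>h. fps_nth h 0"]
    by (simp add: spec0 cubic_at_def)
  show "bilinear_even_at w f k m" if "k \<ge> 1"
    using arg_cong[OF bil(1)[OF that, unfolded bilinear_even_at_def descend], of "\<lambda>h. fps_nth h 0"]
    by (simp add: spec0 bilinear_even_at_def)
  show "bilinear_odd_at w f k m" if "k \<ge> 1"
    using arg_cong[OF bil(2)[OF that, unfolded bilinear_odd_at_def descend], of "\<lambda>h. fps_nth h 0"]
    by (simp add: spec0 bilinear_odd_at_def)
qed

section \<open>Rationals integral at a prime\<close>

text \<open>Frees integrality from lowest terms: any fraction with denominator prime to
  \<open>p\<close> will do.\<close>

lemma p_integral_alt:
  assumes "prime p"
  shows "p_integral p u \<longleftrightarrow> (\<exists>a b. coprime b (int p) \<and> b \<noteq> 0 \<and> u = of_int a / of_int b)"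
proof
  assume "p_integral p u"
  moreover have "u = of_int (fst (quotient_of u)) / of_int (snd (quotient_of u))"
    by (rule quotient_of_div) simp
  moreover have "snd (quotient_of u) \<noteq> 0" using quotient_of_denom_pos'[of u] by simp
  ultimately show "\<exists>a b. coprime b (int p) \<and> b \<noteq> 0 \<and> u = of_int a / of_int b"
    unfolding p_integral_def by blast
next
  assume "\<exists>a b. coprime b (int p) \<and> b \<noteq> 0 \<and> u = of_int a / of_int b"
  then obtain a b where ab: "coprime b (int p)" "b \<noteq> 0" "u = of_int a / of_int b" by blast
  obtain c d where cd: "quotient_of u = (c, d)" by fastforce
  have d: "d > 0" "coprime c d" using quotient_of_denom_pos[OF cd] quotient_of_coprime[OF cd] by simp_all
  have "of_int a / of_int b = (of_int c / of_int d :: rat)"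
    using quotient_of_div[OF cd] ab(3) by simp
  hence "of_int (a * d) = (of_int (c * b) :: rat)"
    using ab(2) d(1) by (simp add: frac_eq_eq)
  hence "a * d = c * b" by (simp only: of_int_eq_iff)
  hence "d dvd b" using d(2) by (metis coprime_commute coprime_dvd_mult_right_iff dvd_triv_right)
  hence "coprime d (int p)" using ab(1) by (meson coprime_divisors dvd_refl)
  thus "p_integral p u" by (simp add: p_integral_def cd)
qed

lemma p_integral_of_int: "prime p \<Longrightarrow> p_integral p (of_int a)"
  unfolding p_integral_alt by (intro exI[of _ a] exI[of _ 1]) simp

lemma p_integral_of_nat: "prime p \<Longrightarrow> p_integral p (of_nat a)"
  using p_integral_of_int[of p "int a"] by simp

lemma p_integral_numeral: "prime p \<Longrightarrow> p_integral p (numeral a)"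
  using p_integral_of_int[of p "numeral a"] by simp

lemma p_integral_0: "prime p \<Longrightarrow> p_integral p 0"
  using p_integral_of_int[of p 0] by simp

lemma p_integral_1: "prime p \<Longrightarrow> p_integral p 1"
  using p_integral_of_int[of p 1] by simp

lemma p_integral_add:
  assumes "prime p" "p_integral p u" "p_integral p v" shows "p_integral p (u + v)"
proof -
  obtain a b c d where "coprime b (int p)" "b \<noteq> 0" "u = of_int a / of_int b"
    "coprime d (int p)" "d \<noteq> 0" "v = of_int c / of_int d"
    using assms p_integral_alt by blast
  thus ?thesis unfolding p_integral_alt[OF assms(1)]
    by (intro exI[of _ "a * d + c * b"] exI[of _ "b * d"]) (simp add: field_simps)
qed

lemma p_integral_mult:
  assumes "prime p" "p_integral p u" "p_integral p v" shows "p_integral p (u * v)"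
proof -
  obtain a b c d where "coprime b (int p)" "b \<noteq> 0" "u = of_int a / of_int b"
    "coprime d (int p)" "d \<noteq> 0" "v = of_int c / of_int d"
    using assms p_integral_alt by blast
  thus ?thesis unfolding p_integral_alt[OF assms(1)]
    by (intro exI[of _ "a * c"] exI[of _ "b * d"]) simp
qed

lemma p_integral_uminus: "prime p \<Longrightarrow> p_integral p u \<Longrightarrow> p_integral p (- u)"
  using p_integral_mult[of p "of_int (- 1)" u] p_integral_of_int[of p "- 1"] by simp

lemma p_integral_diff: "prime p \<Longrightarrow> p_integral p u \<Longrightarrow> p_integral p v \<Longrightarrow> p_integral p (u - v)"
  using p_integral_add[of p u "- v"] p_integral_uminus[of p v] by simp

lemma p_integral_power: "prime p \<Longrightarrow> p_integral p u \<Longrightarrow> p_integral p (u ^ n)"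
  by (induction n) (simp_all add: p_integral_1 p_integral_mult)

lemmas p_integral_intros = p_integral_of_int p_integral_of_nat p_integral_numeral p_integral_0
  p_integral_1 p_integral_add p_integral_mult p_integral_uminus p_integral_diff p_integral_power

text \<open>The first conjunct excludes 0, whose inverse is 0 and hence integral.\<close>

definition p_unit :: "nat \<Rightarrow> rat \<Rightarrow> bool" where
  "p_unit p u \<longleftrightarrow> u \<noteq> 0 \<and> p_integral p u \<and> p_integral p (inverse u)"

lemma p_integral_cases:
  assumes "prime p" "p_integral p u"
  shows "p_unit p u \<or> (\<exists>z. p_integral p z \<and> u = of_nat p * z)"
proof -
  obtain a b where ab: "coprime b (int p)" "b \<noteq> 0" "u = of_int a / of_int b"
    using assms p_integral_alt by blast
  show ?thesis
  proof (cases "int p dvd a")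
    case True
    then obtain c where "a = int p * c" by blast
    hence "u = of_nat p * (of_int c / of_int b)" by (simp add: ab)
    thus ?thesis using ab(1,2) p_integral_alt[OF assms(1)] by blast
  next
    case False
    have "prime (int p)" using assms(1) by simp
    hence "coprime a (int p)" using False by (meson coprime_commute prime_imp_coprime)
    moreover have "a \<noteq> 0" using False by auto
    moreover have "inverse u = of_int b / of_int a" by (simp add: ab)
    ultimately show ?thesis using ab assms p_integral_alt[OF assms(1)] unfolding p_unit_def by auto
  qed
qed

lemma p_integral_inverse_p:
  assumes "prime p" shows "\<not> p_integral p (inverse (of_nat p))"
proof
  assume "p_integral p (inverse (of_nat p))"
  then obtain a b where ab: "coprime b (int p)" "b \<noteq> 0" "inverse (of_nat p) = (of_int a / of_int b :: rat)"
    using assms p_integral_alt by blast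
  have "p > 1" using assms prime_gt_1_nat by simp
  hence "of_int b = (of_int (int p * a) :: rat)" using ab(2,3) by (simp add: field_simps)
  hence "b = int p * a" by (simp only: of_int_eq_iff)
  hence "int p dvd 1" using ab(1) by (metis coprime_common_divisor dvd_refl dvd_triv_left)
  thus False using \<open>p > 1\<close> by simp
qed

lemma p_unit_not_multiple:
  assumes "prime p" "p_unit p (of_nat p * z)" "p_integral p z" shows False
proof -
  have "z \<noteq> 0" using assms(2) by (auto simp: p_unit_def)
  hence "z * inverse (of_nat p * z) = inverse (of_nat p)" by simp
  moreover have "p_integral p (z * inverse (of_nat p * z))"
    using assms p_integral_mult unfolding p_unit_def by blast
  ultimately show False using p_integral_inverse_p[OF assms(1)] by metis
qed

lemma p_unit_mult: "prime p \<Longrightarrow> p_unit p u \<Longrightarrow> p_unit p v \<Longrightarrow> p_unit p (u * v)"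
  by (simp add: p_unit_def p_integral_mult)

lemma p_unit_power: "prime p \<Longrightarrow> p_unit p u \<Longrightarrow> p_unit p (u ^ n)"
  by (simp add: p_unit_def p_integral_power flip: power_inverse)

text \<open>Integral closedness in degree two: if z is not integral, then its inverse is, and z = c
  / z - b is integral after all.\<close>

lemma p_integral_monic_quadratic:
  assumes p: "prime p" and bc: "p_integral p b" "p_integral p c" and eq: "z ^ 2 + b * z = c"
  shows "p_integral p z"
proof (rule ccontr)
  assume n: "\<not> p_integral p z"
  obtain m d where md: "quotient_of z = (m, d)" by fastforce
  have d: "d > 0" "coprime m d" and z: "z = of_int m / of_int d"
    using quotient_of_denom_pos[OF md] quotient_of_coprime[OF md] quotient_of_div[OF md] by simp_all
  have "\<not> coprime d (int p)" using n md by (simp add: p_integral_def)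
  hence pd: "int p dvd d" using p by (metis coprime_commute prime_imp_coprime prime_nat_int_transfer)
  hence "\<not> int p dvd m" using d(2) p
    by (metis coprime_common_divisor not_prime_unit prime_nat_int_transfer)
  hence m: "coprime m (int p)" "m \<noteq> 0"
    using p by (metis coprime_commute prime_imp_coprime prime_nat_int_transfer, auto)
  have inv: "inverse z = of_int d / of_int m" by (simp add: z)
  hence I: "p_integral p (inverse z)" using m p_integral_alt[OF p] by blast
  have z0: "z \<noteq> 0" using m(2) d(1) by (simp add: z)
  have "z = (z ^ 2 + b * z) * inverse z - b"
    using z0 by (simp add: power2_eq_square algebra_simps)
  hence "z = c * inverse z - b" by (simp add: eq)
  moreover have "p_integral p (c * inverse z - b)" using p bc I by (intro p_integral_intros)
  ultimately show False using n by simp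
qed

lemma not_unit_multiple:
  assumes "prime p" "p_integral p u" "\<not> p_unit p u"
  obtains z where "p_integral p z" "u = of_nat p * z"
  using p_integral_cases[OF assms(1,2)] assms(3) by blast

text \<open>The bound is the negation of \<open>cong_infinity p 1\<close>. Taken alone it leaves
  room for one factor \<open>p\<close> in the denominator; a curve or slope equation has to remove
  it.\<close>

lemma rat_ord_pos_multiple:
  assumes p: "prime p" and ord: "- 2 < rat_ord p x"
  shows "p_integral p (of_nat p * x)"
proof -
  obtain m d where md: "quotient_of x = (m, d)" by fastforce
  have d: "d > 0" "coprime m d" and z: "x = of_int m / of_int d"
    using quotient_of_denom_pos[OF md] quotient_of_coprime[OF md] quotient_of_div[OF md] by simp_all
  have pp: "prime (int p)" using p by simp
  show ?thesis
  proof (cases "int p dvd d")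
    case False
    hence "coprime d (int p)" using pp by (meson coprime_commute prime_imp_coprime)
    hence "p_integral p x" by (simp add: p_integral_def md)
    thus ?thesis by (intro p_integral_intros p)
  next
    case True
    hence "\<not> int p dvd m" using d(2) pp by (metis coprime_common_divisor not_prime_unit)
    hence "multiplicity (int p) m = 0" by (simp add: not_dvd_imp_multiplicity_0)
    hence "multiplicity (int p) d < 2" using ord by (simp add: rat_ord_def md)
    hence "\<not> (int p) ^ 2 dvd d"
      using d(1) pp by (metis multiplicity_geI not_le not_prime_unit order.strict_implies_not_eq)
    moreover obtain d' where d': "d = int p * d'" using True by blast
    ultimately have "\<not> int p dvd d'" by (simp add: power2_eq_square)
    hence "coprime d' (int p)" using pp by (meson coprime_commute prime_imp_coprime)
    moreover have "p \<noteq> 0" using p by auto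
    hence "of_nat p * x = of_int m / of_int d'" by (simp add: z d')
    moreover have "d' \<noteq> 0" using d d' by auto
    ultimately show ?thesis using p_integral_alt[OF p] by blast
  qed
qed

lemma p_square_root_multiple:
  assumes p: "prime p" and c: "p_integral p c" and b: "p_integral p b" "p_integral p z"
    and eq: "z ^ 2 + of_nat p * b * z = of_nat p * c"
  shows "\<exists>z'. p_integral p z' \<and> z = of_nat p * z'"
proof (rule ccontr)
  assume "\<not> ?thesis"
  hence "p_unit p z" using p_integral_cases[OF p b(2)] by blast
  hence "p_unit p (z ^ 2)" using p by (intro p_unit_power)
  moreover have "z ^ 2 = of_nat p * (c - b * z)" using eq by (simp add: algebra_simps)
  ultimately show False using p_unit_not_multiple[OF p, of "c - b * z"] b c p
    by (metis p_integral_diff p_integral_mult)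
qed

text \<open>The number p l is integral and its square is divisible by \<open>p\<close>, so it is
  itself divisible by \<open>p\<close>. Applied to the chord through P1 and P2, whose denominator x2
  - x1 may be divisible by \<open>p\<close>.\<close>

lemma slope_p_integral:
  assumes p: "prime p" and I: "p_integral p a" "p_integral p c" and x: "x = l ^ 2 + a * l - c"
    and ord: "- 2 < rat_ord p x"
  shows "p_integral p l"
proof -
  have px: "p_integral p (of_nat p * x)" by (rule rat_ord_pos_multiple[OF p ord])
  define z where "z = of_nat p * l"
  have p0: "(of_nat p :: rat) \<noteq> 0" using p by auto
  have eq: "z ^ 2 + of_nat p * a * z = of_nat p * (of_nat p * x + of_nat p * c)"
    by (simp add: z_def x algebra_simps power2_eq_square)
  have "p_integral p z"
    by (rule p_integral_monic_quadratic[OF p _ _ eq]) (intro p_integral_intros p I px)+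
  moreover have "p_integral p (of_nat p * x + of_nat p * c)"
    by (intro p_integral_intros p I px)
  ultimately obtain z' where "p_integral p z'" "z = of_nat p * z'"
    using p_square_root_multiple[OF p _ I(1) _ eq] by blast
  thus ?thesis using p0 by (simp add: z_def)
qed

text \<open>A single \<open>p\<close> in the denominator of x would force the odd power p ^ 3 in the
  denominator of y ^ 2. Scaling by p ^ 4 expresses this without valuations: X = p x would be a unit
  whose cube is divisible by \<open>p\<close>.\<close>

lemma affine_point_p_integral:
  assumes p: "prime p" and E: "p_integral_curve p E"
    and on: "weierstrass_eq E x y = 0" and ord: "- 2 < rat_ord p x"
  shows "p_integral p x \<and> p_integral p y"
proof -
  have a: "p_integral p (a1 E)" "p_integral p (a2 E)" "p_integral p (a3 E)" "p_integral p (a4 E)"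
    "p_integral p (a6 E)"
    using E by (cases E; simp add: p_integral_curve_def)+
  have px: "p_integral p (of_nat p * x)" by (rule rat_ord_pos_multiple[OF p ord])
  have p0: "(of_nat p :: rat) \<noteq> 0" using p by auto
  have x: "p_integral p x"
  proof (rule ccontr)
    assume n: "\<not> p_integral p x"
    define X where "X = of_nat p * x"
    define P :: rat where "P = of_nat p"
    have PX: "p_integral p P" "p_integral p X" by (simp_all add: P_def X_def p_integral_of_nat p px)
    have uX: "p_unit p X" using p_integral_cases[OF p PX(2)] n p0 by (auto simp: X_def)
    define z where "z = P ^ 2 * y"
    define c where "c = X ^ 3 + P * (a2 E * X ^ 2) + P ^ 2 * (a4 E * X) + P ^ 3 * a6 E"
    have "z ^ 2 + P * (a1 E * X + P * a3 E) * z = P ^ 4 * (y ^ 2 + a1 E * x * y + a3 E * y)"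
      by (simp add: z_def X_def P_def[symmetric] algebra_simps power2_eq_square power4_eq_xxxx)
    also have "\<dots> = P ^ 4 * (x ^ 3 + a2 E * x ^ 2 + a4 E * x + a6 E)"
      using on by (simp add: weierstrass_eq_def algebra_simps)
    also have "\<dots> = P * c"
      by (simp add: c_def X_def P_def[symmetric] algebra_simps power2_eq_square power3_eq_cube power4_eq_xxxx)
    finally have eq: "z ^ 2 + P * (a1 E * X + P * a3 E) * z = P * c" .
    have Ic: "p_integral p c" unfolding c_def by (intro p_integral_intros p a PX)
    have Ib: "p_integral p (a1 E * X + P * a3 E)" by (intro p_integral_intros p a PX)
    have "p_integral p z"
      by (rule p_integral_monic_quadratic[OF p _ _ eq]) (intro p_integral_intros p Ib Ic PX)+
    then obtain z' where z': "p_integral p z'" "z = P * z'"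
      using p_square_root_multiple[OF p Ic Ib] eq unfolding P_def by blast
    have "P * (P * z' ^ 2 + P * (a1 E * X + P * a3 E) * z') = P * c"
      using eq unfolding z'(2) by (simp add: algebra_simps power2_eq_square)
    hence "c = P * z' ^ 2 + P * (a1 E * X + P * a3 E) * z'" using p0 by (simp add: P_def)
    hence "X ^ 3 = P * (z' ^ 2 + (a1 E * X + P * a3 E) * z' - a2 E * X ^ 2 - P * (a4 E * X) - P ^ 2 * a6 E)"
      by (simp add: c_def algebra_simps power2_eq_square power3_eq_cube)
    moreover have "p_integral p (z' ^ 2 + (a1 E * X + P * a3 E) * z' - a2 E * X ^ 2 - P * (a4 E * X) - P ^ 2 * a6 E)"
      by (intro p_integral_intros p a PX z')
    ultimately show False using p_unit_not_multiple[OF p] p_unit_power[OF p uX, of 3]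
      unfolding P_def by metis
  qed
  have "y ^ 2 + (a1 E * x + a3 E) * y = x ^ 3 + a2 E * x ^ 2 + a4 E * x + a6 E"
    using on by (simp add: weierstrass_eq_def algebra_simps)
  hence "p_integral p y"
    by (rule p_integral_monic_quadratic[OF p, rotated 2]) (intro p_integral_intros p a x)+
  with x show ?thesis ..
qed

section \<open>Reduction and integrality\<close>

lemma p_unit_cancel:
  assumes "prime p" "p_unit p u" "p_integral p (u * z)"
  shows "p_integral p z"
proof -
  have "p_integral p (inverse u * (u * z))" 
    by (rule p_integral_mult[OF assms(1) _ assms(3)]) (use assms(2) in \<open>simp add: p_unit_def\<close>)
  moreover have "inverse u * (u * z) = z" using assms(2) by (simp add: p_unit_def mult.assoc[symmetric])
  ultimately show ?thesis by metis
qed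

text \<open>\<open>red\<close> fixes the target type of the polymorphic \<open>reduce\<close>, the
  field with \<open>p\<close> elements.\<close>

context
  fixes p :: nat and red :: "rat \<Rightarrow> 'p::prime_card mod_ring"
  assumes p: "p = CARD('p)"
  defines "red \<equiv> reduce"
begin

lemma prime_p: "prime p"
  by (simp add: p prime_card)

lemma of_int_mod_ring_eq_0: "(of_int a :: 'p mod_ring) = 0 \<longleftrightarrow> int p dvd a"
  by (simp add: p of_int_of_int_mod_ring) (transfer, auto)

lemma of_int_mod_ring_nonzero: "coprime b (int p) \<Longrightarrow> (of_int b :: 'p mod_ring) \<noteq> 0"
  using prime_p unfolding of_int_mod_ring_eq_0
  by (metis coprime_common_divisor dvd_refl not_prime_unit prime_nat_int_transfer)

lemma reduce_fraction:
  assumes "coprime b (int p)" "b \<noteq> 0"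
  shows "red (of_int a / of_int b) = of_int a / of_int b"
proof -
  obtain c d where cd: "quotient_of (of_int a / of_int b) = (c, d)" by fastforce
  have d: "d > 0" "(of_int a / of_int b :: rat) = of_int c / of_int d"
    using quotient_of_denom_pos[OF cd] quotient_of_div[OF cd] by simp_all
  hence "(of_int (a * d) :: rat) = of_int (c * b)"
    using assms(2) by (simp add: frac_eq_eq)
  hence "a * d = c * b" by (simp only: of_int_eq_iff)
  hence eq: "(of_int a :: 'p mod_ring) * of_int d = of_int c * of_int b"
    by (metis of_int_mult)
  have "p_integral p (of_int a / of_int b)" using assms p_integral_alt[OF prime_p] by blast
  hence cop: "coprime d (int p)" by (simp add: p_integral_def cd)
  have "red (of_int a / of_int b) = of_int c / of_int d"
    by (simp only: red_def reduce_def cd fst_conv snd_conv)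
  also have "\<dots> = of_int a / of_int b"
    using frac_eq_eq[OF of_int_mod_ring_nonzero[OF cop] of_int_mod_ring_nonzero[OF assms(1)]] eq
    by metis
  finally show ?thesis .
qed

lemma reduce_of_int: "red (of_int a) = of_int a"
  using reduce_fraction[of 1 a] by simp

lemma reduce_0: "red 0 = 0" and reduce_1: "red 1 = 1" and reduce_numeral: "red (numeral n) = numeral n"
  using reduce_of_int[of 0] reduce_of_int[of 1] reduce_of_int[of "numeral n"] by simp_all

lemma reduce_add:
  assumes "p_integral p u" "p_integral p v" shows "red (u + v) = red u + red v"
proof -
  obtain a b c d where 1: "coprime b (int p)" "b \<noteq> 0" "u = of_int a / of_int b"
    "coprime d (int p)" "d \<noteq> 0" "v = of_int c / of_int d"
    using assms p_integral_alt[OF prime_p] by blast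
  have "u + v = of_int (a * d + c * b) / of_int (b * d)" using 1 by (simp add: field_simps)
  hence "red (u + v) = of_int (a * d + c * b) / of_int (b * d)"
    using 1 by (simp only: reduce_fraction[of "b * d"] coprime_mult_left_iff mult_eq_0_iff simp_thms)
  also have "\<dots> = red u + red v"
    using 1 of_int_mod_ring_nonzero by (simp add: reduce_fraction add_frac_eq)
  finally show ?thesis .
qed

lemma reduce_mult:
  assumes "p_integral p u" "p_integral p v" shows "red (u * v) = red u * red v"
proof -
  obtain a b c d where 1: "coprime b (int p)" "b \<noteq> 0" "u = of_int a / of_int b"
    "coprime d (int p)" "d \<noteq> 0" "v = of_int c / of_int d"
    using assms p_integral_alt[OF prime_p] by blast
  have "u * v = of_int (a * c) / of_int (b * d)" using 1 by simp
  hence "red (u * v) = of_int (a * c) / of_int (b * d)"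
    using 1 by (simp only: reduce_fraction[of "b * d"] coprime_mult_left_iff mult_eq_0_iff simp_thms)
  also have "\<dots> = red u * red v" using 1 by (simp add: reduce_fraction)
  finally show ?thesis .
qed

lemma reduce_uminus: "p_integral p u \<Longrightarrow> red (- u) = - red u"
  using reduce_mult[of "of_int (- 1)" u] p_integral_of_int[OF prime_p, of "- 1"]
  by (simp add: reduce_of_int[of "- 1", simplified])

lemma reduce_diff: "p_integral p u \<Longrightarrow> p_integral p v \<Longrightarrow> red (u - v) = red u - red v"
  using reduce_add[of u "- v"] p_integral_uminus[OF prime_p] reduce_uminus by simp

lemma reduce_power: "p_integral p u \<Longrightarrow> red (u ^ n) = red u ^ n"
  by (induction n) (simp_all add: reduce_1 reduce_mult p_integral_power prime_p)

lemma reduce_p_multiple: "p_integral p z \<Longrightarrow> red (of_nat p * z) = 0"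
  using reduce_mult[of "of_int (int p)" z] p_integral_of_int[OF prime_p, of "int p"]
    reduce_of_int[of "int p"] of_int_mod_ring_eq_0[of "int p"] by simp

lemma reduce_eq_0_iff: "p_integral p u \<Longrightarrow> red u = 0 \<longleftrightarrow> \<not> p_unit p u"
proof
  assume I: "p_integral p u" and "red u = 0"
  show "\<not> p_unit p u"
  proof
    assume u: "p_unit p u"
    hence "red (u * inverse u) = red u * red (inverse u)" by (intro reduce_mult) (auto simp: p_unit_def)
    moreover have "u * inverse u = 1" using u by (simp add: p_unit_def)
    ultimately show False using \<open>red u = 0\<close> by (simp add: reduce_1)
  qed
next
  assume "p_integral p u" "\<not> p_unit p u"
  then obtain z where "p_integral p z" "u = of_nat p * z" using not_unit_multiple[OF prime_p] by blast
  thus "red u = 0" using reduce_p_multiple by simp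
qed

lemmas reduce_hom = reduce_0 reduce_1 reduce_numeral reduce_add reduce_mult reduce_uminus
  reduce_diff reduce_power

context
  fixes E :: "rat weierstrass"
  assumes E: "p_integral_curve p E"
begin

lemma curve_coeffs_integral: "p_integral p (a1 E)" "p_integral p (a2 E)" "p_integral p (a3 E)"
  "p_integral p (a4 E)" "p_integral p (a6 E)"
  using E by (cases E; simp add: p_integral_curve_def)+

lemma reduce_curve_coeffs: "a1 (reduce_curve E) = red (a1 E)" "a2 (reduce_curve E) = red (a2 E)"
  "a3 (reduce_curve E) = red (a3 E)" "a4 (reduce_curve E) = red (a4 E)"
  "a6 (reduce_curve E) = red (a6 E)"
  by (simp_all add: reduce_curve_def weierstrass.map_sel red_def)

lemma b_integral: "p_integral p (b2 E)" "p_integral p (b4 E)" "p_integral p (b6 E)"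
  "p_integral p (b8 E)"
  unfolding b2_def b4_def b6_def b8_def
  by (intro p_integral_intros prime_p curve_coeffs_integral)+

lemma beta_integral:
  assumes "p_integral p x" "p_integral p y"
  shows "p_integral p (beta1 E x y)" "p_integral p (beta2 E x)" "p_integral p (jinv E x)"
  unfolding beta1_def beta2_def jinv_def
  by (intro p_integral_intros prime_p curve_coeffs_integral b_integral assms)+

lemma reduce_b: "b2 (reduce_curve E) = red (b2 E)" "b4 (reduce_curve E) = red (b4 E)"
  "b6 (reduce_curve E) = red (b6 E)" "b8 (reduce_curve E) = red (b8 E)"
  by (simp_all add: b2_def b4_def b6_def b8_def reduce_curve_coeffs reduce_hom p_integral_intros
      prime_p curve_coeffs_integral)

lemma reduce_beta:
  assumes "p_integral p x" "p_integral p y"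
  shows "beta1 (reduce_curve E) (red x) (red y) = red (beta1 E x y)"
    "beta2 (reduce_curve E) (red x) = red (beta2 E x)"
  by (simp_all add: beta1_def beta2_def reduce_curve_coeffs reduce_b reduce_hom p_integral_intros
      prime_p curve_coeffs_integral b_integral assms)

end

end

section \<open>Integrality of the division sequence and of the translated sequence\<close>

lemma division_sequence_bilinear:
  fixes w :: "int \<Rightarrow> 'a::idom"
  assumes w: "w 0 = 0" "w 1 = 1" "w 2 ^ 2 = \<alpha>" "w 3 = \<beta>"
    and nz: "\<And>k. k \<ge> 1 \<Longrightarrow> w k \<noteq> 0"
    and W: "\<And>k. k \<ge> 2 \<Longrightarrow> somos_at \<alpha> \<beta> w k" "\<And>k. k \<ge> 2 \<Longrightarrow> cubic_at \<alpha> J w k"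
    and k: "k \<ge> 1" "m - k \<ge> 1"
  shows "bilinear_even_at w w k m" "bilinear_odd_at w w k m"
proof -
  have "(\<forall>i. 1 \<le> i - k \<and> i + k \<le> m + k + 2 \<longrightarrow> bilinear_even_at w w k i) \<and>
    (\<forall>i. 1 \<le> i - k \<and> i + k + 1 \<le> m + k + 2 \<longrightarrow> bilinear_odd_at w w k i)"
  proof (rule bilinear_relations[OF w _ W])
    show "quartic_at \<alpha> \<beta> J w i" if "1 \<le> i - 1" for i
      using that by (intro cubic_imp_quartic W) simp_all
  qed (use nz W k in simp_all)
  thus "bilinear_even_at w w k m" "bilinear_odd_at w w k m" using k by simp_all
qed

text \<open>The Somos relation would divide by w (k - 2), which may be divisible by
  \<open>p\<close>. The addition formulas with m next to the shift halve the index instead and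
  divide by the unit w 2 only.\<close>

lemma division_sequence_integral:
  fixes w :: "int \<Rightarrow> rat"
  assumes p: "prime p"
    and w: "w 0 = 0" "w 1 = 1" "w 2 ^ 2 = \<alpha>" "w 3 = \<beta>"
    and nz: "\<And>k. k \<ge> 1 \<Longrightarrow> w k \<noteq> 0"
    and W: "\<And>k. k \<ge> 2 \<Longrightarrow> somos_at \<alpha> \<beta> w k" "\<And>k. k \<ge> 2 \<Longrightarrow> cubic_at \<alpha> J w k"
    and I: "p_unit p (w 2)" "p_integral p \<beta>" "p_integral p J"
  shows "k \<ge> 0 \<Longrightarrow> p_integral p (w k)"
proof (induction "nat k" arbitrary: k rule: less_induct)
  case less
  note bil = division_sequence_bilinear[OF w nz W]
  have I2: "p_integral p (w 2)" using I(1) by (simp add: p_unit_def)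
  show ?case
  proof (cases "k \<le> 4")
    case True
    have "w 4 = J * w 3 * w 2 - \<alpha> * w 2 ^ 3" using W(2)[of 2] by (simp add: cubic_at_def w)
    hence "p_integral p (w 4)" unfolding w(3,4)[symmetric] using I I2
      by (simp only: w(4)) (intro p_integral_intros p; simp)
    moreover have "k = 0 \<or> k = 1 \<or> k = 2 \<or> k = 3 \<or> k = 4" using True less.prems by linarith
    ultimately show ?thesis using w I I2 p_integral_0[OF p] p_integral_1[OF p] by auto
  next
    case False
    show ?thesis
    proof (cases "even k")
      case True
      then obtain j where j: "k = 2 * j" by blast
      have "w 2 * w k = w (j - 1) * w j * w (j + 2) * w (j - 1) - w (j - 2) * w (j + 1) * w (j + 1) * w j"
        using bil(2)[of "j - 1" j] False j w by (simp add: bilinear_odd_at_def add.commute)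
      moreover have I': "p_integral p (w i)" if "j - 2 \<le> i" "i \<le> j + 2" for i
        using less.hyps[of i] that j False by simp
      moreover note I'[of "j - 2"] I'[of "j - 1"] I'[of j] I'[of "j + 1"] I'[of "j + 2"]
      ultimately have "p_integral p (w 2 * w k)" by (simp add: p_integral_intros p)
      thus ?thesis by (rule p_unit_cancel[OF p I(1)])
    next
      case odd: False
      then obtain j where j: "k = 2 * j + 1" by (metis oddE)
      have "w k = w j ^ 2 * w (j + 2) * w j - w (j + 1) * w (j - 1) * w (j + 1) ^ 2"
        using bil(1)[of j "j + 1"] False j w by (simp add: bilinear_even_at_def algebra_simps)
      moreover have I': "p_integral p (w i)" if "j - 1 \<le> i" "i \<le> j + 2" for i
        using less.hyps[of i] that j False by simp
      moreover note I'[of "j - 1"] I'[of j] I'[of "j + 1"] I'[of "j + 2"]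
      ultimately show ?thesis by (simp add: p_integral_intros p)
    qed
  qed
qed

text \<open>Again the index is halved. Here the cofactor of f k is f 0 or f 1, so nothing is divided
  at all, and only the values at 3 and 4 need the recurrences.\<close>

lemma translated_sequence_integral_nonneg:
  fixes f w :: "int \<Rightarrow> rat"
  assumes p: "prime p"
    and f: "f 0 = 1" "f 1 = 1" "\<And>m. somos_at \<alpha> \<beta> f m" "\<And>m. cubic_at \<alpha> J f m"
    and bil: "\<And>k m. k \<ge> 1 \<Longrightarrow> bilinear_even_at w f k m"
    and w: "\<And>k. k \<ge> 0 \<Longrightarrow> p_integral p (w k)"
    and I: "p_integral p \<alpha>" "p_integral p \<beta>" "p_integral p J" "p_integral p (f (- 1))" "p_integral p (f 2)"
  shows "k \<ge> 0 \<Longrightarrow> p_integral p (f k)"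
proof (induction "nat k" arbitrary: k rule: less_induct)
  case less
  show ?case
  proof (cases "k \<le> 4")
    case True
    have "f 3 = J * f 2 - \<alpha> - f (- 1) * f 2 ^ 2"
      using f(4)[of 1] by (simp add: cubic_at_def f(1,2) algebra_simps)
    hence 3: "p_integral p (f 3)" by (simp add: p_integral_intros p I)
    have "f 4 = \<alpha> * f 3 - \<beta> * f 2 ^ 2"
      using f(3)[of 2] by (simp add: somos_at_def f(1,2) algebra_simps)
    hence "p_integral p (f 4)" by (simp add: p_integral_intros p I 3)
    moreover have "k = 0 \<or> k = 1 \<or> k = 2 \<or> k = 3 \<or> k = 4" using True less.prems by linarith
    ultimately show ?thesis using f(1,2) I 3 p_integral_1[OF p] by auto
  next
    case False
    show ?thesis
    proof (cases "even k")
      case True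
      then obtain j where j: "k = 2 * j" by blast
      have "f k = w j ^ 2 * f (j + 1) * f (j - 1) - w (j + 1) * w (j - 1) * f j ^ 2"
        using bil[of j j] False j f(1) by (simp add: bilinear_even_at_def)
      moreover have I': "p_integral p (f i)" "p_integral p (w i)" if "j - 1 \<le> i" "i \<le> j + 1" for i
        using less.hyps[of i] that j False w by simp_all
      moreover note I'[of "j - 1"] I'[of j] I'[of "j + 1"]
      ultimately show ?thesis by (simp add: p_integral_intros p)
    next
      case odd: False
      then obtain j where j: "k = 2 * j + 1" by (metis oddE)
      have "f k = w j ^ 2 * f (j + 2) * f j - w (j + 1) * w (j - 1) * f (j + 1) ^ 2"
        using bil[of j "j + 1"] False j f(2) by (simp add: bilinear_even_at_def algebra_simps)
      moreover have "p_integral p (f j)" "p_integral p (f (j + 1))" "p_integral p (f (j + 2))"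
        "p_integral p (w (j - 1))" "p_integral p (w j)" "p_integral p (w (j + 1))"
        using less.hyps[of j] less.hyps[of "j + 1"] less.hyps[of "j + 2"] j False w by simp_all
      ultimately show ?thesis by (simp add: p_integral_intros p)
    qed
  qed
qed

lemma translated_sequence_integral:
  fixes f w :: "int \<Rightarrow> rat"
  assumes p: "prime p"
    and f: "f 0 = 1" "f 1 = 1" "\<And>m. somos_at \<alpha> \<beta> f m" "\<And>m. cubic_at \<alpha> J f m"
    and bil: "\<And>k m. k \<ge> 1 \<Longrightarrow> bilinear_even_at w f k m"
    and w: "\<And>k. k \<ge> 0 \<Longrightarrow> p_integral p (w k)"
    and I: "p_integral p \<alpha>" "p_integral p \<beta>" "p_integral p J" "p_integral p (f (- 1))" "p_integral p (f 2)"
  shows "p_integral p (f k)"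
proof (cases "k \<ge> 0")
  case True
  show ?thesis by (rule translated_sequence_integral_nonneg[OF assms True])
next
  case False
  define g where "g n = f (1 - n)" for n
  have "p_integral p (g (1 - k))"
  proof (rule translated_sequence_integral_nonneg[OF p _ _ _ _ _ w I(1,2,3)])
    show "somos_at \<alpha> \<beta> g m" for m using f(3)[of "1 - m"] by (simp add: somos_at_def g_def algebra_simps)
    show "cubic_at \<alpha> J g m" for m using f(4)[of "1 - m"] by (simp add: cubic_at_def g_def algebra_simps)
    show "bilinear_even_at w g k m" if "k \<ge> 1" for k m
      using bil[OF that, of "1 - m"] by (simp add: bilinear_even_at_def g_def algebra_simps)
  qed (use False f I in \<open>simp_all add: g_def\<close>)
  thus ?thesis by (simp add: g_def)
qed

section \<open>Geometric shifts modulo an integer\<close>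

text \<open>Congruences are derived as explicit linear combinations: each use supplies the
  coefficients \<open>a\<close> and \<open>b\<close>, and a ring identity over the integers
  remains.\<close>

lemma cong_comb:
  fixes x :: int
  assumes "[x = y] (mod M)" "[u = v] (mod M)" "s - t = a * (x - y) + b * (u - v)"
  shows "[s = t] (mod M)"
  using assms by (simp add: cong_iff_dvd_diff dvd_add dvd_mult)

lemma cong_comb3:
  fixes x :: int
  assumes "[x = y] (mod M)" "[u = v] (mod M)" "[z = w] (mod M)"
    "s - t = a * (x - y) + b * (u - v) + c * (z - w)"
  shows "[s = t] (mod M)"
  using assms by (simp add: cong_iff_dvd_diff dvd_add dvd_mult)

lemma cong_cancel:
  fixes k :: int
  assumes "[k * a = k * b] (mod M)" "coprime k M"
  shows "[a = b] (mod M)"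
  using assms by (simp add: cong_mult_lcancel)

lemma cong_coprime:
  fixes a :: int
  assumes "[a = b] (mod M)" "coprime b M"
  shows "coprime a M"
  using assms by (metis cong_imp_coprime cong_sym)

text \<open>\<open>u\<close>, \<open>v\<close>, \<open>u'\<close>, \<open>v'\<close>,
  \<open>b\<close> stand for w at k + 1, k - 1, k + 2, k - 2 and 2, and \<open>M\<close> divides w
  k. Dividing \<open>r2\<close> by \<open>r1\<close> shows that f (m + k) / f m grows by q = u' / (b
  u) when m grows by 1. This needs f m to be a unit; a nonunit is jumped over with
  \<open>r3\<close>, which gives the factor - u / v for two steps, and this is q ^ 2.\<close>

lemma geometric_shift:
  fixes f :: "int \<Rightarrow> int" and k M :: int
  assumes init: "[f 0 = 1] (mod M)"
    and r1: "\<And>m. [f (m + k) * f (m - k) = - (u * v) * f m ^ 2] (mod M)"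
    and r2: "\<And>m. [b * f (m + k + 1) * f (m - k) = - (v * u') * f (m + 1) * f m] (mod M)"
    and r2': "\<And>m. [b * f (m + k) * f (m - k + 1) = - (v' * u) * f (m + 1) * f m] (mod M)"
    and r3: "\<And>m. [f (m + k + 1) * f (m - k - 1) = u ^ 2 * f (m + 1) * f (m - 1)] (mod M)"
    and cop: "coprime u M" "coprime v M" "coprime b M"
    and w1: "[u' * v' = b ^ 2 * u * v] (mod M)" and w2: "[u' ^ 2 * v = - (b ^ 2 * u ^ 3)] (mod M)"
    and units: "\<And>m. m \<ge> 0 \<Longrightarrow> coprime (f m) M \<or> coprime (f (m + 1)) M"
  obtains c q where "coprime c M" "coprime q M" "[q ^ 2 * v = - u] (mod M)"
    "[f k = c * q] (mod M)"
    "\<And>n. [f (int n - 1 + k) = c * q ^ n * f (int n - 1)] (mod M)"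
proof -
  have bu: "coprime (b * u) M" using cop by simp
  then obtain i where i: "[(b * u) * i = 1] (mod M)"
    using cong_solve_coprime_int by blast
  define q where "q = u' * i"
  have q: "[b * u * q = u'] (mod M)"
    by (rule cong_comb[OF i cong_refl[of 0], where a = u' and b = 0]) (simp add: q_def algebra_simps)
  have "coprime (- (b ^ 2 * u ^ 3)) M" using cop by simp
  from cong_coprime[OF w2 this] have u': "coprime u' M" by simp
  from cong_coprime[OF q this] have qc: "coprime q M" by simp
  have q2: "[q ^ 2 * v = - u] (mod M)"
  proof (rule cong_cancel)
    show "[(b * u) ^ 2 * (q ^ 2 * v) = (b * u) ^ 2 * (- u)] (mod M)"
      by (rule cong_comb[OF q w2, where a = "(b * u * q + u') * v" and b = 1])
        (simp add: algebra_simps power2_eq_square power3_eq_cube)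
    show "coprime ((b * u) ^ 2) M" using bu by simp
  qed
  define C where "C = f k"
  have "coprime (f 0) M" using cong_coprime[OF init] by simp
  moreover have step0: "coprime (f (m + k)) M \<and> coprime (f (m - k)) M" if "coprime (f m) M" for m
  proof -
    have "coprime (- (u * v) * f m ^ 2) M" using that cop by simp
    from cong_coprime[OF r1 this] show ?thesis by simp
  qed
  ultimately have C: "coprime C M" using step0[of 0] by (simp add: C_def)
  have step1: "[f (m + 1 + k) = C * q ^ Suc n * f (m + 1)] (mod M)"
    if m: "coprime (f m) M" and P: "[f (m + k) = C * q ^ n * f m] (mod M)" for m n
  proof (rule cong_cancel)
    define B where "B = f (m - k)"
    have A: "[b * f (m + 1 + k) * B = - (v * u') * f (m + 1) * f m] (mod M)"
      using r2[of m] by (simp add: B_def algebra_simps)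
    have "[(B * f m) * (b * u * f (m + 1 + k)) = (B * f m) * (u' * C * q ^ n * f (m + 1))] (mod M)"
      by (rule cong_comb3[OF A r1[of m] P, where a = "u * f m" and b = "- u' * f (m + 1)"
            and c = "u' * f (m + 1) * B"])
        (simp add: B_def algebra_simps power2_eq_square)
    hence "[b * u * f (m + 1 + k) = u' * C * q ^ n * f (m + 1)] (mod M)"
      by (rule cong_cancel) (use step0[OF m] m in \<open>simp add: B_def\<close>)
    thus "[(b * u) * f (m + 1 + k) = (b * u) * (C * q ^ Suc n * f (m + 1))] (mod M)"
      by (rule cong_comb[OF _ q, where a = 1 and b = "- C * q ^ n * f (m + 1)"])
        (simp add: algebra_simps)
  qed (rule bu)
  have step2: "[f (m + 2 + k) = C * q ^ Suc (Suc n) * f (m + 2)] (mod M)"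
    if m: "coprime (f m) M" and P: "[f (m + k) = C * q ^ n * f m] (mod M)" for m n
  proof (rule cong_cancel)
    define B where "B = f (m - k)"
    have A: "[f (m + 2 + k) * B = u ^ 2 * f (m + 2) * f m] (mod M)"
      using r3[of "m + 1"] by (simp add: B_def algebra_simps)
    have "[(B * f m * u) * (v * f (m + 2 + k)) = (B * f m * u) * (- u * C * q ^ n * f (m + 2))] (mod M)"
      by (rule cong_comb3[OF A r1[of m] P, where a = "f m * u * v" and b = "u ^ 2 * f (m + 2)"
            and c = "- (u ^ 2) * f (m + 2) * B"])
        (simp add: B_def algebra_simps power2_eq_square)
    hence "[v * f (m + 2 + k) = - u * C * q ^ n * f (m + 2)] (mod M)"
      by (rule cong_cancel) (use step0[OF m] m cop in \<open>simp add: B_def\<close>)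
    thus "[v * f (m + 2 + k) = v * (C * q ^ Suc (Suc n) * f (m + 2))] (mod M)"
      by (rule cong_comb[OF _ q2, where a = 1 and b = "- C * q ^ n * f (m + 2)"])
        (simp add: algebra_simps power2_eq_square)
  qed (rule cop)
  have P: "[f (int n + k) = C * q ^ n * f (int n)] (mod M) \<and>
    [f (int n + 1 + k) = C * q ^ Suc n * f (int n + 1)] (mod M)" for n
  proof (induction n)
    case 0
    have P0: "[f (0 + k) = C * q ^ 0 * f 0] (mod M)"
      by (rule cong_comb[OF init cong_refl[of 0], where a = "- C" and b = 0]) (simp add: C_def algebra_simps)
    moreover have "coprime (f 0) M" using cong_coprime[OF init] by simp
    ultimately show ?case using step1[OF _ P0] by simp
  next
    \<comment> \<open>The invariant covers two neighbours. If f n is a unit, two steps at once lead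
      to n + 2; otherwise f (n + 1) is a unit and one step suffices.\<close>
    case (Suc n)
    have "[f (int n + 2 + k) = C * q ^ Suc (Suc n) * f (int n + 2)] (mod M)"
      using units[of "int n"] Suc step2[of "int n" n] step1[of "int n + 1" "Suc n"]
      by (auto simp: algebra_simps)
    with Suc show ?case by (simp add: algebra_simps)
  qed
  obtain j where j: "[q * j = 1] (mod M)" using qc cong_solve_coprime_int by blast
  define c where "c = C * j"
  have cq: "[C = c * q] (mod M)"
    by (rule cong_comb[OF j cong_refl[of 0], where a = "- C" and b = 0]) (simp add: c_def algebra_simps)
  have cc: "coprime c M" using cong_coprime[OF cong_sym[OF cq] C] by simp
  \<comment> \<open>Index -1 is needed because \<open>Omega_val\<close> at 1 refers to it. As f (-
    1) may be a nonunit, it is reached from 0 through \<open>r2'\<close>, where the cofactor f (- k)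
    is a unit.\<close>
  have m1: "[f (- 1 + k) = c * f (- 1)] (mod M)"
  proof (rule cong_cancel)
    have "[C * f (0 - k) = - (u * v) * f 0 ^ 2] (mod M)" using r1[of 0] by (simp add: C_def)
    hence D: "[C * f (- k) = - (u * v)] (mod M)"
      by (rule cong_comb[OF _ init, where a = 1 and b = "- (u * v) * (f 0 + 1)"])
        (simp add: algebra_simps power2_eq_square)
    have A: "[b * f (- 1 + k) * f (- k) = - (v' * u) * f 0 * f (- 1)] (mod M)"
      using r2'[of "- 1"] by (simp add: algebra_simps)
    have A': "[b * f (- 1 + k) * f (- k) = - (v' * u) * f (- 1)] (mod M)"
      by (rule cong_comb[OF A init, where a = 1 and b = "- (v' * u) * f (- 1)"])
        (simp add: algebra_simps)
    have "[u * (v * b * f (- 1 + k)) = u * (v' * C * f (- 1))] (mod M)"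
      by (rule cong_comb[OF A' D, where a = "- C" and b = "b * f (- 1 + k)"])
        (simp add: algebra_simps)
    hence E: "[v * b * f (- 1 + k) = v' * C * f (- 1)] (mod M)"
      by (rule cong_cancel) (use cop in simp)
    have E2: "[v * b * f (- 1 + k) = v' * (c * q) * f (- 1)] (mod M)"
      by (rule cong_comb[OF E cq, where a = 1 and b = "v' * f (- 1)"]) (simp add: algebra_simps)
    have "[v' * b * u * q = b ^ 2 * u * v] (mod M)"
      by (rule cong_comb[OF q w1, where a = v' and b = 1]) (simp add: algebra_simps)
    thus "[(b ^ 2 * u * v) * f (- 1 + k) = (b ^ 2 * u * v) * (c * f (- 1))] (mod M)"
      by (rule cong_comb[OF E2, where a = "b * u" and b = "c * f (- 1)"])
        (simp add: algebra_simps power2_eq_square)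
  qed (use cop in simp)
  show ?thesis
  proof (rule that[OF cc qc q2])
    show "[f k = c * q] (mod M)" using cq by (simp add: C_def)
    show "[f (int n - 1 + k) = c * q ^ n * f (int n - 1)] (mod M)" for n
    proof (cases n)
      case 0
      then show ?thesis using m1 by simp
    next
      case (Suc l)
      have "[f (int l + k) = C * q ^ l * f (int l)] (mod M)" using P by blast
      hence "[f (int l + k) = c * q ^ Suc l * f (int l)] (mod M)"
        by (rule cong_comb[OF _ cq, where a = 1 and b = "q ^ l * f (int l)"])
          (simp add: algebra_simps)
      thus ?thesis using Suc by simp
    qed
  qed
qed

text \<open>
  A shift by \<open>k T\<close> introduces a power of \<open>q\<close> with exponent \<open>k T (T - 1) / 2\<close> up to a multiple of \<open>T\<close>.
  The denominator \<open>2\<close> is harmless because \<open>q ^ (k + 2)\<close> is the square of the unit \<open>u\<close>.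
\<close>

lemma periodic_shift:
  fixes f :: "int \<Rightarrow> int" and k M :: int and N :: nat
  assumes init: "[f 0 = 1] (mod M)"
    and r1: "\<And>m. [f (m + k) * f (m - k) = - (u * v) * f m ^ 2] (mod M)"
    and r2: "\<And>m. [b * f (m + k + 1) * f (m - k) = - (v * u') * f (m + 1) * f m] (mod M)"
    and r2': "\<And>m. [b * f (m + k) * f (m - k + 1) = - (v' * u) * f (m + 1) * f m] (mod M)"
    and r3: "\<And>m. [f (m + k + 1) * f (m - k - 1) = u ^ 2 * f (m + 1) * f (m - 1)] (mod M)"
    and cop: "coprime u M" "coprime v M" "coprime b M"
    and w1: "[u' * v' = b ^ 2 * u * v] (mod M)" and w2: "[u' ^ 2 * v = - (b ^ 2 * u ^ 3)] (mod M)"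
    and units: "\<And>m. m \<ge> 0 \<Longrightarrow> coprime (f m) M \<or> coprime (f (m + 1)) M"
    and k: "k \<ge> 0" and N: "\<And>x. coprime x M \<Longrightarrow> [x ^ N = 1] (mod M)" "even N" and m: "m \<ge> - 1"
  shows "[f (m + k * int N) = f m] (mod M)"
proof -
  obtain c q where cq: "coprime c M" "coprime q M" "[q ^ 2 * v = - u] (mod M)" "[f k = c * q] (mod M)"
    "\<And>n. [f (int n - 1 + k) = c * q ^ n * f (int n - 1)] (mod M)"
    using geometric_shift[OF init r1 r2 r2' r3 cop w1 w2 units] by blast
  define K where "K = nat k"
  have K: "k = int K" using k by (simp add: K_def)
  \<comment> \<open>The T shifts contribute powers of q with exponents n, n + K, ..., n + (T - 1) K,
    which add up to the stated exponent.\<close>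
  have iter: "[f (int n - 1 + k * int T) = c ^ T * q ^ (n * T + K * (T choose 2)) * f (int n - 1)] (mod M)" for n T
  proof (induction T)
    case 0
    show ?case by (simp add: binomial_eq_0)
  next
    case (Suc T)
    have e: "int (n + K * T) - 1 = int n - 1 + k * int T" by (simp add: K)
    have "[f (int n - 1 + k * int T + k) = c * q ^ (n + K * T) * f (int n - 1 + k * int T)] (mod M)"
      using cq(5)[of "n + K * T"] unfolding e .
    also have "[c * q ^ (n + K * T) * f (int n - 1 + k * int T)
      = c * q ^ (n + K * T) * (c ^ T * q ^ (n * T + K * (T choose 2)) * f (int n - 1))] (mod M)"
      by (rule cong_mult[OF cong_refl Suc])
    also have "c * q ^ (n + K * T) * (c ^ T * q ^ (n * T + K * (T choose 2)) * f (int n - 1))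
      = c ^ Suc T * q ^ ((n + K * T) + (n * T + K * (T choose 2))) * f (int n - 1)"
      by (simp add: power_add)
    also have "(n + K * T) + (n * T + K * (T choose 2)) = n * Suc T + K * (Suc T choose 2)"
      by (simp add: numeral_2_eq_2 algebra_simps)
    finally show ?case by (simp add: algebra_simps)
  qed
  \<comment> \<open>Compares two expressions for f (2 k): the geometric law at index k and
    \<open>r1\<close> at m = k.\<close>
  have qk: "[q ^ (K + 2) = u ^ 2] (mod M)"
  proof (rule cong_cancel)
    have e: "int (2 * K + 1) - 1 = k + k" "int (K + 1) - 1 = k" by (simp_all add: K)
    have fk: "[f (k + k) = c * q ^ (K + 1) * f k] (mod M)"
      using cq(5)[of "K + 1"] unfolding e by simp
    have r: "[f (k + k) * f 0 = - (u * v) * f k ^ 2] (mod M)" using r1[of k] by simp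
    have "coprime (c * q) M" using cq by simp
    hence fkc: "coprime (f k) M" using cong_coprime[OF cq(4)] by blast
    have "[f k * (c * q ^ (K + 1)) = f k * (- (u * v) * f k)] (mod M)"
      by (rule cong_comb3[OF r init fk, where a = 1 and b = "- f (k + k)" and c = "- 1"])
        (simp add: algebra_simps power2_eq_square)
    hence "[c * q ^ (K + 1) = - (u * v) * f k] (mod M)" using fkc by (rule cong_cancel)
    hence "[c * q ^ (K + 1) = - (u * v) * (c * q)] (mod M)"
      by (rule cong_comb[OF _ cq(4), where a = 1 and b = "- (u * v)"]) (simp add: algebra_simps)
    thus "[(c * q) * q ^ (K + 2) = (c * q) * u ^ 2] (mod M)"
      by (rule cong_comb[OF _ cq(3), where a = "q ^ 2" and b = "- u * (c * q)"])
        (simp add: algebra_simps power2_eq_square)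
    show "coprime (c * q) M" by fact
  qed
  obtain h where h: "N = 2 * h" using N(2) by blast
  define H where "H = h * (N - 1)"
  have choose: "N choose 2 = H"
    by (simp add: H_def h choose_two)
  have one: "[x ^ (N * i) = 1] (mod M)" if "coprime x M" for x i
    using cong_pow[OF N(1)[OF that], of i] by (simp add: power_mult)
  \<comment> \<open>As 2 H = N (N - 1), both q ^ (2 H) and u ^ (2 H) are N-th powers of units, hence
    1; so q ^ (K H) = q ^ ((K + 2) H) = u ^ (2 H) = 1.\<close>
  have qH: "[q ^ (K * H) = 1] (mod M)"
  proof -
    have "[q ^ ((K + 2) * H) = (u ^ 2) ^ H] (mod M)"
      unfolding power_mult by (rule cong_pow[OF qk])
    also have "(u ^ 2) ^ H = u ^ (N * (N - 1))"
      by (simp add: H_def h power_mult[symmetric] mult.assoc)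
    also have "[\<dots> = 1] (mod M)" by (rule one[OF cop(1)])
    finally have "[q ^ ((K + 2) * H) = 1] (mod M)" .
    moreover have "q ^ ((K + 2) * H) = q ^ (K * H) * q ^ (N * (N - 1))"
    proof -
      have "(K + 2) * H = K * H + N * (N - 1)"
        by (simp add: H_def h add_mult_distrib mult.assoc)
      thus ?thesis by (simp only: power_add)
    qed
    ultimately have A: "[q ^ (K * H) * q ^ (N * (N - 1)) = 1] (mod M)" by simp
    show ?thesis
      by (rule cong_comb[OF A one[OF cq(2), of "N - 1"], where a = 1 and b = "- (q ^ (K * H))"])
        (simp add: algebra_simps)
  qed
  define n where "n = nat (m + 1)"
  have mn: "m = int n - 1" using m by (simp add: n_def)
  have "[c ^ N * q ^ (n * N + K * H) * f (int n - 1) = 1 * (1 * 1) * f (int n - 1)] (mod M)"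
    unfolding power_add
    by (intro cong_mult cong_refl N(1) cq(1) qH) (use one[OF cq(2), of n] in \<open>simp add: mult.commute\<close>)
  with iter[of n N] show ?thesis unfolding choose mn by (simp add: cong_trans)
qed

section \<open>Multiples of a zero of the division sequence\<close>

text \<open>Two neighbouring nonunits would make \<open>\<beta> * w k ^ 2\<close> divisible by
  \<open>p\<close> for the entry before them. The bound \<open>a\<close> is 0 for the division
  sequence and -1 for the translated one.\<close>

lemma somos_consecutive_units:
  fixes w :: "int \<Rightarrow> rat"
  assumes p: "prime p" and I: "\<And>k. k \<ge> a \<Longrightarrow> p_integral p (w k)" and \<alpha>: "p_integral p \<alpha>"
    and \<beta>: "p_unit p \<beta>" and W: "\<And>k. k \<ge> a + 2 \<Longrightarrow> somos_at \<alpha> \<beta> w k"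
    and base: "p_unit p (w (a + 1)) " "p_unit p (w (a + 2))"
    and k: "k \<ge> a + 1"
  shows "p_unit p (w k) \<or> p_unit p (w (k + 1))"
  using k
proof (induction k rule: int_ge_induct)
  case base
  then show ?case using assms(6) by simp
next
  case (step k)
  show ?case
  proof (rule ccontr)
    assume n: "\<not> ?thesis"
    hence uk: "p_unit p (w k)" using step.IH by auto
    have ka: "k \<ge> a + 2"
    proof (rule ccontr)
      assume "\<not> k \<ge> a + 2"
      hence "k = a + 1" using step.hyps by simp
      thus False using n assms(7) by (simp add: add.commute)
    qed
    have n1: "\<not> p_unit p (w (k + 1))" and n2: "\<not> p_unit p (w (k + 2))"
      using n by (simp_all add: add.assoc)
    have I1: "p_integral p (w (k + 1))" and I2: "p_integral p (w (k + 2))"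
      using ka by (simp_all add: I)
    obtain y where y: "p_integral p y" "w (k + 1) = of_nat p * y"
      by (rule not_unit_multiple[OF p I1 n1])
    obtain z where z: "p_integral p z" "w (k + 2) = of_nat p * z"
      by (rule not_unit_multiple[OF p I2 n2])
    have "\<beta> * w k ^ 2 = of_nat p * (\<alpha> * y * w (k - 1) - z * w (k - 2))"
      using W[OF ka] y z by (simp add: somos_at_def algebra_simps)
    moreover have "p_unit p (\<beta> * w k ^ 2)" using p_unit_mult p_unit_power p uk \<beta> by blast
    moreover have "p_integral p (\<alpha> * y * w (k - 1) - z * w (k - 2))"
      using ka by (intro p_integral_intros p y z I \<alpha>) simp_all
    ultimately show False using p_unit_not_multiple[OF p] by metis
  qed
qed

context
  fixes p :: nat and red :: "rat \<Rightarrow> 'p::prime_card mod_ring"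
    and w :: "int \<Rightarrow> rat" and \<alpha> \<beta> J :: rat
  assumes p: "p = CARD('p)"
  defines "red \<equiv> reduce"
  assumes w: "w 0 = 0" "w 1 = 1" "w 2 ^ 2 = \<alpha>" "w 3 = \<beta>"
    and nz: "\<And>k. k \<ge> 1 \<Longrightarrow> w k \<noteq> 0"
    and W: "\<And>k. k \<ge> 2 \<Longrightarrow> somos_at \<alpha> \<beta> w k" "\<And>k. k \<ge> 2 \<Longrightarrow> cubic_at \<alpha> J w k"
    and I: "p_unit p (w 2)" "p_unit p \<beta>" "p_integral p J"
begin

lemma division_integral: "k \<ge> 0 \<Longrightarrow> p_integral p (w k)"
  using division_sequence_integral[OF prime_p[OF p] w nz W I(1) _ I(3)] I(2)
  by (simp add: p_unit_def)

lemma division_bilinear: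
  assumes "k \<ge> 1" "m - k \<ge> 1"
  shows "bilinear_even_at w w k m" "bilinear_odd_at w w k m"
  using division_sequence_bilinear[OF w nz W assms] by blast+

lemma division_neighbour_units:
  assumes "k \<ge> 2" "\<not> p_unit p (w k)"
  shows "p_unit p (w (k + 1))" "p_unit p (w (k - 1))"
proof -
  have \<alpha>: "p_integral p \<alpha>" using I(1) p_integral_power[OF prime_p[OF p]] w(3) by (auto simp: p_unit_def)
  have one: "p_unit p (w 1)" using w(2) by (simp add: p_unit_def p_integral_1 prime_p[OF p])
  have "p_unit p (w j) \<or> p_unit p (w (j + 1))" if "j \<ge> 1" for j
    by (rule somos_consecutive_units[where a = 0, OF prime_p[OF p] _ \<alpha> I(2)])
       (use W I one that division_integral in simp_all)
  from this[of k] this[of "k - 1"] show "p_unit p (w (k + 1))" "p_unit p (w (k - 1))"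
    using assms by simp_all
qed

lemma reduce_division:
  "i \<ge> 0 \<Longrightarrow> red (w i) = 0 \<longleftrightarrow> \<not> p_unit p (w i)"
  unfolding red_def by (rule reduce_eq_0_iff[OF p division_integral])

text \<open>
  With \<open>V\<^sub>n = w (n k) / w k\<close> and \<open>c\<^sup>2 = - w (k + 1) w (k - 1)\<close>, the even relations modulo \<open>p\<close> say
  \<open>V\<^sub>n\<^sub>+\<^sub>1 V\<^sub>n\<^sub>-\<^sub>1 = c ^ 2 * V\<^sub>n ^ 2 - c ^ (2 * n ^ 2)\<close>, whose solution \<open>n * c ^ (n ^ 2 - 1)\<close> vanishes
  at \<open>n = p\<close>.
\<close>

lemma division_multiple:
  assumes k: "k \<ge> 2" and wk: "\<not> p_unit p (w k)"
  obtains z where "p_integral p z" "w (int p * k) = w k * (of_nat p * z)"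
proof -
  note pp = prime_p[OF p]
  note hom = reduce_hom[OF p, folded red_def]
  note wi = division_integral
  let ?r = red
  have wk0: "w k \<noteq> 0" using k nz by simp
  have rk: "?r (w k) = 0" using reduce_division[of k] k wk by simp
  have ab0: "?r (w (k + 1)) \<noteq> 0" "?r (w (k - 1)) \<noteq> 0" "?r (w 2) \<noteq> 0"
    using reduce_division division_neighbour_units[OF k wk] I(1) k by simp_all
  define C where "C = ?r (w (k + 1)) * ?r (w (k - 1))"
  have C0: "C \<noteq> 0" using ab0 by (simp add: C_def)
  define U where "U n = w (int n * k + 1) * w (int n * k - 1)" for n
  define V where "V n = w (int n * k) / w k" for n
  have pos: "int n * k \<ge> 2" if "n \<ge> 1" for n
    using mult_mono[of 1 "int n" 2 k] that k by simp
  have UI: "p_integral p (U n)" if "n \<ge> 1" for n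
    unfolding U_def using pos[OF that] by (intro p_integral_mult pp wi) simp_all
  have idx: "int (Suc n) * k = int n * k + k" "int (n - 1) * k = int n * k - k" if "n \<ge> 1" for n
    using that by (simp_all add: algebra_simps of_nat_diff)
  \<comment> \<open>Multiplies the even relations for k + 1 and k - 1, whose last terms vanish
    modulo \<open>p\<close>.\<close>
  have Urec: "?r (U (Suc n)) * ?r (U (n - 1)) = C ^ 2 * ?r (U n) ^ 2" if n: "n \<ge> 2" for n
  proof -
    define m where "m = int n * k"
    have mk: "m \<ge> k + k" using mult_right_mono[of 2 "int n" k] n k by (simp add: m_def)
    have e1: "w (m + k + 1) * w (m - k - 1) = w (k + 1) ^ 2 * w (m + 1) * w (m - 1) - w (k + 2) * w k * w m ^ 2"
      using division_bilinear(1)[of "k + 1" m] k mk by (simp add: bilinear_even_at_def algebra_simps)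
    have e2: "w (m + k - 1) * w (m - k + 1) = w (k - 1) ^ 2 * w (m + 1) * w (m - 1) - w k * w (k - 2) * w m ^ 2"
      using division_bilinear(1)[of "k - 1" m] k mk by (simp add: bilinear_even_at_def algebra_simps)
    have r1: "?r (w (m + k + 1) * w (m - k - 1)) = ?r (w (k + 1)) ^ 2 * (?r (w (m + 1)) * ?r (w (m - 1)))"
      unfolding e1 using k mk by (simp add: hom p_integral_intros pp wi rk)
    have r2: "?r (w (m + k - 1) * w (m - k + 1)) = ?r (w (k - 1)) ^ 2 * (?r (w (m + 1)) * ?r (w (m - 1)))"
      unfolding e2 using k mk by (simp add: hom p_integral_intros pp wi rk)
    have n1: "n \<ge> 1" using n by simp
    have US: "U (Suc n) = w (m + k + 1) * w (m + k - 1)"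
      and UP: "U (n - 1) = w (m - k + 1) * w (m - k - 1)"
      unfolding U_def idx(1)[OF n1] idx(2)[OF n1] m_def by (rule refl)+
    have "?r (U (Suc n)) * ?r (U (n - 1))
        = ?r (w (m + k + 1) * w (m - k - 1)) * ?r (w (m + k - 1) * w (m - k + 1))"
      unfolding US UP using k mk by (simp add: hom p_integral_intros pp wi mult_ac)
    also have "\<dots> = C ^ 2 * (?r (w (m + 1)) * ?r (w (m - 1))) ^ 2"
      unfolding r1 r2 C_def by (simp add: power2_eq_square mult_ac)
    also have "?r (w (m + 1)) * ?r (w (m - 1)) = ?r (U n)"
      unfolding U_def using k mk by (simp add: hom p_integral_intros pp wi m_def[symmetric])
    finally show ?thesis .
  qed
  have U1: "?r (U 1) = C" unfolding U_def C_def using k by (simp add: hom p_integral_intros pp wi)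
  \<comment> \<open>\<open>Urec\<close> cannot start from U 0, which contains w (- 1), about which
    nothing is assumed; so U 2 is computed by doubling.\<close>
  have U2: "?r (U 2) = - (C ^ 4)"
  proof -
    have e1: "w (2 * k + 1) = w k ^ 2 * w (k + 2) * w k - w (k + 1) * w (k - 1) * w (k + 1) ^ 2"
      using division_bilinear(1)[of k "k + 1"] k w by (simp add: bilinear_even_at_def algebra_simps)
    have e2: "w (2 * k - 1) = w (k - 1) ^ 2 * w (k + 1) * w (k - 1) - w k * w (k - 2) * w k ^ 2"
      using division_bilinear(1)[of "k - 1" k] k w by (simp add: bilinear_even_at_def algebra_simps)
    have r1: "?r (w (2 * k + 1)) = - C * ?r (w (k + 1)) ^ 2"
      unfolding e1 C_def using k by (simp add: hom p_integral_intros pp wi rk)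
    have r2: "?r (w (2 * k - 1)) = C * ?r (w (k - 1)) ^ 2"
      unfolding e2 C_def using k by (simp add: hom p_integral_intros pp wi rk power2_eq_square mult_ac)
    have "?r (U 2) = ?r (w (2 * k + 1)) * ?r (w (2 * k - 1))"
      unfolding U_def using k by (simp add: hom p_integral_intros pp wi)
    thus ?thesis unfolding r1 r2 by (simp add: C_def power4_eq_xxxx power2_eq_square mult_ac)
  qed
  define s where "s = - C"
  have s0: "s \<noteq> 0" and C: "C = - s" using C0 by (simp_all add: s_def)
  have U: "?r (U n) = - (s ^ (n ^ 2))" if "n \<ge> 1" for n
    using that
  proof (induction n rule: less_induct)
    case (less n)
    consider "n = 1" | "n = 2" | "n \<ge> 3" using less.prems by linarith
    then show ?case
    proof cases
      case 3
      then obtain j where j: "n = Suc (Suc j)" "j \<ge> 1" by (metis Suc_le_D Suc_le_mono numeral_3_eq_3 One_nat_def)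
      have "?r (U n) * (- (s ^ (j ^ 2))) = C ^ 2 * (- (s ^ ((Suc j) ^ 2))) ^ 2"
        using Urec[of "Suc j"] less.IH[of j] less.IH[of "Suc j"] j by simp
      also have "\<dots> = s ^ 2 * s ^ ((Suc j) ^ 2 * 2)"
        by (simp add: C power_mult)
      also have "\<dots> = s ^ (n ^ 2) * s ^ (j ^ 2)"
        unfolding power_add[symmetric] by (rule arg_cong[of _ _ "\<lambda>i. s ^ i"])
          (simp add: j power2_eq_square algebra_simps)
      finally have "?r (U n) * (- (s ^ (j ^ 2))) = - (s ^ (n ^ 2)) * (- (s ^ (j ^ 2)))" by simp
      moreover have "- (s ^ (j ^ 2)) \<noteq> 0" using s0 by simp
      ultimately show ?thesis using mult_right_cancel by blast
    qed (use U1 U2 C in simp_all)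
  qed
  have V1: "V 1 = 1" using wk0 by (simp add: V_def)
  define x y where "x = ?r (w (k + 2))" and "y = ?r (w (k - 2))"
  define a b where "a = ?r (w (k - 1))" and "b = ?r (w (k + 1))"
  have V2: "w 2 * V 2 = w (k - 1) ^ 2 * w (k + 2) - w (k - 2) * w (k + 1) ^ 2"
  proof -
    have "w 2 * w (2 * k) = w k * (w (k - 1) ^ 2 * w (k + 2) - w (k - 2) * w (k + 1) ^ 2)"
      using division_bilinear(2)[of "k - 1" k] k w
      by (simp add: bilinear_odd_at_def algebra_simps power2_eq_square)
    thus ?thesis using wk0 by (simp add: V_def field_simps)
  qed
  have V2I: "p_integral p (V 2)"
  proof (rule p_unit_cancel[OF pp I(1)])
    show "p_integral p (w 2 * V 2)" unfolding V2 using k by (intro p_integral_intros pp wi) simp_all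
  qed
  have xa: "x * a ^ 2 = - (y * b ^ 2)"
  proof -
    have "w (k + 2) * w (k - 1) ^ 2 + w (k - 2) * w (k + 1) ^ 2 = w k * (J * w (k + 1) * w (k - 1) - \<alpha> * w k ^ 2)"
      using W(2)[OF k] by (simp add: cubic_at_def algebra_simps power2_eq_square power3_eq_cube)
    moreover have "p_integral p (J * w (k + 1) * w (k - 1) - \<alpha> * w k ^ 2)"
      unfolding w(3)[symmetric] using k by (intro p_integral_intros pp wi I) simp_all
    ultimately have "?r (w (k + 2) * w (k - 1) ^ 2 + w (k - 2) * w (k + 1) ^ 2) = 0"
      using k by (simp only: hom wi rk mult_zero_left)
    hence "x * a ^ 2 + y * b ^ 2 = 0"
      using k by (simp add: hom p_integral_intros pp wi x_def y_def a_def b_def)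
    thus ?thesis by (simp add: eq_neg_iff_add_eq_0)
  qed
  define d where "d = ?r (w 2)"
  have xy: "x * y = d ^ 2 * a * b"
  proof -
    have "w (k + 2) * w (k - 2) = w 2 ^ 2 * w (k + 1) * w (k - 1) - w k * (\<beta> * w k)"
      using W(1)[OF k] unfolding somos_at_def w(3)[symmetric] by (simp add: power2_eq_square)
    moreover have "p_integral p (\<beta> * w k)" using I(2) k by (intro p_integral_mult pp wi) (auto simp: p_unit_def)
    ultimately have "?r (w (k + 2) * w (k - 2)) = ?r (w 2 ^ 2 * w (k + 1) * w (k - 1))"
      using k by (simp add: hom p_integral_intros pp wi rk)
    thus ?thesis using k by (simp add: hom p_integral_intros pp wi x_def y_def a_def b_def d_def)
  qed
  have abd: "a \<noteq> 0" "b \<noteq> 0" "d \<noteq> 0" using ab0 by (simp_all add: a_def b_def d_def)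
  have sab: "s = - (a * b)" by (simp add: s_def C_def a_def b_def mult.commute)
  \<comment> \<open>A square root of \<open>s\<close>, that is of - w (k + 1) w (k - 1), modulo
    \<open>p\<close>: by \<open>xa\<close> and \<open>xy\<close>, c ^ 2 = - x y / d ^ 2 = - a b. The
    sign is chosen to fit V 2.\<close>
  define c where "c = - (x * a) / (d * b)"
  have cdb: "c * (d * b) = - (x * a)" using abd by (simp add: c_def)
  have cs: "c ^ 2 = s"
  proof -
    have "(d * b) ^ 2 * c ^ 2 = (d * b) ^ 2 * s"
      using cdb xa xy sab by Groebner_Basis.algebra
    thus ?thesis using abd by simp
  qed
  have c0: "c \<noteq> 0" using cs s0 by auto
  have rV2: "?r (V 2) = 2 * c ^ 3"
  proof -
    have "d * ?r (V 2) = ?r (w 2 * V 2)" unfolding d_def using V2I by (simp add: hom wi)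
    also have "\<dots> = a ^ 2 * x - y * b ^ 2"
      unfolding V2 using k by (simp add: hom p_integral_intros pp wi x_def y_def a_def b_def)
    finally have "(d * b) * ?r (V 2) = (d * b) * (2 * c ^ 3)"
      using cdb xa cs sab by Groebner_Basis.algebra
    thus ?thesis using abd by simp
  qed
  have Vrec: "V (Suc n) * V (n - 1) = U n - w (k + 1) * w (k - 1) * V n ^ 2" if n: "n \<ge> 2" for n
  proof -
    define m where "m = int n * k"
    have mk: "m \<ge> k + k" using mult_right_mono[of 2 "int n" k] n k by (simp add: m_def)
    have n1: "n \<ge> 1" using n by simp
    have A: "w (m + k) * w (m - k) = w k ^ 2 * w (m + 1) * w (m - 1) - w (k + 1) * w (k - 1) * w m ^ 2"
      using division_bilinear(1)[of k m] k mk by (simp add: bilinear_even_at_def)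
    have B: "V (Suc n) * V (n - 1) = w (m + k) * w (m - k) / w k ^ 2"
      unfolding V_def idx(1)[OF n1] idx(2)[OF n1] m_def[symmetric]
      by (simp add: power2_eq_square)
    have UV: "U n = w (m + 1) * w (m - 1)" "V n = w m / w k"
      by (simp_all only: U_def V_def m_def)
    show ?thesis unfolding B A UV using wk0 by (simp add: field_simps power2_eq_square)
  qed
  \<comment> \<open>The factor \<open>c\<close> avoids the truncated exponent n ^ 2 - 1. The step
    divides by V (n - 2), whose residue is nonzero as 0 < n - 2 < p; hence the bound n \<le>
    p.\<close>
  have V: "p_integral p (V n) \<and> c * ?r (V n) = of_nat n * c ^ (n ^ 2)" if "1 \<le> n" "n \<le> p" for n
    using that
  proof (induction n rule: less_induct)
    case (less n)
    consider "n = 1" | "n = 2" | "n \<ge> 3" using less.prems by linarith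
    then show ?case
    proof cases
      case 1
      then show ?thesis using V1 by (simp add: hom p_integral_1 pp)
    next
      case 2
      then show ?thesis using V2I rV2 by (simp add: power_numeral_reduce)
    next
      case 3
      then obtain j where j: "n = Suc (Suc j)" "j \<ge> 1" by (metis Suc_le_D Suc_le_mono numeral_3_eq_3 One_nat_def)
      have VI: "p_integral p (V j)" "p_integral p (V (Suc j))"
        and Vj: "c * ?r (V j) = of_nat j * c ^ (j ^ 2)"
        and Vsj: "c * ?r (V (Suc j)) = of_nat (Suc j) * c ^ ((Suc j) ^ 2)"
        using less.IH[of j] less.IH[of "Suc j"] j less.prems by simp_all
      have "\<not> int p dvd int j" using j less.prems zdvd_imp_le[of "int p" "int j"] by auto
      hence j0: "(of_nat j :: 'p mod_ring) \<noteq> 0"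
        using of_int_mod_ring_eq_0[OF p, of "int j"] by simp
      hence "?r (V j) \<noteq> 0" using Vj c0 by auto
      hence uj: "p_unit p (V j)" using reduce_eq_0_iff[OF p VI(1)] by (auto simp: red_def)
      have rec: "V j * V n = U (Suc j) - w (k + 1) * w (k - 1) * V (Suc j) ^ 2"
        using Vrec[of "Suc j"] j by (simp add: mult.commute)
      have "p_integral p (V j * V n)" unfolding rec
        using k by (intro p_integral_intros pp wi VI UI) simp_all
      hence VnI: "p_integral p (V n)" by (rule p_unit_cancel[OF pp uj])
      have "?r (V j) * ?r (V n) = ?r (U (Suc j)) - C * ?r (V (Suc j)) ^ 2"
      proof -
        have "?r (V j) * ?r (V n) = ?r (V j * V n)" by (simp add: hom VI VnI)
        thus ?thesis unfolding rec C_def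
          using k by (simp add: hom p_integral_intros pp wi VI UI)
      qed
      hence "(c * ?r (V j)) * (c * ?r (V n)) = c ^ 2 * ?r (U (Suc j)) - C * (c * ?r (V (Suc j))) ^ 2"
        by Groebner_Basis.algebra
      also have "\<dots> = (of_nat j * of_nat n) * c ^ (j ^ 2 + n ^ 2)"
      proof -
        define e where "e = (Suc j) ^ 2"
        have USj: "?r (U (Suc j)) = - ((c ^ 2) ^ e)" unfolding e_def cs by (rule U) simp
        have ce: "(c ^ 2) ^ e = (c ^ e) ^ 2" by (simp add: power_mult[symmetric] mult.commute)
        have "j ^ 2 + n ^ 2 = e + e + 2" by (simp add: e_def j power2_eq_square algebra_simps)
        hence pw: "c ^ (j ^ 2 + n ^ 2) = c ^ e * c ^ e * c ^ 2" by (simp only: power_add)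
        have "c ^ 2 * ?r (U (Suc j)) - C * (c * ?r (V (Suc j))) ^ 2
            = c ^ 2 * (c ^ e) ^ 2 * (of_nat (Suc j) ^ 2 - 1)"
          unfolding USj ce Vsj C cs[symmetric] e_def[symmetric]
          by (simp add: algebra_simps power2_eq_square)
        also have "of_nat (Suc j) ^ 2 - 1 = (of_nat j * of_nat n :: 'p mod_ring)"
          by (simp add: j algebra_simps power2_eq_square)
        finally show ?thesis unfolding pw by (simp add: algebra_simps power2_eq_square)
      qed
      also have "(of_nat j * of_nat n) * c ^ (j ^ 2 + n ^ 2)
          = (of_nat j * c ^ (j ^ 2)) * (of_nat n * c ^ (n ^ 2))"
        by (simp add: power_add)
      finally have "(of_nat j * c ^ (j ^ 2)) * (c * ?r (V n)) = (of_nat j * c ^ (j ^ 2)) * (of_nat n * c ^ (n ^ 2))"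
        unfolding Vj .
      moreover have "of_nat j * c ^ (j ^ 2) \<noteq> 0" using j0 c0 by simp
      ultimately have "c * ?r (V n) = of_nat n * c ^ (n ^ 2)" using mult_left_cancel by blast
      with VnI show ?thesis ..
    qed
  qed
  have p1: "p \<ge> 1" using prime_ge_1_nat[OF pp] .
  have "(of_nat p :: 'p mod_ring) = 0" using of_int_mod_ring_eq_0[OF p, of "int p"] by simp
  hence "?r (V p) = 0" using V[OF p1 order_refl] c0 by auto
  hence "\<not> p_unit p (V p)" using reduce_eq_0_iff[OF p] V[OF p1 order_refl] by (auto simp: red_def)
  then obtain z where "p_integral p z" "V p = of_nat p * z"
    using not_unit_multiple[OF pp] V[OF p1 order_refl] by blast
  moreover have "w (int p * k) = w k * V p" using wk0 by (simp add: V_def)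
  ultimately show ?thesis using that by metis
qed

lemma division_multiple_power:
  assumes k: "k \<ge> 2" and v: "v \<ge> 1" and wk: "p_integral p z" "w k = of_nat p ^ v * z"
  shows "\<exists>z. p_integral p z \<and> w (int p ^ i * k) = of_nat p ^ (v + i) * z"
proof (induction i)
  case 0
  then show ?case using wk by auto
next
  case (Suc i)
  then obtain z where z: "p_integral p z" "w (int p ^ i * k) = of_nat p ^ (v + i) * z" by blast
  note pp = prime_p[OF p]
  obtain n where n: "v + i = Suc n" using v by (cases "v + i") auto
  have "\<not> p_unit p (w (int p ^ i * k))"
  proof
    assume "p_unit p (w (int p ^ i * k))"
    hence "p_unit p (of_nat p * (of_nat p ^ n * z))" unfolding z(2) n by (simp add: mult.assoc)
    thus False using p_unit_not_multiple[OF pp] p_integral_intros pp z(1) by metis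
  qed
  moreover have "int p ^ i * k \<ge> 2"
    using mult_mono[of 1 "int p ^ i" 2 k] k prime_gt_0_nat[OF pp] by simp
  ultimately obtain y where "p_integral p y"
    "w (int p * (int p ^ i * k)) = w (int p ^ i * k) * (of_nat p * y)"
    using division_multiple by blast
  hence "w (int p ^ Suc i * k) = of_nat p ^ (v + Suc i) * (z * y)" "p_integral p (z * y)"
    using z pp by (simp_all add: mult_ac p_integral_mult)
  thus ?case by blast
qed

end

section \<open>Congruences of integral rationals\<close>

text \<open>\<open>rat_cong\<close> by itself is not compatible with products; with both sides
  integral it is.\<close>

definition padic_cong :: "nat \<Rightarrow> nat \<Rightarrow> rat \<Rightarrow> rat \<Rightarrow> bool" where
  "padic_cong p l u v \<longleftrightarrow> p_integral p u \<and> p_integral p v \<and> rat_cong p l u v"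

context
  fixes p l :: nat
  assumes p: "prime p"
begin

lemma padic_cong_iff: "padic_cong p l u v \<longleftrightarrow>
  p_integral p u \<and> p_integral p v \<and> (\<exists>z. p_integral p z \<and> u - v = of_nat p ^ l * z)"
  by (simp add: padic_cong_def rat_cong_def)

lemma padic_cong_refl: "p_integral p u \<Longrightarrow> padic_cong p l u u"
  unfolding padic_cong_iff using p_integral_0[OF p] by auto

lemma padic_cong_sym: "padic_cong p l u v \<Longrightarrow> padic_cong p l v u"
  unfolding padic_cong_iff using p_integral_uminus[OF p]
  by (metis minus_diff_eq mult_minus_right)

lemma padic_cong_add:
  assumes "padic_cong p l u v" "padic_cong p l x y" shows "padic_cong p l (u + x) (v + y)"
proof -
  obtain a b where "p_integral p a" "u - v = of_nat p ^ l * a" "p_integral p b" "x - y = of_nat p ^ l * b"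
    using assms by (auto simp: padic_cong_iff)
  moreover from this have "u + x - (v + y) = of_nat p ^ l * (a + b)" by (simp add: algebra_simps)
  ultimately show ?thesis using assms p_integral_add[OF p] unfolding padic_cong_iff by blast
qed

lemma padic_cong_mult:
  assumes "padic_cong p l u v" "padic_cong p l x y" shows "padic_cong p l (u * x) (v * y)"
proof -
  obtain a b where ab: "p_integral p a" "u - v = of_nat p ^ l * a" "p_integral p b" "x - y = of_nat p ^ l * b"
    using assms by (auto simp: padic_cong_iff)
  have "u * x - v * y = (u - v) * x + v * (x - y)" by (simp add: algebra_simps)
  hence "u * x - v * y = of_nat p ^ l * (a * x + v * b)" unfolding ab by (simp add: algebra_simps)
  moreover have "p_integral p (a * x + v * b)"
    using assms ab by (intro p_integral_add p_integral_mult p) (auto simp: padic_cong_iff)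
  ultimately show ?thesis using assms p_integral_mult[OF p] unfolding padic_cong_iff by blast
qed

lemma padic_cong_uminus: "padic_cong p l u v \<Longrightarrow> padic_cong p l (- u) (- v)"
  using padic_cong_mult[OF padic_cong_refl[of "- 1"]] p_integral_uminus[OF p p_integral_1[OF p]]
  by fastforce

lemma padic_cong_diff:
  "padic_cong p l u v \<Longrightarrow> padic_cong p l x y \<Longrightarrow> padic_cong p l (u - x) (v - y)"
  using padic_cong_add[of u v "- x" "- y"] padic_cong_uminus by simp

lemma padic_cong_power: "padic_cong p l u v \<Longrightarrow> padic_cong p l (u ^ n) (v ^ n)"
  by (induction n) (simp_all add: padic_cong_refl p_integral_1 p padic_cong_mult)

lemmas padic_cong_intros = padic_cong_add padic_cong_mult padic_cong_uminus padic_cong_diff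
  padic_cong_power

lemma padic_cong_trans:
  assumes "padic_cong p l u v" "padic_cong p l v x" shows "padic_cong p l u x"
  using padic_cong_diff[OF padic_cong_add[OF assms] padic_cong_refl[of v]] assms
  by (simp add: padic_cong_def)

lemma p_integral_quotient_of_int:
  assumes "p_integral p z" "of_int a = of_nat p ^ l * z"
  shows "int p ^ l dvd a"
proof -
  obtain c d where cd: "coprime d (int p)" "d \<noteq> 0" "z = of_int c / of_int d"
    using assms(1) p_integral_alt[OF p] by blast
  have "of_int (a * d) = (of_int (int p ^ l * c) :: rat)" using assms(2) cd by simp
  hence "a * d = int p ^ l * c" by (simp only: of_int_eq_iff)
  hence "int p ^ l dvd a * d" by simp
  moreover have "coprime (int p ^ l) d" using cd(1) by (simp add: coprime_commute)
  ultimately show ?thesis by (simp add: coprime_dvd_mult_left_iff)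
qed

lemma padic_cong_of_int_iff: "padic_cong p l (of_int a) (of_int b) \<longleftrightarrow> [a = b] (mod int p ^ l)"
proof
  assume "padic_cong p l (of_int a) (of_int b)"
  then obtain z where "p_integral p z" "of_int (a - b) = of_nat p ^ l * z"
    by (auto simp: padic_cong_iff)
  thus "[a = b] (mod int p ^ l)" using p_integral_quotient_of_int cong_iff_dvd_diff by blast
next
  assume "[a = b] (mod int p ^ l)"
  then obtain c where "a - b = int p ^ l * c" by (auto simp: cong_iff_dvd_diff)
  hence "(of_int a - of_int b :: rat) = of_nat p ^ l * of_int c"
    by (metis of_int_diff of_int_mult of_int_of_nat_eq of_int_power)
  thus "padic_cong p l (of_int a) (of_int b)"
    using p_integral_of_int[OF p] by (auto simp: padic_cong_iff)
qed

lemma padic_cong_of_int_unique: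
  "padic_cong p l u (of_int a) \<Longrightarrow> padic_cong p l u (of_int b) \<Longrightarrow> [a = b] (mod int p ^ l)"
  using padic_cong_trans padic_cong_sym padic_cong_of_int_iff by blast

text \<open>Modulo p ^ l the denominator is invertible, so every residue class contains an integer,
  and the shift argument can be carried out over the integers.\<close>

lemma padic_cong_integer:
  assumes "p_integral p u"
  obtains a where "padic_cong p l u (of_int a)"
proof -
  obtain c d where cd: "coprime d (int p)" "d \<noteq> 0" "u = of_int c / of_int d"
    using assms p_integral_alt[OF p] by blast
  have "coprime d (int p ^ l)" using cd(1) by simp
  then obtain e where "[d * e = 1] (mod int p ^ l)" using cong_solve_coprime_int by blast
  then obtain f where "d * e - 1 = int p ^ l * f" by (auto simp: cong_iff_dvd_diff)
  hence "(of_int d * of_int e - 1 :: rat) = of_nat p ^ l * of_int f"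
    by (metis of_int_1 of_int_diff of_int_mult of_int_of_nat_eq of_int_power)
  moreover have "u - of_int (c * e) = - u * (of_int d * of_int e - 1)"
    using cd by (simp add: field_simps)
  ultimately have "u - of_int (c * e) = of_nat p ^ l * (- u * of_int f)" by simp
  moreover have "p_integral p (- u * of_int f)" by (intro p_integral_intros p assms)
  ultimately show ?thesis using that p_integral_of_int[OF p] assms unfolding padic_cong_iff by blast
qed

lemma p_unit_integer_coprime:
  assumes l: "l \<ge> 1" and "padic_cong p l u (of_int a)" "p_unit p u"
  shows "coprime a (int p ^ l)"
proof -
  have pp: "prime (int p)" using p by simp
  have "\<not> int p dvd a"
  proof
    assume "int p dvd a"
    then obtain b where b: "a = int p * b" by blast
    obtain z where z: "p_integral p z" "u - of_int a = of_nat p ^ l * z"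
      using assms(2) by (auto simp: padic_cong_iff)
    obtain n where n: "l = Suc n" using l by (cases l) auto
    have "u = of_nat p * (of_int b + of_nat p ^ n * z)" using z(2) by (simp add: b n algebra_simps)
    moreover have "p_integral p (of_int b + of_nat p ^ n * z)" by (intro p_integral_intros p z)
    ultimately show False using p_unit_not_multiple[OF p] assms(3) by metis
  qed
  hence "coprime a (int p)" using pp by (meson coprime_commute prime_imp_coprime)
  thus ?thesis by simp
qed

lemma euler_theorem_prime_power:
  assumes l: "l \<ge> 1" and x: "coprime x (int p ^ l)"
  shows "[x ^ (p ^ (l - 1) * (p - 1)) = 1] (mod int p ^ l)"
proof -
  define y where "y = nat (x mod int p ^ l)"
  have "int p ^ l > 0" using prime_gt_0_nat[OF p] by simp
  hence y: "int y = x mod int p ^ l" by (simp add: y_def)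
  hence xy: "[x = int y] (mod int p ^ l)" by (simp add: cong_def)
  have "coprime (int y) (int p ^ l)" using cong_coprime[OF cong_sym[OF xy] x] .
  hence "coprime y (p ^ l)" by (metis coprime_int_iff of_nat_power)
  hence "[y ^ totient (p ^ l) = 1] (mod p ^ l)" by (rule euler_theorem)
  hence "[int y ^ totient (p ^ l) = 1] (mod int p ^ l)"
    by (metis cong_int_iff of_nat_1 of_nat_power)
  moreover have "totient (p ^ l) = p ^ (l - 1) * (p - 1)"
    using totient_prime_power[of p l] p l by simp
  ultimately show ?thesis using cong_pow[OF xy] cong_trans by metis
qed

end

section \<open>From the denominator of a multiple to congruences of the sequence\<close>

lemma rat_ord_inverse:
  assumes p: "prime p" and v: "v \<ge> 1" and ord: "rat_ord p x \<le> - 2 * int v"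
  shows "x \<noteq> 0 \<and> (\<exists>z. p_integral p z \<and> inverse x = of_nat p ^ (2 * v) * z)"
proof -
  obtain m d where md: "quotient_of x = (m, d)" by fastforce
  have d: "d > 0" "coprime m d" and x: "x = of_int m / of_int d"
    using quotient_of_denom_pos[OF md] quotient_of_coprime[OF md] quotient_of_div[OF md] by simp_all
  have pp: "prime (int p)" using p by simp
  have ord': "int (multiplicity (int p) m) + 2 * int v \<le> int (multiplicity (int p) d)"
    using ord by (simp add: rat_ord_def md)
  hence dv: "2 * v \<le> multiplicity (int p) d" by linarith
  hence dvd: "int p ^ (2 * v) dvd d" by (rule multiplicity_dvd')
  \<comment> \<open>Here v \<ge> 1 excludes x = 0, to which \<open>rat_ord\<close> assigns 0: its
    denominator is 1.\<close>
  hence "int p dvd d" using v by (metis dvd_power dvd_trans mult_is_0 not_one_le_zero zero_neq_numeral neq0_conv)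
  hence nm: "\<not> int p dvd m" using d(2) pp by (metis coprime_common_divisor not_prime_unit)
  hence m: "coprime m (int p)" "m \<noteq> 0"
    using pp by (meson coprime_commute prime_imp_coprime, auto)
  obtain e where e: "d = int p ^ (2 * v) * e" using dvd by blast
  have "inverse x = of_nat p ^ (2 * v) * (of_int e / of_int m)" by (simp add: x e)
  moreover have "p_integral p (of_int e / of_int m)" using m p_integral_alt[OF p] by blast
  moreover have "x \<noteq> 0" using m d by (simp add: x)
  ultimately show ?thesis by blast
qed

text \<open>After multiplication by 1 / x, which p ^ (2 v) divides, the equation makes w ^ 2
  divisible by p ^ (2 v); integral closedness takes the square root.\<close>

lemma division_value_divisible:
  assumes p: "prime p" and v: "v \<ge> 1" and I: "p_integral p x1" "p_integral p w" "p_integral p c"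
    and eq: "(x1 - x) * w ^ 2 = c" and ord: "rat_ord p x \<le> - 2 * int v"
  shows "\<exists>z. p_integral p z \<and> w = of_nat p ^ v * z"
proof -
  obtain y where y: "p_integral p y" "inverse x = of_nat p ^ (2 * v) * y" and x0: "x \<noteq> 0"
    using rat_ord_inverse[OF p v ord] by blast
  have p0: "(of_nat p :: rat) \<noteq> 0" using p by auto
  define z where "z = w / of_nat p ^ v"
  have wz: "w = of_nat p ^ v * z" using p0 by (simp add: z_def)
  have "x * w ^ 2 = x1 * w ^ 2 - c" using eq by (simp add: algebra_simps)
  hence "w ^ 2 = (x1 * w ^ 2 - c) * inverse x" using x0 by (simp add: field_simps)
  hence "of_nat p ^ (2 * v) * z ^ 2 = of_nat p ^ (2 * v) * ((x1 * w ^ 2 - c) * y)"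
    unfolding y(2) by (simp add: wz power_mult_distrib power_mult mult_ac power_commutes flip: power_mult)
  hence "z ^ 2 + 0 * z = (x1 * w ^ 2 - c) * y" using p0 by simp
  moreover have "p_integral p ((x1 * w ^ 2 - c) * y)" by (intro p_integral_intros p I y)
  ultimately have "p_integral p z"
    using p_integral_monic_quadratic[OF p p_integral_0[OF p]] by blast
  with wz show ?thesis by blast
qed

text \<open>Transfers \<open>periodic_shift\<close> from integers to integral rationals through
  representatives. The four relations it wants are the even ones for k and k + 1 and the odd ones
  for k and k - 1, with w k replaced by 0.\<close>

lemma translated_sequence_periodic:
  fixes f w :: "int \<Rightarrow> rat"
  assumes p: "prime p" "odd p" and l: "l \<ge> 1"
    and f: "f 0 = 1" "f 1 = 1" "\<And>m. somos_at \<alpha> \<beta> f m"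
    and bil: "\<And>k m. k \<ge> 1 \<Longrightarrow> bilinear_even_at w f k m" "\<And>k m. k \<ge> 1 \<Longrightarrow> bilinear_odd_at w f k m"
    and fI: "\<And>m. p_integral p (f m)" and wI: "\<And>k. k \<ge> 0 \<Longrightarrow> p_integral p (w k)"
    and W: "somos_at \<alpha> \<beta> w k" "cubic_at \<alpha> J w k" and \<alpha>: "\<alpha> = w 2 ^ 2"
    and k: "k \<ge> 2" and wk: "padic_cong p l (w k) 0"
    and units: "p_unit p (w (k + 1))" "p_unit p (w (k - 1))" "p_unit p (w 2)" "p_unit p \<beta>"
    and J: "p_integral p J"
    and consecutive: "\<And>m. m \<ge> 0 \<Longrightarrow> p_unit p (f m) \<or> p_unit p (f (m + 1))"
    and m: "m \<ge> - 1"
  shows "padic_cong p l (f (m + k * int (p ^ (l - 1) * (p - 1)))) (f m)"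
proof -
  let ?pc = "padic_cong p l"
  let ?M = "int p ^ l"
  define rep where "rep u = (SOME a. ?pc u (of_int a))" for u
  have rep: "?pc u (of_int (rep u))" if "p_integral p u" for u
    unfolding rep_def by (rule padic_cong_integer[OF p(1) that, of l]) (rule someI)
  define F where "F m = rep (f m)" for m
  define U V B U' V' where "U = rep (w (k + 1))" and "V = rep (w (k - 1))" and "B = rep (w 2)"
    and "U' = rep (w (k + 2))" and "V' = rep (w (k - 2))"
  have F: "?pc (f m) (of_int (F m))" for m unfolding F_def by (intro rep fI)
  have Wr: "?pc (w (k + 1)) (of_int U)" "?pc (w (k - 1)) (of_int V)" "?pc (w 2) (of_int B)"
    "?pc (w (k + 2)) (of_int U')" "?pc (w (k - 2)) (of_int V')"
    using k wI by (auto simp: U_def V_def B_def U'_def V'_def intro!: rep)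
  note pcs = padic_cong_intros[OF p(1)] F Wr wk
  note uniq = padic_cong_of_int_unique[OF p(1), of l]
  have init: "[F 0 = 1] (mod ?M)"
    by (rule uniq[OF F]) (simp add: f padic_cong_refl p p_integral_1)
  have r1: "[F (i + k) * F (i - k) = - (U * V) * F i ^ 2] (mod ?M)" for i
  proof (rule uniq)
    show "?pc (f (i + k) * f (i - k)) (of_int (F (i + k) * F (i - k)))"
      unfolding of_int_mult by (intro pcs)
    have "?pc (w k ^ 2 * f (i + 1) * f (i - 1) - w (k + 1) * w (k - 1) * f i ^ 2)
      (0 ^ 2 * of_int (F (i + 1)) * of_int (F (i - 1)) - of_int U * of_int V * of_int (F i) ^ 2)"
      by (intro pcs)
    thus "?pc (f (i + k) * f (i - k)) (of_int (- (U * V) * F i ^ 2))"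
      using bil(1)[of k i] k by (simp add: bilinear_even_at_def)
  qed
  have r2: "[B * F (i + k + 1) * F (i - k) = - (V * U') * F (i + 1) * F i] (mod ?M)" for i
  proof (rule uniq)
    show "?pc (w 2 * f (i + k + 1) * f (i - k)) (of_int (B * F (i + k + 1) * F (i - k)))"
      unfolding of_int_mult by (intro pcs)
    have "?pc (w k * w (k + 1) * f (i + 2) * f (i - 1) - w (k - 1) * w (k + 2) * f (i + 1) * f i)
      (0 * of_int U * of_int (F (i + 2)) * of_int (F (i - 1)) - of_int V * of_int U' * of_int (F (i + 1)) * of_int (F i))"
      by (intro pcs)
    thus "?pc (w 2 * f (i + k + 1) * f (i - k)) (of_int (- (V * U') * F (i + 1) * F i))"
      using bil(2)[of k i] k by (simp add: bilinear_odd_at_def)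
  qed
  have r2': "[B * F (i + k) * F (i - k + 1) = - (V' * U) * F (i + 1) * F i] (mod ?M)" for i
  proof (rule uniq)
    show "?pc (w 2 * f (i + k) * f (i - k + 1)) (of_int (B * F (i + k) * F (i - k + 1)))"
      unfolding of_int_mult by (intro pcs)
    have "?pc (w (k - 1) * w k * f (i + 2) * f (i - 1) - w (k - 2) * w (k + 1) * f (i + 1) * f i)
      (of_int V * 0 * of_int (F (i + 2)) * of_int (F (i - 1)) - of_int V' * of_int U * of_int (F (i + 1)) * of_int (F i))"
      by (intro pcs)
    moreover have "w 2 * f (i + k) * f (i - k + 1)
        = w (k - 1) * w k * f (i + 2) * f (i - 1) - w (k - 2) * w (k + 1) * f (i + 1) * f i"
      using bil(2)[of "k - 1" i] k by (simp add: bilinear_odd_at_def algebra_simps)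
    ultimately show "?pc (w 2 * f (i + k) * f (i - k + 1)) (of_int (- (V' * U) * F (i + 1) * F i))"
      by simp
  qed
  have r3: "[F (i + k + 1) * F (i - k - 1) = U ^ 2 * F (i + 1) * F (i - 1)] (mod ?M)" for i
  proof (rule uniq)
    show "?pc (f (i + k + 1) * f (i - k - 1)) (of_int (F (i + k + 1) * F (i - k - 1)))"
      unfolding of_int_mult by (intro pcs)
    have "?pc (w (k + 1) ^ 2 * f (i + 1) * f (i - 1) - w (k + 2) * w k * f i ^ 2)
      (of_int U ^ 2 * of_int (F (i + 1)) * of_int (F (i - 1)) - of_int U' * 0 * of_int (F i) ^ 2)"
      by (intro pcs)
    moreover have "f (i + k + 1) * f (i - k - 1)
        = w (k + 1) ^ 2 * f (i + 1) * f (i - 1) - w (k + 2) * w k * f i ^ 2"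
      using bil(1)[of "k + 1" i] k by (simp add: bilinear_even_at_def algebra_simps)
    ultimately show "?pc (f (i + k + 1) * f (i - k - 1)) (of_int (U ^ 2 * F (i + 1) * F (i - 1)))"
      by simp
  qed
  have cop: "coprime U ?M" "coprime V ?M" "coprime B ?M"
    using p_unit_integer_coprime[OF p(1) l] Wr units by blast+
  have \<alpha>I: "p_integral p \<alpha>" "p_integral p \<beta>"
    using units(3,4) p_integral_power[OF p(1)] by (auto simp: \<alpha> p_unit_def)
  have w1: "[U' * V' = B ^ 2 * U * V] (mod ?M)"
  proof (rule uniq)
    show "?pc (w (k + 2) * w (k - 2)) (of_int (U' * V'))"
      unfolding of_int_mult by (intro pcs)
    have "?pc (w 2 ^ 2 * w (k + 1) * w (k - 1) - \<beta> * w k ^ 2)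
      (of_int B ^ 2 * of_int U * of_int V - \<beta> * 0 ^ 2)"
      by (intro pcs padic_cong_refl p \<alpha>I)
    thus "?pc (w (k + 2) * w (k - 2)) (of_int (B ^ 2 * U * V))"
      using W(1) by (simp add: somos_at_def \<alpha>)
  qed
  have cub: "[U' * V ^ 2 + V' * U ^ 2 = 0] (mod ?M)"
  proof (rule uniq)
    show "?pc (w (k + 2) * w (k - 1) ^ 2 + w (k - 2) * w (k + 1) ^ 2) (of_int (U' * V ^ 2 + V' * U ^ 2))"
      unfolding of_int_mult of_int_add of_int_power by (intro pcs)
    have "?pc (J * w (k + 1) * w k * w (k - 1) - \<alpha> * w k ^ 3)
      (J * of_int U * 0 * of_int V - \<alpha> * 0 ^ 3)"
      by (intro pcs padic_cong_refl p \<alpha>I J)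
    thus "?pc (w (k + 2) * w (k - 1) ^ 2 + w (k - 2) * w (k + 1) ^ 2) (of_int 0)"
      using W(2) by (simp add: cubic_at_def)
  qed
  \<comment> \<open>Multiplied by V, this is U' times the cubic relation minus U ^ 2 times the Somos
    relation.\<close>
  have w2: "[U' ^ 2 * V = - (B ^ 2 * U ^ 3)] (mod ?M)"
  proof (rule cong_cancel)
    show "[V * (U' ^ 2 * V) = V * (- (B ^ 2 * U ^ 3))] (mod ?M)"
      by (rule cong_comb[OF cub w1, where a = "U'" and b = "- (U ^ 2)"])
        (simp add: algebra_simps power2_eq_square power3_eq_cube)
  qed (rule cop)
  have un: "coprime (F i) ?M \<or> coprime (F (i + 1)) ?M" if "i \<ge> 0" for i
    using consecutive[OF that] p_unit_integer_coprime[OF p(1) l F] by blast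
  have k0: "k \<ge> 0" using k by simp
  have ev: "even (p ^ (l - 1) * (p - 1))" using p(2) by simp
  have "[F (m + k * int (p ^ (l - 1) * (p - 1))) = F m] (mod ?M)"
    by (rule periodic_shift[OF init r1 r2 r2' r3 cop w1 w2 un k0 euler_theorem_prime_power[OF p(1) l] ev m])
  hence "?pc (of_int (F (m + k * int (p ^ (l - 1) * (p - 1))))) (of_int (F m))"
    by (simp add: padic_cong_of_int_iff p)
  thus ?thesis using padic_cong_trans[OF p(1)] padic_cong_sym[OF p(1)] F by blast
qed

section \<open>Periodicity\<close>

lemma infinite_order_multiple_nonzero:
  "infinite_order E P \<Longrightarrow> n \<ge> 1 \<Longrightarrow> point_mult E n P \<noteq> Infinity"
  by (simp add: infinite_order_def)

lemma distinct_abscissae: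
  fixes E :: "'a::field weierstrass"
  assumes on: "weierstrass_eq E x1 y1 = 0" "weierstrass_eq E x2 y2 = 0"
    and ne: "point_add E (Affine x2 y2) (Affine x1 y1) \<noteq> Infinity"
      "point_add E (Affine x2 y2) (point_neg E (Affine x1 y1)) \<noteq> Infinity"
  shows "x1 \<noteq> x2"
proof
  assume x: "x1 = x2"
  have "(y2 - y1) * (y2 + y1 + a1 E * x1 + a3 E) = weierstrass_eq E x2 y2 - weierstrass_eq E x1 y1"
    by (simp add: x weierstrass_eq_def algebra_simps power2_eq_square)
  hence "y2 = y1 \<or> y2 + y1 + a1 E * x1 + a3 E = 0" using on by simp
  thus False using ne x by auto
qed

theorem theorem1p2:
  fixes E :: "rat weierstrass"
    and P1 P2 :: "rat point"
    and p r v :: nat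
    and Psi :: "int \<Rightarrow> mpoly_indet"
    and Ebar :: "'p::prime_card mod_ring weierstrass"
    and P1bar P2bar :: "'p mod_ring point"
  assumes p: "prime p" "odd p" "p = CARD('p)"
    and E: "elliptic_curve E" "p_integral_curve p E"
    and P1: "on_curve E P1" "infinite_order E P1"
    and P2: "on_curve E P2" "infinite_order E P2"
    and reductions: "Ebar = reduce_curve E" "P1bar = reduce_point P1" "P2bar = reduce_point P2"
    and nonsingular: "nonsingular_point Ebar P1bar" "nonsingular_point Ebar P2bar"
    and defined: "point_add E P2 P1 \<noteq> Infinity" "point_add E P2 (point_neg E P1) \<noteq> Infinity"
    and defined_mod_p: "\<not> cong_infinity p 1 P2" "\<not> cong_infinity p 1 (point_add E P2 P1)"
    and r: "has_order Ebar P1bar r" "r > 3"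
    and v: "v \<ge> 1" "cong_infinity p v (point_mult E r P1)"
           "\<And>k. k \<ge> 1 \<Longrightarrow> cong_infinity p k (point_mult E r P1) \<Longrightarrow> k \<le> v"
    and Psi: "translated_division_polynomials Psi"
  shows "\<forall>l\<ge>1. \<exists>t t'. t dvd p ^ (l - 1) * (p - 1) \<and> t' dvd p ^ (l - 1) * (p - 1) \<and>
           purely_periodic_mod p l (\<lambda>n. Phi_val Psi E P1 P2 (int n)) (r_level p v r l * t) \<and>
           purely_periodic_mod p l (\<lambda>n. Omega_val Psi E P1 P2 (int n)) (r_level p v r l * t')"
proof (intro allI impI)
  fix l :: nat
  assume l: "l \<ge> 1"
  \<comment> \<open>The multiples 1, 2 and 3 make the coordinates of P1 integral,
    \<open>beta1\<close> a unit and \<open>beta2\<close> a unit, in this order.\<close>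
  have bar_nz: "point_mult Ebar m P1bar \<noteq> Infinity" if "1 \<le> m" "m \<le> 3" for m
    using r that by (simp add: has_order_def)
  have "P1bar \<noteq> Infinity" using bar_nz[of 1] point_mult_1[of Ebar P1bar] by simp
  then obtain x1 y1 where P1a: "P1 = Affine x1 y1" and I1: "p_integral p x1" "p_integral p y1"
    using reductions(2) p(3) by (cases P1) (auto split: if_splits)
  have P1bar: "P1bar = Affine (reduce x1) (reduce y1)"
    using I1 by (simp add: reductions P1a p(3)[symmetric])
  have "P2 \<noteq> Infinity"
    using infinite_order_multiple_nonzero[OF P2(2), of 1] point_mult_1[of E P2] by simp
  then obtain x2 y2 where P2a: "P2 = Affine x2 y2" by (cases P2) auto
  have on1: "weierstrass_eq E x1 y1 = 0" and on2: "weierstrass_eq E x2 y2 = 0"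
    using P1(1) P2(1) by (simp_all add: P1a P2a)
  have nz1: "point_mult E m (Affine x1 y1) \<noteq> Infinity"
    and nz2: "point_mult E m (Affine x2 y2) \<noteq> Infinity" if "1 \<le> m" for m
    using infinite_order_multiple_nonzero P1(2) P2(2) that unfolding P1a P2a by blast+
  have I2: "p_integral p x2" "p_integral p y2"
    using affine_point_p_integral[OF p(1) E(2) on2] defined_mod_p(1) by (simp_all add: P2a)
  have ne: "x1 \<noteq> x2" using distinct_abscissae[OF on1 on2] defined by (simp add: P1a P2a)

  define \<alpha> \<beta> J where "\<alpha> = beta1 E x1 y1 ^ 2" and "\<beta> = beta2 E x1" and "J = jinv E x1"
  have b1: "beta1 E x1 y1 \<noteq> 0" and b1': "beta1 E x2 y2 \<noteq> 0"
    by (rule beta1_nonzero, rule nz1, simp, rule beta1_nonzero, rule nz2, simp)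
  note curve = p(3) E(2)
  have betaI: "p_integral p (beta1 E x1 y1)" "p_integral p \<beta>" "p_integral p J"
    using beta_integral[OF curve I1] by (simp_all add: \<beta>_def J_def)
  have b1u: "p_unit p (beta1 E x1 y1)"
  proof -
    have "beta1 Ebar (reduce x1) (reduce y1) \<noteq> 0"
      using bar_nz[of 2] by (intro beta1_nonzero) (simp add: P1bar)
    thus ?thesis using reduce_beta(1)[OF curve I1] reduce_eq_0_iff[OF p(3) betaI(1)]
      by (simp add: reductions(1))
  qed
  have \<beta>u: "p_unit p \<beta>"
  proof -
    have "weierstrass_eq Ebar (reduce x1) (reduce y1) = 0"
      using nonsingular(1) by (simp add: P1bar)
    hence "beta2 Ebar (reduce x1) \<noteq> 0"
      using bar_nz by (intro beta2_nonzero) (simp_all add: P1bar)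
    thus ?thesis using reduce_beta(2)[OF curve I1] reduce_eq_0_iff[OF p(3) betaI(2)]
      by (simp add: reductions(1) \<beta>_def)
  qed
  have \<alpha>I: "p_integral p \<alpha>" using betaI(1) p_integral_power[OF p(1)] by (simp add: \<alpha>_def)

  obtain w :: "int \<Rightarrow> rat" where w: "w 0 = 0" "w 1 = 1" "w 2 = beta1 E x1 y1" "w 3 = \<beta>"
    and wnz: "\<And>k. k \<ge> 1 \<Longrightarrow> w k \<noteq> 0"
    and W: "\<And>k. k \<ge> 2 \<Longrightarrow> somos_at \<alpha> \<beta> w k" "\<And>k. k \<ge> 2 \<Longrightarrow> cubic_at \<alpha> J w k"
    and wx: "\<And>n. n \<ge> 2 \<Longrightarrow> (x1 - x_of (point_mult E n (Affine x1 y1))) * w (int n) ^ 2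
             = w (int n + 1) * w (int n - 1)"
    using division_sequence_exists[OF on1 nz1] unfolding \<alpha>_def \<beta>_def J_def by blast
  have w2: "w 2 ^ 2 = \<alpha>" by (simp add: w \<alpha>_def)
  have w2u: "p_unit p (w 2)" using b1u w by simp
  note ctx = p(3) w(1,2) w2 w(4) wnz W w2u \<beta>u betaI(3)
  have wI: "p_integral p (w k)" if "k \<ge> 0" for k
    using division_integral[OF ctx that] .

  define f where "f = Psi_val Psi E P1 P2"
  have W': "k \<ge> 2 \<Longrightarrow> somos_at (beta1 E x1 y1 ^ 2) (beta2 E x1) w k"
    "k \<ge> 2 \<Longrightarrow> cubic_at (beta1 E x1 y1 ^ 2) (jinv E x1) w k" for k
    using W unfolding \<alpha>_def \<beta>_def J_def by blast+
  have rels: "f (- 1) = x1 - x2" "f 0 = 1" "f 1 = 1"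
    "f 2 = xdiff_add E x1 x2 ((y2 - y1) / (x2 - x1))"
    "somos_at \<alpha> \<beta> f m" "cubic_at \<alpha> J f m"
    "k \<ge> 1 \<Longrightarrow> bilinear_even_at w f k m" "k \<ge> 1 \<Longrightarrow> bilinear_odd_at w f k m" for k m
    using Psi_val_relations[where w = w, OF Psi on1 b1 on2 b1' ne w(1-3) w(4)[unfolded \<beta>_def] W']
    unfolding f_def P1a P2a \<alpha>_def \<beta>_def J_def by blast+
  \<comment> \<open>The points may have congruent abscissae modulo \<open>p\<close>, so the
    integrality of the slope is inferred from P2 + P1 not reducing to O.\<close>
  have f2I: "p_integral p (f 2)"
  proof -
    define s where "s = (y2 - y1) / (x2 - x1)"
    have s: "s = (y1 - y2) / (x1 - x2)"
      unfolding s_def by (metis minus_diff_eq minus_divide_divide)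
    have "point_add E P2 P1 = Affine (s ^ 2 + a1 E * s - a2 E - x2 - x1)
        (s * (x2 - (s ^ 2 + a1 E * s - a2 E - x2 - x1)) - y2 - a1 E * (s ^ 2 + a1 E * s - a2 E - x2 - x1) - a3 E)"
      unfolding P1a P2a s using ne
      by (simp only: point_add.simps Let_def ne[symmetric] simp_thms if_False)
    hence ord: "- 2 < rat_ord p (s ^ 2 + a1 E * s - a2 E - x2 - x1)"
      using defined_mod_p(2) by simp
    have I: "p_integral p (a2 E + x2 + x1)"
      by (intro p_integral_intros p curve_coeffs_integral[OF curve] I1 I2)
    have "p_integral p s"
      by (rule slope_p_integral[OF p(1) curve_coeffs_integral(1)[OF curve] I _ ord]) simp
    thus ?thesis unfolding rels(4) s_def[symmetric] xdiff_add_def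
      by (intro p_integral_intros p curve_coeffs_integral[OF curve] I1 I2)
  qed
  have fm1: "p_integral p (f (- 1))"
    unfolding rels(1) by (intro p_integral_intros p(1) I1 I2)
  have fI: "p_integral p (f m)" for m
    by (rule translated_sequence_integral[OF p(1) rels(2,3,5,6,7) wI \<alpha>I betaI(2,3) fm1 f2I])

  define k where "k = int (r_level p v r l)"
  have r2: "int r \<ge> 2" using r(2) by simp
  have wr: "\<exists>z. p_integral p z \<and> w (int r) = of_nat p ^ v * z"
  proof (rule division_value_divisible[OF p(1) v(1) I1(1) wI _ wx])
    show "rat_ord p (x_of (point_mult E r (Affine x1 y1))) \<le> - 2 * int v"
      using v(2) nz1[of r] r(2) unfolding P1a
      by (cases "point_mult E r (Affine x1 y1)") simp_all
  qed (use r(2) wI p(1) in \<open>auto intro!: p_integral_mult\<close>)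
  have k2: "k \<ge> 2"
  proof -
    have "r \<le> r_level p v r l"
      using prime_gt_0_nat[OF p(1)] by (simp add: r_level_def)
    thus ?thesis using r(2) by (simp add: k_def)
  qed
  have "\<exists>z. p_integral p z \<and> w k = of_nat p ^ l * z"
  proof -
    obtain z where z: "p_integral p z" "w (int r) = of_nat p ^ v * z" using wr by blast
    show ?thesis
    proof (cases "l \<ge> v")
      case True
      have "k = int p ^ (l - v) * int r" using True by (simp add: k_def r_level_def)
      with division_multiple_power[OF ctx r2 v(1) z, of "l - v"] True show ?thesis by simp
    next
      case False
      hence "w k = of_nat p ^ l * (of_nat p ^ (v - l) * z)"
        by (simp add: k_def r_level_def z(2) mult.assoc[symmetric] power_add[symmetric])
      moreover have "p_integral p (of_nat p ^ (v - l) * z)" by (intro p_integral_intros p(1) z(1))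
      ultimately show ?thesis by blast
    qed
  qed
  then obtain z where z: "p_integral p z" "w k = of_nat p ^ l * z" by blast
  have wk: "padic_cong p l (w k) 0"
    using z wI[of k] k2 p_integral_0[OF p(1)] by (auto simp: padic_cong_def rat_cong_def)
  have wkn: "\<not> p_unit p (w k)"
  proof
    assume "p_unit p (w k)"
    moreover obtain n where "l = Suc n" using l by (cases l) auto
    ultimately have "p_unit p (of_nat p * (of_nat p ^ n * z))" using z(2) by (simp add: mult.assoc)
    moreover have "p_integral p (of_nat p ^ n * z)" by (intro p_integral_intros p(1) z(1))
    ultimately show False by (rule p_unit_not_multiple[OF p(1)])
  qed
  have one: "p_unit p 1" using p_integral_1[OF p(1)] by (simp add: p_unit_def)
  have consecutive: "p_unit p (f m) \<or> p_unit p (f (m + 1))" if "m \<ge> 0" for m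
    by (rule somos_consecutive_units[where a = "- 1", OF p(1) fI \<alpha>I \<beta>u])
       (use rels(2,3,5) one that in simp_all)

  define N where "N = p ^ (l - 1) * (p - 1)"
  define per where "per = r_level p v r l * N"
  have per: "int per = k * int N" by (simp add: per_def k_def)
  \<comment> \<open>The bound -1 is what \<open>Omega_val\<close> requires at n = 1, where the
    smallest index is n - 2.\<close>
  have shift: "padic_cong p l (f (m + int per)) (f m)" if "m \<ge> - 1" for m
    unfolding per N_def
    by (rule translated_sequence_periodic[OF p(1,2) l rels(2,3,5,7,8) fI wI _ _ w2[symmetric] k2 wk _ _ w2u \<beta>u
          betaI(3) consecutive that])
       (use W k2 division_neighbour_units[OF ctx k2 wkn] in auto)
  note pcs = padic_cong_intros[OF p(1)] padic_cong_refl[OF p(1)]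
  have sel: "x_of P1 = x1" "y_of P1 = y1" by (simp_all add: P1a)
  have Phi: "padic_cong p l (Phi_val Psi E P1 P2 (m + int per)) (Phi_val Psi E P1 P2 m)"
    if "m \<ge> 1" for m
  proof -
    have s: "padic_cong p l (f (m + int per + i)) (f (m + i))" if "i \<ge> - 2" for i
      using shift[of "m + i"] that \<open>m \<ge> 1\<close> by (simp add: add_ac)
    note s' = s[of 0, simplified] s[of 1, simplified] s[of "- 1", simplified]
    show ?thesis unfolding Phi_val_def f_def[symmetric] sel
      by (intro pcs s' I1)
  qed
  have two: "p_unit p 2"
  proof (rule ccontr)
    assume "\<not> p_unit p 2"
    with not_unit_multiple[OF p(1) p_integral_numeral[OF p(1)]]
    obtain z where z: "p_integral p z" "2 = of_nat p * z" by metis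
    have "(of_int 2 :: rat) = of_nat p ^ 1 * z" using z(2) by simp
    from p_integral_quotient_of_int[OF p(1) z(1) this] have "int p dvd int 2" by simp
    hence "p dvd 2" by (simp only: int_dvd_int_iff)
    hence "p = 2" by (rule primes_dvd_imp_eq[OF p(1) two_is_prime_nat])
    thus False using p(2) by simp
  qed
  have Omega: "padic_cong p l (Omega_val Psi E P1 P2 (m + int per)) (Omega_val Psi E P1 P2 m)"
    if "m \<ge> 1" for m
  proof -
    have s: "padic_cong p l (f (m + int per + i)) (f (m + i))" if "i \<ge> - 2" for i
      using shift[of "m + i"] that \<open>m \<ge> 1\<close> by (simp add: add_ac)
    note s' = s[of 0, simplified] s[of 1, simplified] s[of "- 1", simplified]
      s[of 2, simplified] s[of "- 2", simplified]
    have inv: "p_integral p (inverse (2 * beta1 E x1 y1))"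
      using p_unit_mult[OF p(1) two b1u] by (simp add: p_unit_def)
    show ?thesis unfolding Omega_val_def Let_def f_def[symmetric] divide_inverse sel
      by (intro pcs s' Phi[OF that] inv betaI curve_coeffs_integral[OF curve])
  qed
  have "per \<ge> 1"
    using k2 prime_gt_1_nat[OF p(1)] by (simp add: per_def N_def k_def Suc_le_eq)
  hence "purely_periodic_mod p l (\<lambda>n. Phi_val Psi E P1 P2 (int n)) (r_level p v r l * N)"
    "purely_periodic_mod p l (\<lambda>n. Omega_val Psi E P1 P2 (int n)) (r_level p v r l * N)"
    using Phi Omega by (simp_all add: purely_periodic_mod_def padic_cong_def per_def[symmetric])
  thus "\<exists>t t'. t dvd p ^ (l - 1) * (p - 1) \<and> t' dvd p ^ (l - 1) * (p - 1) \<and>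
           purely_periodic_mod p l (\<lambda>n. Phi_val Psi E P1 P2 (int n)) (r_level p v r l * t) \<and>
           purely_periodic_mod p l (\<lambda>n. Omega_val Psi E P1 P2 (int n)) (r_level p v r l * t')"
    by (intro exI[of _ N] conjI) (simp_all add: N_def)
qed

end
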